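(* Let $L$ be a complete ortholattice, and let $\kappa$ be any cardinal. Then: (1) There is a complete ortholattice $\bar L$ extending $L$ (i.e. containing $L$ as a subortholattice) such that every function $f:L\to L$ is represented by an orthopolynomial of $\bar L$, i.e. for every $f:L\to L$ there is a unary orthopolynomial $p(\mathtt{x})$ with coefficients in $\bar L$ such that $p(a)=f(a)$ for all $a\in L$. Moreover, $\bar L$ can be chosen to be of the form $\mathrm{ortho}(L_1,L)$ with $L\trianglelefteq L_1$; in particular, $L$ will be convex in $\bar L$. Moreover, $\bar L$ can be chosen to be $\kappa$-power closed. (2) There is a complete ortholattice $\hat L$ extending $L$ such that for every natural number $n$, for every function $f:\hat L^n\to\hat L$ and for every set $A\subseteq \hat L^n$ of cardinality $\le\kappa$ there is an orthopolynomial $p(\mathtt{x}_1,\ldots,\mathtt{x}_n)$ with coefficients in $\hat L$ that interpolates $f$ at every point of $A$, i.e. $p(a_1,\ldots,a_n)=f(a_1,\ldots,a_n)$ for all $(a_1,\ldots,a_n)\in A$.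
   Context: An ortholattice is a bounded lattice $(L,\vee,\wedge,0,1)$ with a unary operation $x\mapsto x^{\perp}$ satisfying, for all $x,y$: $x\le y\Rightarrow x^\perp\ge y^\perp$, $(x^\perp)^\perp=x$, $x\vee x^\perp=1$, $x\wedge x^\perp=0$. A subortholattice is a subset closed under $\vee,\wedge,{}^\perp$ and containing $0,1$. An ortholattice is complete if it is complete as a partial order. An orthopolynomial with coefficients in an ortholattice $M$ is a term built from variables and elements of $M$ using $\vee,\wedge,{}^\perp$. For bounded lattices, $L_0\le L_1$ means that $L_0$ is a $\{0,1\}$-sublattice of $L_1$ (a sublattice with the same least and greatest elements). $L_0\trianglelefteq L_1$ means: (a) $L_0\le L_1$; (b) for every $x\in L_1$ the set $\{z\in L_0: z\le_{L_1}x\}$ has a greatest element; (c) $L_0$ is downward closed in $L_1$ in the following sense: for all $z\in L_0\setminus\{1\}$ and all $x\in L_1$, if $x\le z$ then $x\in L_0$. A subset $A$ of a bounded lattice $M$ is called convex in $M$ if whenever $a,a'\in A$, $x\in M$ and $0<a\le x\le a'<1$, then $x\in A$. Construction of $\mathrm{ortho}(L_1,L_0)$: let $L_0$ be an ortholattice with orthocomplement ${}^{\perp_0}$ and $L_1$ a bounded lattice with $L_0\trianglelefteq L_1$. Choose a set $L_2$ and a bijection $\iota:L_1\to L_2$ with $L_1\cap L_2=L_0$ and $\iota(z)=z^{\perp_0}$ for all $z\in L_0$. Order $L_2$ by $\iota(x)\le_2\iota(y)$ iff $y\le_1 x$. Then $\mathrm{ortho}(L_1,L_0)$ is the set $L_1\cup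 L_2$ ordered by the transitive closure of $(\le_1)\cup(\le_2)$ (this is a lattice), with orthocomplement $x^\perp=\iota(x)$ for $x\in L_1$ and $x^\perp=\iota^{-1}(x)$ for $x\in L_2$. A family $\mathscr F$ of lattices is power closed if for every $S\in\mathscr F$ there is some $S'\in\mathscr F$ isomorphic to $S\times S$. A lattice $M$ is $\kappa$-power closed if the family of sublattices of $M$ of size $\le\kappa$ is power closed.
   Formalization: The claim that the extension in (1) can be chosen κ-power closed is made only for infinite κ and κ ≤ 1; for finite κ ≥ 2 it fails for every L with more than one element, since the square of a largest sublattice of size ≤ κ is too big. *)

theory Defs
  imports "HOL-Algebra.Complete_Lattice"
begin

unbundle cardinal_syntax

section \<open>Ortholattices\<close>

record 'a ortholat = "'a gorder" +
  orth :: "'a \<Rightarrow> 'a"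

locale ortholattice = bounded_lattice L for L :: "('a, 'm) ortholat_scheme" (structure) +
  assumes orth_closed: "x \<in> carrier L \<Longrightarrow> orth L x \<in> carrier L"
    and orth_antitone: "\<lbrakk>x \<in> carrier L; y \<in> carrier L; x \<sqsubseteq> y\<rbrakk> \<Longrightarrow> orth L y \<sqsubseteq> orth L x"
    and orth_orth: "x \<in> carrier L \<Longrightarrow> orth L (orth L x) = x"
    and join_orth: "x \<in> carrier L \<Longrightarrow> x \<squnion> orth L x = \<top>"
    and meet_orth: "x \<in> carrier L \<Longrightarrow> x \<sqinter> orth L x = \<bottom>"

locale complete_ortholattice = ortholattice L + complete_lattice L
  for L :: "('a, 'm) ortholat_scheme" (structure)

section \<open>Substructures and isomorphisms\<close>

text \<open>\<open>L0 \<le> L1\<close>: \<open>L0\<close> is a {0,1}-sublattice of \<open>L1\<close>.\<close>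

definition sublattice01 :: "('a, 'm) gorder_scheme \<Rightarrow> ('a, 'n) gorder_scheme \<Rightarrow> bool" where
  "sublattice01 L0 L1 \<longleftrightarrow>
     bounded_lattice L0 \<and> bounded_lattice L1 \<and> carrier L0 \<subseteq> carrier L1 \<and>
     (\<forall>x\<in>carrier L0. \<forall>y\<in>carrier L0.
        x \<squnion>\<^bsub>L0\<^esub> y = x \<squnion>\<^bsub>L1\<^esub> y \<and> x \<sqinter>\<^bsub>L0\<^esub> y = x \<sqinter>\<^bsub>L1\<^esub> y) \<and>
     \<bottom>\<^bsub>L0\<^esub> = \<bottom>\<^bsub>L1\<^esub> \<and> \<top>\<^bsub>L0\<^esub> = \<top>\<^bsub>L1\<^esub>"

definition subortholattice :: "('a, 'm) ortholat_scheme \<Rightarrow> ('a, 'n) ortholat_scheme \<Rightarrow> bool" where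
  "subortholattice L M \<longleftrightarrow>
     ortholattice L \<and> ortholattice M \<and> sublattice01 L M \<and>
     (\<forall>x\<in>carrier L. orth L x = orth M x)"

definition lattice_iso ::
    "('a, 'm) gorder_scheme \<Rightarrow> ('b, 'n) gorder_scheme \<Rightarrow> ('a \<Rightarrow> 'b) \<Rightarrow> bool" where
  "lattice_iso A B h \<longleftrightarrow>
     bij_betw h (carrier A) (carrier B) \<and>
     (\<forall>x\<in>carrier A. \<forall>y\<in>carrier A.
        h (x \<squnion>\<^bsub>A\<^esub> y) = h x \<squnion>\<^bsub>B\<^esub> h y \<and> h (x \<sqinter>\<^bsub>A\<^esub> y) = h x \<sqinter>\<^bsub>B\<^esub> h y)"

definition ortholattice_iso ::
    "('a, 'm) ortholat_scheme \<Rightarrow> ('b, 'n) ortholat_scheme \<Rightarrow> ('a \<Rightarrow> 'b) \<Rightarrow> bool" where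
  "ortholattice_iso A B h \<longleftrightarrow>
     lattice_iso A B h \<and> (\<forall>x\<in>carrier A. h (orth A x) = orth B (h x)) \<and>
     h \<bottom>\<^bsub>A\<^esub> = \<bottom>\<^bsub>B\<^esub> \<and> h \<top>\<^bsub>A\<^esub> = \<top>\<^bsub>B\<^esub>"

text \<open>
  \<open>L0 \<unlhd> L1\<close>: every element of \<open>L1\<close> has a greatest element of \<open>L0\<close> below it, and \<open>L0\<close> is downward
  closed in \<open>L1\<close> except below 1.
\<close>

definition tri_sub :: "('a, 'm) gorder_scheme \<Rightarrow> ('a, 'n) gorder_scheme \<Rightarrow> bool"
    (infix \<open>\<unlhd>\<close> 50) where
  "L0 \<unlhd> L1 \<longleftrightarrow>
     sublattice01 L0 L1 \<and>
     (\<forall>x\<in>carrier L1. \<exists>g. greatest L1 g {z \<in> carrier L0. z \<sqsubseteq>\<^bsub>L1\<^esub> x}) \<and>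
     (\<forall>z\<in>carrier L0 - {\<top>\<^bsub>L1\<^esub>}. \<forall>x\<in>carrier L1. x \<sqsubseteq>\<^bsub>L1\<^esub> z \<longrightarrow> x \<in> carrier L0)"

definition convex_in :: "'a set \<Rightarrow> ('a, 'm) gorder_scheme \<Rightarrow> bool" where
  "convex_in A M \<longleftrightarrow>
     A \<subseteq> carrier M \<and>
     (\<forall>a\<in>A. \<forall>a'\<in>A. \<forall>x\<in>carrier M.
        \<bottom>\<^bsub>M\<^esub> \<sqsubset>\<^bsub>M\<^esub> a \<and> a \<sqsubseteq>\<^bsub>M\<^esub> x \<and> x \<sqsubseteq>\<^bsub>M\<^esub> a' \<and> a' \<sqsubset>\<^bsub>M\<^esub> \<top>\<^bsub>M\<^esub> \<longrightarrow> x \<in> A)"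

section \<open>The construction of ortho(L1, L0)\<close>

text \<open>
  The set \<open>L2\<close> is the image \<open>\<iota> ` carrier L1\<close>, with \<open>\<iota> x \<le>\<^sub>2 \<iota> y\<close> iff \<open>y \<le>\<^sub>1 x\<close>.
  The ortholattice \<open>L0\<close> enters only through the conditions on \<open>\<iota>\<close> in \<open>is_ortho\<close>; they make
  the two clauses for the orthocomplement agree on \<open>L1 \<inter> L2 = L0\<close>.
\<close>

definition ortho_along :: "('a, 'm) gorder_scheme \<Rightarrow> ('a \<Rightarrow> 'a) \<Rightarrow> 'a ortholat" where
  "ortho_along L1 \<iota> =
     \<lparr> carrier = carrier L1 \<union> \<iota> ` carrier L1,
       eq = (=),
       le = (\<lambda>x y. (x, y) \<in>
              ({(u, v). u \<in> carrier L1 \<and> v \<in> carrier L1 \<and> u \<sqsubseteq>\<^bsub>L1\<^esub> v} \<union>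
               {(\<iota> u, \<iota> v) | u v. u \<in> carrier L1 \<and> v \<in> carrier L1 \<and> v \<sqsubseteq>\<^bsub>L1\<^esub> u})\<^sup>+),
       orth = (\<lambda>x. if x \<in> carrier L1 then \<iota> x else inv_into (carrier L1) \<iota> x) \<rparr>"

definition is_ortho ::
    "'a ortholat \<Rightarrow> ('a, 'm) gorder_scheme \<Rightarrow> ('a, 'n) ortholat_scheme \<Rightarrow> bool" where
  "is_ortho M L1 L0 \<longleftrightarrow>
     ortholattice L0 \<and> L0 \<unlhd> L1 \<and>
     (\<exists>\<iota>. inj_on \<iota> (carrier L1) \<and>
          carrier L1 \<inter> \<iota> ` carrier L1 = carrier L0 \<and>
          (\<forall>z\<in>carrier L0. \<iota> z = orth L0 z) \<and>
          M = ortho_along L1 \<iota>)"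

section \<open>Orthopolynomials\<close>

datatype 'a orthoterm =
    Var nat
  | Coeff 'a
  | Join "'a orthoterm" "'a orthoterm"
  | Meet "'a orthoterm" "'a orthoterm"
  | Orth "'a orthoterm"

primrec orthopolynomial :: "('a, 'm) ortholat_scheme \<Rightarrow> nat \<Rightarrow> 'a orthoterm \<Rightarrow> bool" where
  "orthopolynomial M n (Var i) \<longleftrightarrow> i < n"
| "orthopolynomial M n (Coeff c) \<longleftrightarrow> c \<in> carrier M"
| "orthopolynomial M n (Join p q) \<longleftrightarrow> orthopolynomial M n p \<and> orthopolynomial M n q"
| "orthopolynomial M n (Meet p q) \<longleftrightarrow> orthopolynomial M n p \<and> orthopolynomial M n q"
| "orthopolynomial M n (Orth p) \<longleftrightarrow> orthopolynomial M n p"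

primrec eval_orthoterm :: "('a, 'm) ortholat_scheme \<Rightarrow> 'a orthoterm \<Rightarrow> 'a list \<Rightarrow> 'a" where
  "eval_orthoterm M (Var i) as = as ! i"
| "eval_orthoterm M (Coeff c) as = c"
| "eval_orthoterm M (Join p q) as = eval_orthoterm M p as \<squnion>\<^bsub>M\<^esub> eval_orthoterm M q as"
| "eval_orthoterm M (Meet p q) as = eval_orthoterm M p as \<sqinter>\<^bsub>M\<^esub> eval_orthoterm M q as"
| "eval_orthoterm M (Orth p) as = orth M (eval_orthoterm M p as)"

definition tuples :: "('a, 'm) gorder_scheme \<Rightarrow> nat \<Rightarrow> 'a list set" where
  "tuples M n = {as. length as = n \<and> set as \<subseteq> carrier M}"

section \<open>Power closed families\<close>

definition prod_lattice ::
    "('a, 'm) gorder_scheme \<Rightarrow> ('b, 'n) gorder_scheme \<Rightarrow> ('a \<times> 'b) gorder" where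
  "prod_lattice A B =
     \<lparr> carrier = carrier A \<times> carrier B,
       eq = (=),
       le = (\<lambda>(a, b) (a', b'). a \<sqsubseteq>\<^bsub>A\<^esub> a' \<and> b \<sqsubseteq>\<^bsub>B\<^esub> b') \<rparr>"

definition power_closed :: "('a, 'm) gorder_scheme set \<Rightarrow> bool" where
  "power_closed F \<longleftrightarrow> (\<forall>S\<in>F. \<exists>S'\<in>F. \<exists>h. lattice_iso (prod_lattice S S) S' h)"

definition sublattice_set :: "'a set \<Rightarrow> ('a, 'm) gorder_scheme \<Rightarrow> bool" where
  "sublattice_set S M \<longleftrightarrow>
     S \<noteq> {} \<and> S \<subseteq> carrier M \<and> (\<forall>x\<in>S. \<forall>y\<in>S. x \<squnion>\<^bsub>M\<^esub> y \<in> S \<and> x \<sqinter>\<^bsub>M\<^esub> y \<in> S)"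

definition card_power_closed :: "'k rel \<Rightarrow> ('a, 'm) gorder_scheme \<Rightarrow> bool" where
  "card_power_closed \<kappa> M \<longleftrightarrow>
     power_closed {M\<lparr>carrier := S\<rparr> | S. sublattice_set S M \<and> |S| \<le>o \<kappa>}"

text \<open>
  No finite \<open>\<kappa> \<ge> 2\<close> admits a nontrivial \<open>\<kappa>\<close>-power closed bounded lattice: the square of a
  largest sublattice with at most \<open>\<kappa>\<close> elements is too big. Power closedness can therefore only be
  demanded for infinite \<open>\<kappa>\<close> and for \<open>\<kappa> \<le> 1\<close>.
\<close>

lemma not_card_power_closed_finite:
  assumes "bounded_lattice M" "\<bottom>\<^bsub>M\<^esub> \<noteq> \<top>\<^bsub>M\<^esub>"
    and "Card_order \<kappa>" "finite (Field \<kappa>)" "2 \<le> card (Field \<kappa>)"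
  shows "\<not> card_power_closed \<kappa> M"
proof
  assume pc: "card_power_closed \<kappa> M"
  interpret bounded_lattice M by fact
  let ?n = "card (Field \<kappa>)"
  have kap: "|Field \<kappa>| =o \<kappa>" using assms(3) by (rule card_of_Field_ordIso)
  have le_iff: "|S| \<le>o \<kappa> \<longleftrightarrow> finite S \<and> card S \<le> ?n" for S :: "'a set"
  proof -
    have "|S| \<le>o \<kappa> \<longleftrightarrow> |S| \<le>o |Field \<kappa>|"
      using kap ordIso_symmetric ordLeq_ordIso_trans by blast
    also have "\<dots> \<longleftrightarrow> finite S \<and> card S \<le> ?n"
      using assms(4) by (metis card_of_ordLeq card_of_ordLeq_finite finite_imageD inj_on_iff_card_le)
    finally show ?thesis .
  qed
  define N where "N = {card S | S. sublattice_set S M \<and> |S| \<le>o \<kappa>}"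
  have finN: "finite N" by (rule finite_subset[of _ "{..?n}"]) (auto simp: N_def le_iff)
  have b: "\<bottom>\<^bsub>M\<^esub> \<in> carrier M" "\<top>\<^bsub>M\<^esub> \<in> carrier M" by auto
  have jm: "\<bottom>\<^bsub>M\<^esub> \<squnion>\<^bsub>M\<^esub> \<bottom>\<^bsub>M\<^esub> = \<bottom>\<^bsub>M\<^esub>" "\<bottom>\<^bsub>M\<^esub> \<squnion>\<^bsub>M\<^esub> \<top>\<^bsub>M\<^esub> = \<top>\<^bsub>M\<^esub>" "\<top>\<^bsub>M\<^esub> \<squnion>\<^bsub>M\<^esub> \<bottom>\<^bsub>M\<^esub> = \<top>\<^bsub>M\<^esub>" "\<top>\<^bsub>M\<^esub> \<squnion>\<^bsub>M\<^esub> \<top>\<^bsub>M\<^esub> = \<top>\<^bsub>M\<^esub>"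
           "\<bottom>\<^bsub>M\<^esub> \<sqinter>\<^bsub>M\<^esub> \<bottom>\<^bsub>M\<^esub> = \<bottom>\<^bsub>M\<^esub>" "\<bottom>\<^bsub>M\<^esub> \<sqinter>\<^bsub>M\<^esub> \<top>\<^bsub>M\<^esub> = \<bottom>\<^bsub>M\<^esub>" "\<top>\<^bsub>M\<^esub> \<sqinter>\<^bsub>M\<^esub> \<bottom>\<^bsub>M\<^esub> = \<bottom>\<^bsub>M\<^esub>" "\<top>\<^bsub>M\<^esub> \<sqinter>\<^bsub>M\<^esub> \<top>\<^bsub>M\<^esub> = \<top>\<^bsub>M\<^esub>"
    using b by (auto intro!: le_antisym join_le meet_le join_left join_right meet_left meet_right)
  have "sublattice_set {\<bottom>\<^bsub>M\<^esub>, \<top>\<^bsub>M\<^esub>} M" using b jm by (auto simp: sublattice_set_def)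
  moreover have "card {\<bottom>\<^bsub>M\<^esub>, \<top>\<^bsub>M\<^esub>} = 2" using assms(2) by simp
  ultimately have two: "2 \<in> N" unfolding N_def using assms(5) le_iff
    by (metis (mono_tags, lifting) finite.emptyI finite.insertI mem_Collect_eq)
  obtain S where S: "sublattice_set S M" "|S| \<le>o \<kappa>" "card S = Max N"
    using Max_in[OF finN] two unfolding N_def by (smt (verit) empty_iff mem_Collect_eq)
  obtain S' h where S': "sublattice_set S' M" "|S'| \<le>o \<kappa>"
      "lattice_iso (prod_lattice (M\<lparr>carrier := S\<rparr>) (M\<lparr>carrier := S\<rparr>)) (M\<lparr>carrier := S'\<rparr>) h"
    using pc S unfolding card_power_closed_def power_closed_def by blast
  have "card S' = card (S \<times> S)"
    using S'(3) by (auto simp: lattice_iso_def prod_lattice_def dest!: bij_betw_same_card)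
  moreover have "card S' \<le> Max N" using S' finN by (auto simp: N_def intro!: Max_ge)
  moreover have "2 \<le> Max N" using two finN by simp
  ultimately have "Max N * Max N \<le> Max N" "2 \<le> Max N" using S(3) by (auto simp: card_cartesian_product)
  then show False by simp
qed

section \<open>A type for the extensions\<close>

text \<open>
  HOL cannot quantify existentially over types, so the extensions of an ortholattice on a set of
  elements of type \<open>'a\<close> are sought on sets of elements of a fixed, sufficiently large type,
  and an ortholattice is identified with an isomorphic copy there.
\<close>

type_synonym ('a, 'k) ext = "('a + 'k + nat) set set"

end

theory Submission
  imports Defs
begin

text \<open>
  All extensions are built by piling new elements on top of \<open>L\<close>. Let \<open>N\<close> be a partial order with a
  map \<open>\<pi>\<close> from \<open>N\<close> into \<open>L - {1}\<close>, where \<open>\<pi> n\<close> is to be the greatest element of \<open>L\<close> below \<open>n\<close>, and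
  nothing of \<open>L\<close> except \<open>1\<close> is to be above \<open>n\<close>. The order on \<open>L1 = L \<union> N\<close> is complete as soon as every
  nonempty subset of \<open>N\<close> with a lower bound in \<open>N\<close> has an infimum in \<open>N\<close> and \<open>\<pi>\<close> preserves that infimum;
  such an \<open>N\<close> is called a crown (locale \<open>crown\<close>). Sets without a lower bound in \<open>N\<close> find their infimum in
  \<open>L\<close>. The ortholattice \<open>ortho(L1, L)\<close> adds a mirror image of \<open>N\<close> at the bottom and is complete for the same
  reason (locale \<open>crowned\<close>). Disjoint unions of crowns are crowns, so \<open>L\<close> can be given many independent
  extensions at the same time.

  A function \<open>f\<close> from \<open>L\<^sup>n\<close> to \<open>L\<close> becomes an orthopolynomial as follows. Lattice polynomials are monotone,
  but the tuples \<open>(x, x\<^sup>\<bottom>)\<close> form an antichain, so monotonicity in \<open>x\<close> and \<open>x\<^sup>\<bottom>\<close> is no restriction on \<open>f\<close>.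
  The crown for \<open>f\<close> (\<open>gadget\<close>) contains the proper subintervals of \<open>L\<^sup>n\<close>, ordered by inclusion. Joins of \<open>x\<^sub>i\<close>
  and of its complement with suitable intervals give the half-spaces below and above \<open>x\<close> in coordinate
  \<open>i\<close>, and the meet of these is the one-point interval \<open>{x}\<close>. These points are minimal in the crown and
  pairwise unrelated, so that nothing prevents the following ascent: \<open>{x}\<close> lies below an element \<open>Tip x\<close>, the
  tip lies above a part of a copy of \<open>L\<close> (the rail) that is cut off at \<open>f x\<close>, and above the rail lies another
  copy of \<open>L\<close> (the peaks) with \<open>\<pi> (Peak w) = w\<close>. One join or meet with a constant leads from each stage
  to the next. Finally, the peaks over \<open>f x\<close> in two disjoint copies of the gadget have no lower bound in
  common in \<open>N\<close>, so their meet falls down to \<open>f x\<close> (lemma \<open>gadget_pair_interpolates\<close>).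

  For power closedness, the nonempty ideals of any lattice form a crown with constant \<open>\<pi> = 0\<close>, and the lattice
  embeds into it by principal ideals. Including the ideals of all lattices on a given set makes the square of
  every small sublattice reappear as a sublattice (lemma \<open>embed_lattice\<close>).

  Cardinalities are measured by a type \<open>'u\<close> that has at least as many elements as \<open>L\<close>, as \<open>\<kappa>\<close>, and as the
  natural numbers. If \<open>f\<close> is only prescribed on \<open>|'u|\<close> points, then an ortholattice with at most \<open>2\<close> to
  the \<open>|'u|\<close> elements needs no more than that many gadgets, and the extension (\<open>extension_step\<close>) satisfies
  the same bound. As \<open>L\<close> has at most \<open>|'u|\<close> elements, one such step proves the first claim. For the second claim consider the ortholattices within
  this bound, where \<open>M\<close> precedes \<open>K\<close> if \<open>M\<close> is convex in \<open>K\<close> and the functions on \<open>M\<close> are interpolated by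
  orthopolynomials of \<open>K\<close>. Along a chain, convexity makes the union complete. The union \<open>H\<close> of a maximal
  chain interpolates its own functions: any set of at most \<open>|'u|\<close> elements of \<open>H\<close> is contained in a single
  member of the chain, since otherwise \<open>H\<close> would itself be within the bound and succeed all members; and
  every member is followed by another one in which its functions are interpolated.
\<close>

section \<open>Orders, bounds and sublattices\<close>

lemma partial_orderI_eq:
  assumes "eq M = (=)"
    and "\<And>x. x \<in> carrier M \<Longrightarrow> le M x x"
    and "\<And>x y. \<lbrakk>le M x y; le M y x; x \<in> carrier M; y \<in> carrier M\<rbrakk> \<Longrightarrow> x = y"
    and "\<And>x y z. \<lbrakk>le M x y; le M y z; x \<in> carrier M; y \<in> carrier M; z \<in> carrier M\<rbrakk> \<Longrightarrow> le M x z"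
  shows "partial_order M"
  by unfold_locales (use assms in auto)

lemma complete_lattice_if_infs:
  assumes "partial_order M"
    and inf: "\<And>A. A \<subseteq> carrier M \<Longrightarrow> \<exists>g\<in>carrier M. \<forall>y\<in>carrier M. le M y g \<longleftrightarrow> (\<forall>a\<in>A. le M y a)"
  shows "complete_lattice M"
proof -
  interpret partial_order M by fact
  have glb: "\<exists>g. greatest M g (Lower M A)" if A: "A \<subseteq> carrier M" for A
  proof -
    obtain g where "g \<in> carrier M" "\<forall>y\<in>carrier M. le M y g \<longleftrightarrow> (\<forall>a\<in>A. le M y a)"
      using inf[OF A] by blast
    then have "greatest M g (Lower M A)"
      using A by (intro greatest_LowerI) (auto simp: Lower_def)
    then show ?thesis ..
  qed
  have "\<exists>g. greatest M g (carrier M)"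
    using glb[of "{}"] by simp
  then show ?thesis
    using glb by (intro complete_lattice_criterion1) auto
qed

lemma (in partial_order) join_eqI:
  assumes "x \<in> carrier L" "y \<in> carrier L" "z \<in> carrier L" "x \<sqsubseteq> z" "y \<sqsubseteq> z"
    and "\<And>w. \<lbrakk>w \<in> carrier L; x \<sqsubseteq> w; y \<sqsubseteq> w\<rbrakk> \<Longrightarrow> z \<sqsubseteq> w"
  shows "x \<squnion> y = z"
proof -
  have "least L z (Upper L {x, y})"
    using assms by (intro least_UpperI) (auto simp: Upper_def)
  then show ?thesis
    unfolding join_def sup_def using least_unique by blast
qed

lemma (in partial_order) meet_eqI:
  assumes "x \<in> carrier L" "y \<in> carrier L" "z \<in> carrier L" "z \<sqsubseteq> x" "z \<sqsubseteq> y"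
    and "\<And>w. \<lbrakk>w \<in> carrier L; w \<sqsubseteq> x; w \<sqsubseteq> y\<rbrakk> \<Longrightarrow> w \<sqsubseteq> z"
  shows "x \<sqinter> y = z"
proof -
  have "greatest L z (Lower L {x, y})"
    using assms by (intro greatest_LowerI) (auto simp: Lower_def)
  then show ?thesis
    unfolding meet_def inf_def using greatest_unique by blast
qed

lemma (in partial_order) top_eqI:
  assumes "t \<in> carrier L" "\<And>x. x \<in> carrier L \<Longrightarrow> x \<sqsubseteq> t"
  shows "\<top> = t"
proof -
  have "greatest L t (carrier L)" using assms by (auto simp: greatest_def)
  then show ?thesis unfolding top_def using greatest_unique by blast
qed

lemma (in partial_order) bottom_eqI:
  assumes "b \<in> carrier L" "\<And>x. x \<in> carrier L \<Longrightarrow> b \<sqsubseteq> x"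
  shows "\<bottom> = b"
proof -
  have "least L b (carrier L)" using assms by (auto simp: least_def)
  then show ?thesis unfolding bottom_def using least_unique by blast
qed

lemma (in bounded_lattice) le_join_meet_iff:
  assumes "x \<in> carrier L" "y \<in> carrier L" "z \<in> carrier L"
  shows "x \<squnion> y \<sqsubseteq> z \<longleftrightarrow> x \<sqsubseteq> z \<and> y \<sqsubseteq> z" "z \<sqsubseteq> x \<sqinter> y \<longleftrightarrow> z \<sqsubseteq> x \<and> z \<sqsubseteq> y"
  using assms by (meson join_closed join_le join_left join_right le_trans)
    (meson assms meet_closed meet_le meet_left meet_right le_trans)

lemma (in bounded_lattice) le_bottom_iff: "x \<in> carrier L \<Longrightarrow> x \<sqsubseteq> \<bottom> \<longleftrightarrow> x = \<bottom>"
  by (metis bottom_closed bottom_lower le_antisym le_refl)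

lemma (in bounded_lattice) top_le_iff: "x \<in> carrier L \<Longrightarrow> \<top> \<sqsubseteq> x \<longleftrightarrow> x = \<top>"
  by (metis top_closed top_higher le_antisym le_refl)

lemma (in complete_lattice) le_Inf_iff:
  "\<lbrakk>A \<subseteq> carrier L; z \<in> carrier L\<rbrakk> \<Longrightarrow> z \<sqsubseteq> \<Sqinter>A \<longleftrightarrow> (\<forall>a\<in>A. z \<sqsubseteq> a)"
  by (meson inf_closed inf_greatest inf_lower le_trans subsetD)

lemma (in complete_lattice) Sup_le_iff:
  "\<lbrakk>A \<subseteq> carrier L; z \<in> carrier L\<rbrakk> \<Longrightarrow> \<Squnion>A \<sqsubseteq> z \<longleftrightarrow> (\<forall>a\<in>A. a \<sqsubseteq> z)"
  by (meson sup_closed sup_least sup_upper le_trans subsetD)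

lemma complete_lattice_imp_bounded:
  assumes "complete_lattice M"
  shows "bounded_lattice M"
proof -
  interpret complete_lattice M by fact
  show ?thesis by unfold_locales
qed

lemma (in ortholattice) le_orth_iff:
  "\<lbrakk>x \<in> carrier L; y \<in> carrier L\<rbrakk> \<Longrightarrow> x \<sqsubseteq> orth L y \<longleftrightarrow> y \<sqsubseteq> orth L x"
  by (metis orth_antitone orth_closed orth_orth)

lemma (in ortholattice) orth_le_iff:
  "\<lbrakk>x \<in> carrier L; y \<in> carrier L\<rbrakk> \<Longrightarrow> orth L x \<sqsubseteq> orth L y \<longleftrightarrow> y \<sqsubseteq> x"
  by (metis orth_antitone orth_closed orth_orth)

lemma (in ortholattice) orth_bounds: "orth L \<bottom> = \<top>" "orth L \<top> = \<bottom>"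
proof -
  show *: "orth L \<top> = \<bottom>"
    using le_orth_iff[of "orth L \<top>" \<bottom>] le_orth_iff[of \<bottom> \<top>] orth_antitone[of "orth L \<bottom>" \<top>]
    by (simp add: orth_closed orth_orth le_bottom_iff)
  then show "orth L \<bottom> = \<top>" by (metis orth_orth top_closed)
qed

lemma sublattice01I:
  assumes "bounded_lattice L" "bounded_lattice M" and sub: "carrier L \<subseteq> carrier M"
    and le: "\<And>x y. \<lbrakk>x \<in> carrier L; y \<in> carrier L\<rbrakk> \<Longrightarrow> le M x y \<longleftrightarrow> le L x y"
    and join: "\<And>x y w. \<lbrakk>x \<in> carrier L; y \<in> carrier L; w \<in> carrier M; le M x w; le M y w\<rbrakk>
        \<Longrightarrow> le M (x \<squnion>\<^bsub>L\<^esub> y) w"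
    and meet: "\<And>x y w. \<lbrakk>x \<in> carrier L; y \<in> carrier L; w \<in> carrier M; le M w x; le M w y\<rbrakk>
        \<Longrightarrow> le M w (x \<sqinter>\<^bsub>L\<^esub> y)"
    and top: "\<And>w. w \<in> carrier M \<Longrightarrow> le M w \<top>\<^bsub>L\<^esub>"
    and bot: "\<And>w. w \<in> carrier M \<Longrightarrow> le M \<bottom>\<^bsub>L\<^esub> w"
  shows "sublattice01 L M"
proof -
  interpret L: bounded_lattice L by fact
  interpret M: bounded_lattice M by fact
  have "x \<squnion>\<^bsub>L\<^esub> y = x \<squnion>\<^bsub>M\<^esub> y \<and> x \<sqinter>\<^bsub>L\<^esub> y = x \<sqinter>\<^bsub>M\<^esub> y" if "x \<in> carrier L" "y \<in> carrier L" for x y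
  proof
    have sub': "\<And>x. x \<in> carrier L \<Longrightarrow> x \<in> carrier M" using sub by auto
    show "x \<squnion>\<^bsub>L\<^esub> y = x \<squnion>\<^bsub>M\<^esub> y"
      using that join le L.join_left L.join_right
      by (intro M.join_eqI[symmetric]) (auto simp: sub')
    show "x \<sqinter>\<^bsub>L\<^esub> y = x \<sqinter>\<^bsub>M\<^esub> y"
      using that meet le L.meet_left L.meet_right
      by (intro M.meet_eqI[symmetric]) (auto simp: sub')
  qed
  moreover have "\<top>\<^bsub>M\<^esub> = \<top>\<^bsub>L\<^esub>" using sub top by (intro M.top_eqI) auto
  moreover have "\<bottom>\<^bsub>M\<^esub> = \<bottom>\<^bsub>L\<^esub>" using sub bot by (intro M.bottom_eqI) auto
  ultimately show ?thesis using assms(1,2) sub unfolding sublattice01_def by auto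
qed

lemma sublattice01_le_iff:
  assumes "sublattice01 L M" "x \<in> carrier L" "y \<in> carrier L"
  shows "le M x y \<longleftrightarrow> le L x y"
proof -
  interpret L: bounded_lattice L using assms(1) by (simp add: sublattice01_def)
  interpret M: bounded_lattice M using assms(1) by (simp add: sublattice01_def)
  have "x \<in> carrier M" "y \<in> carrier M" "x \<squnion>\<^bsub>L\<^esub> y = x \<squnion>\<^bsub>M\<^esub> y"
    using assms by (auto simp: sublattice01_def)
  then show ?thesis using assms(2,3) L.weak_le_iff_meet[of x y] M.weak_le_iff_meet[of x y]
    by (simp add: L.eq_is_equal M.eq_is_equal)
qed

section \<open>Crowns\<close>

text \<open>
  The greatest element of \<open>L\<close> below \<open>x\<close> is to be \<open>\<pi> x\<close>. It differs from the top since only the top of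
  the extension lies above elements of \<open>N\<close>. Infima are required only in the presence of a lower bound in \<open>N\<close>:
  any other subset of \<open>N\<close> gets its infimum in \<open>L\<close>, as the infimum of the values of \<open>\<pi>\<close>.
\<close>

locale crown =
  fixes L :: "('e, 'm) gorder_scheme" (structure) and N :: "'n set" and leN :: "'n \<Rightarrow> 'n \<Rightarrow> bool"
    and \<pi> :: "'n \<Rightarrow> 'e"
  assumes N_refl: "x \<in> N \<Longrightarrow> leN x x"
    and N_antisym: "\<lbrakk>x \<in> N; y \<in> N; leN x y; leN y x\<rbrakk> \<Longrightarrow> x = y"
    and N_trans: "\<lbrakk>x \<in> N; y \<in> N; z \<in> N; leN x y; leN y z\<rbrakk> \<Longrightarrow> leN x z"
    and pi_closed: "x \<in> N \<Longrightarrow> \<pi> x \<in> carrier L"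
    and pi_not_top: "x \<in> N \<Longrightarrow> \<pi> x \<noteq> \<top>"
    and N_inf: "\<lbrakk>B \<subseteq> N; B \<noteq> {}; l \<in> N; \<And>b. b \<in> B \<Longrightarrow> leN l b\<rbrakk> \<Longrightarrow>
      \<exists>g\<in>N. (\<forall>y\<in>N. leN y g \<longleftrightarrow> (\<forall>b\<in>B. leN y b)) \<and>
            (\<forall>z\<in>carrier L. z \<sqsubseteq> \<pi> g \<longleftrightarrow> (\<forall>b\<in>B. z \<sqsubseteq> \<pi> b))"

lemma (in crown) crown_image:
  assumes le: "\<And>x y. \<lbrakk>x \<in> N; y \<in> N\<rbrakk> \<Longrightarrow> le' (h x) (h y) \<longleftrightarrow> leN x y"
    and pi: "\<And>x. x \<in> N \<Longrightarrow> \<pi>' (h x) = \<pi> x"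
  shows "crown L (h ` N) le' \<pi>'"
proof (unfold_locales, goal_cases)
  case (2 x y)
  then show ?case using le N_antisym by blast
next
  case (3 x y z)
  then show ?case using le N_trans by blast
next
  case (6 B l)
  then obtain B' l' where B': "B = h ` B'" "B' \<subseteq> N" "l = h l'" "l' \<in> N"
    by (auto simp: subset_image_iff)
  have "leN l' b" if "b \<in> B'" for b using 6(4)[of "h b"] B' le[of l' b] that by auto
  then have "\<exists>g\<in>N. (\<forall>y\<in>N. leN y g \<longleftrightarrow> (\<forall>b\<in>B'. leN y b)) \<and>
      (\<forall>z\<in>carrier L. z \<sqsubseteq> \<pi> g \<longleftrightarrow> (\<forall>b\<in>B'. z \<sqsubseteq> \<pi> b))"
    by (intro N_inf[of _ l']) (use 6(2) B' in auto)
  then obtain g where "g \<in> N" "\<forall>y\<in>N. leN y g \<longleftrightarrow> (\<forall>b\<in>B'. leN y b)"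
    "\<forall>z\<in>carrier L. z \<sqsubseteq> \<pi> g \<longleftrightarrow> (\<forall>b\<in>B'. z \<sqsubseteq> \<pi> b)" by blast
  then show ?case using B' by (intro bexI[of _ "h g"]) (auto simp: le pi subset_iff)
qed (use le pi N_refl pi_closed pi_not_top in auto)

text \<open>
  A set with a lower bound lies within a single component of the order. This is why disjoint unions of crowns
  are crowns.
\<close>

lemma crown_of_components:
  fixes L (structure)
  assumes comp: "\<And>x. x \<in> N \<Longrightarrow> \<exists>K. K \<subseteq> N \<and> x \<in> K \<and> crown L K leN \<pi> \<and>
    (\<forall>k\<in>K. \<forall>y\<in>N. leN k y \<or> leN y k \<longrightarrow> y \<in> K)"
  shows "crown L N leN \<pi>"
proof (unfold_locales, goal_cases)
  case (1 x)
  then obtain K where "x \<in> K" "crown L K leN \<pi>" using comp by blast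
  then show ?case by (rule crown.N_refl[rotated])
next
  case (2 x y)
  obtain K where K: "x \<in> K" "crown L K leN \<pi>" "\<forall>k\<in>K. \<forall>y\<in>N. leN k y \<or> leN y k \<longrightarrow> y \<in> K"
    using comp[OF 2(1)] by blast
  have "y \<in> K" using K 2 by blast
  then show ?case using crown.N_antisym[OF K(2,1)] 2 by blast
next
  case (3 x y z)
  obtain K where K: "x \<in> K" "crown L K leN \<pi>" "\<forall>k\<in>K. \<forall>y\<in>N. leN k y \<or> leN y k \<longrightarrow> y \<in> K"
    using comp[OF 3(1)] by blast
  have y: "y \<in> K" using K 3 by blast
  have "z \<in> K" using K y 3 by blast
  then show ?case using crown.N_trans[OF K(2,1) y] 3 by blast
next
  case (4 x)
  then obtain K where "x \<in> K" "crown L K leN \<pi>" using comp by blast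
  then show ?case by (rule crown.pi_closed[rotated])
next
  case (5 x)
  then obtain K where "x \<in> K" "crown L K leN \<pi>" using comp by blast
  then show ?case by (rule crown.pi_not_top[rotated])
next
  case (6 B l)
  obtain K where K: "K \<subseteq> N" "l \<in> K" "crown L K leN \<pi>"
      "\<And>k y. \<lbrakk>k \<in> K; y \<in> N; leN k y \<or> leN y k\<rbrakk> \<Longrightarrow> y \<in> K"
    using comp[OF 6(3)] by blast
  have B: "B \<subseteq> K" using K(4)[OF K(2)] 6(1,4) by blast
  obtain g where g: "g \<in> K" "\<forall>y\<in>K. leN y g \<longleftrightarrow> (\<forall>b\<in>B. leN y b)"
      "\<forall>z\<in>carrier L. z \<sqsubseteq> \<pi> g \<longleftrightarrow> (\<forall>b\<in>B. z \<sqsubseteq> \<pi> b)"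
    using crown.N_inf[OF K(3) B 6(2) K(2) 6(4)] by blast
  have "leN y g \<longleftrightarrow> (\<forall>b\<in>B. leN y b)" if y: "y \<in> N" for y
  proof (cases "y \<in> K")
    case False
    then have "\<not> leN y k" if "k \<in> K" for k using K(4)[OF that y] by blast
    then show ?thesis using g(1) B 6(2) by blast
  qed (use g in blast)
  then show ?case using g K(1) by blast
qed

lemma crown_Sigma:
  assumes "\<And>i. i \<in> I \<Longrightarrow> crown L (N i) (leN i) (\<pi> i)"
  shows "crown L (Sigma I N) (\<lambda>(i, x) (j, y). i = j \<and> leN i x y) (\<lambda>(i, x). \<pi> i x)"
proof (rule crown_of_components)
  fix p assume "p \<in> Sigma I N"
  then obtain i x where p: "p = (i, x)" "i \<in> I" "x \<in> N i" by blast
  have "crown L (Pair i ` N i) (\<lambda>(i, x) (j, y). i = j \<and> leN i x y) (\<lambda>(i, x). \<pi> i x)"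
    by (rule crown.crown_image[OF assms[OF p(2)]]) simp_all
  then show "\<exists>K. K \<subseteq> Sigma I N \<and> p \<in> K \<and>
      crown L K (\<lambda>(i, x) (j, y). i = j \<and> leN i x y) (\<lambda>(i, x). \<pi> i x) \<and>
      (\<forall>k\<in>K. \<forall>y\<in>Sigma I N. (case k of (i, x) \<Rightarrow> \<lambda>(j, y). i = j \<and> leN i x y) y \<or>
        (case y of (i, x) \<Rightarrow> \<lambda>(j, y). i = j \<and> leN i x y) k \<longrightarrow> y \<in> K)"
    using p by (intro exI[of _ "Pair i ` N i"]) auto
qed

lemma crown_Plus:
  assumes "crown L N1 le1 \<pi>1" "crown L N2 le2 \<pi>2"
  shows "crown L (N1 <+> N2) (rel_sum le1 le2) (case_sum \<pi>1 \<pi>2)"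
proof (rule crown_of_components)
  have "crown L (Inl ` N1) (rel_sum le1 le2) (case_sum \<pi>1 \<pi>2)"
    "crown L (Inr ` N2) (rel_sum le1 le2) (case_sum \<pi>1 \<pi>2)"
    by (rule crown.crown_image[OF assms(1)] crown.crown_image[OF assms(2)]; simp)+
  then show "\<exists>K. K \<subseteq> N1 <+> N2 \<and> x \<in> K \<and> crown L K (rel_sum le1 le2) (case_sum \<pi>1 \<pi>2) \<and>
      (\<forall>k\<in>K. \<forall>y\<in>N1 <+> N2. rel_sum le1 le2 k y \<or> rel_sum le1 le2 y k \<longrightarrow> y \<in> K)"
    if "x \<in> N1 <+> N2" for x
    using that by (intro exI[of _ "if isl x then Inl ` N1 else Inr ` N2"]) (auto elim!: rel_sum.cases)
qed

section \<open>The ortholattice of a crown\<close>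

text \<open>
  The mirror image \<open>\<iota> x\<close> of an element \<open>x\<close> of \<open>N\<close> is to be its orthocomplement, as \<open>\<iota>\<close> extends the
  complementation of \<open>L\<close>.
\<close>

locale crowned = complete_ortholattice L + crown L N leN \<pi>
  for L :: "('e, 'm) ortholat_scheme" (structure) and N :: "'e set" and leN \<pi> +
  fixes \<iota> :: "'e \<Rightarrow> 'e"
  assumes N_disj: "N \<inter> carrier L = {}"
    and iota_L: "x \<in> carrier L \<Longrightarrow> \<iota> x = orth L x"
    and iota_N: "x \<in> N \<Longrightarrow> \<iota> x \<notin> carrier L \<union> N"
    and iota_iota: "x \<in> N \<Longrightarrow> \<iota> (\<iota> x) = x"
begin

definition D where "D = \<iota> ` N"

definition C where "C = carrier L \<union> N \<union> D"

text \<open>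
  The greatest element of \<open>L\<close> below \<open>x\<close> and the least one above. The elements of \<open>N\<close> have only the
  top of \<open>L\<close> above them, and those of \<open>D\<close> have only the bottom of \<open>L\<close> below them.
\<close>

definition lo where "lo x = (if x \<in> carrier L then x else if x \<in> N then \<pi> x else \<bottom>)"

definition hi where "hi x = (if x \<in> carrier L then x else if x \<in> N then \<top> else orth L (\<pi> (\<iota> x)))"

text \<open>
  The condition \<open>hi x \<sqsubseteq> lo y\<close> says that some element of \<open>L\<close> lies between \<open>x\<close> and \<open>y\<close>. It is the
  only way in which elements of different parts are comparable, and it is the right order if \<open>x\<close> or \<open>y\<close>
  belongs to \<open>L\<close>. In this form the order is visibly reversed by \<open>\<iota>\<close>.
\<close>

definition leC where
  "leC x y \<longleftrightarrow> x \<in> C \<and> y \<in> C \<and>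
     (hi x \<sqsubseteq> lo y \<or> (x \<in> N \<and> y \<in> N \<and> leN x y) \<or> (x \<in> D \<and> y \<in> D \<and> leN (\<iota> y) (\<iota> x)))"

definition L1 :: "'e gorder" where
  "L1 = \<lparr>carrier = carrier L \<union> N, eq = (=), le = leC\<rparr>"

definition "Lbar = ortho_along L1 \<iota>"

lemma pi_mono: "\<lbrakk>x \<in> N; y \<in> N; leN x y\<rbrakk> \<Longrightarrow> \<pi> x \<sqsubseteq> \<pi> y"
proof -
  assume *: "x \<in> N" "y \<in> N" "leN x y"
  have "\<And>b. b \<in> {x,y} \<Longrightarrow> leN x b" using * N_refl by auto
  then have "\<exists>g\<in>N. (\<forall>z\<in>N. leN z g \<longleftrightarrow> (\<forall>b\<in>{x,y}. leN z b)) \<and>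
      (\<forall>z\<in>carrier L. z \<sqsubseteq> \<pi> g \<longleftrightarrow> (\<forall>b\<in>{x,y}. z \<sqsubseteq> \<pi> b))"
    by (intro N_inf[OF _ _ *(1)]) (use * in auto)
  then obtain g where g: "g \<in> N" "\<And>z. z \<in> N \<Longrightarrow> leN z g \<longleftrightarrow> leN z x \<and> leN z y"
    "\<And>z. z \<in> carrier L \<Longrightarrow> z \<sqsubseteq> \<pi> g \<longleftrightarrow> z \<sqsubseteq> \<pi> x \<and> z \<sqsubseteq> \<pi> y"
    by auto
  have "leN g x" using g(1,2) N_refl[OF g(1)] by blast
  moreover have "leN x g" using g(2)[OF *(1)] * N_refl[OF *(1)] by blast
  ultimately have "g = x" using N_antisym g(1) *(1) by blast
  then show ?thesis using g(3)[of "\<pi> x"] pi_closed[OF *(1)] by simp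
qed

lemma D_disj: "x \<in> D \<Longrightarrow> x \<notin> carrier L" "x \<in> D \<Longrightarrow> x \<notin> N"
  using iota_N by (auto simp: D_def)

lemma N_disj': "x \<in> N \<Longrightarrow> x \<notin> carrier L" "x \<in> N \<Longrightarrow> x \<notin> D"
  using N_disj D_disj by auto

lemma L_disj: "x \<in> carrier L \<Longrightarrow> x \<notin> N" "x \<in> carrier L \<Longrightarrow> x \<notin> D"
  using N_disj D_disj by auto

lemma iota_D: "x \<in> D \<Longrightarrow> \<iota> x \<in> N" "x \<in> D \<Longrightarrow> \<iota> (\<iota> x) = x"
  by (auto simp: D_def iota_iota)

lemma iota_in_D: "x \<in> N \<Longrightarrow> \<iota> x \<in> D"
  by (auto simp: D_def)

lemma iota_closed: "x \<in> C \<Longrightarrow> \<iota> x \<in> C"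
  by (auto simp: C_def iota_D iota_in_D iota_L orth_closed)

lemma iota_invol: "x \<in> C \<Longrightarrow> \<iota> (\<iota> x) = x"
  by (auto simp: C_def iota_D iota_iota iota_L orth_closed orth_orth)

lemma C_cases [consumes 1, case_names L N D]:
  assumes "x \<in> C"
  obtains "x \<in> carrier L" | "x \<in> N" | "x \<in> D"
  using assms by (auto simp: C_def)

lemma lo_simps [simp]: "x \<in> carrier L \<Longrightarrow> lo x = x" "x \<in> N \<Longrightarrow> lo x = \<pi> x" "x \<in> D \<Longrightarrow> lo x = \<bottom>"
  and hi_simps [simp]: "x \<in> carrier L \<Longrightarrow> hi x = x" "x \<in> N \<Longrightarrow> hi x = \<top>"
     "x \<in> D \<Longrightarrow> hi x = orth L (\<pi> (\<iota> x))"
  by (auto simp: lo_def hi_def D_disj N_disj')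

lemma lo_closed [simp]: "x \<in> C \<Longrightarrow> lo x \<in> carrier L"
  and hi_closed [simp]: "x \<in> C \<Longrightarrow> hi x \<in> carrier L"
  by (auto elim!: C_cases simp: pi_closed orth_closed iota_D)

lemma lo_le_hi: "x \<in> C \<Longrightarrow> lo x \<sqsubseteq> hi x"
  by (auto elim!: C_cases simp: pi_closed orth_closed iota_D)

lemma lo_iota: "x \<in> C \<Longrightarrow> lo (\<iota> x) = orth L (hi x)"
  and hi_iota: "x \<in> C \<Longrightarrow> hi (\<iota> x) = orth L (lo x)"
  by (auto elim!: C_cases simp: pi_closed orth_closed orth_orth iota_D iota_L iota_in_D iota_iota
      orth_bounds)

lemma leC_iota: "\<lbrakk>x \<in> C; y \<in> C\<rbrakk> \<Longrightarrow> leC (\<iota> x) (\<iota> y) \<longleftrightarrow> leC y x"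
proof -
  assume *: "x \<in> C" "y \<in> C"
  have N: "\<iota> z \<in> N \<longleftrightarrow> z \<in> D" and D: "\<iota> z \<in> D \<longleftrightarrow> z \<in> N" if "z \<in> C" for z
    using that by (auto elim!: C_cases simp: iota_L L_disj orth_closed iota_D iota_in_D dest: D_disj N_disj' L_disj)
  show ?thesis
    using * unfolding leC_def by (auto simp: N D iota_closed iota_invol lo_iota hi_iota orth_le_iff)
qed

lemma leC_refl: "x \<in> C \<Longrightarrow> leC x x"
  by (auto simp: leC_def N_refl iota_D elim!: C_cases)

lemma not_top_le_pi: "\<lbrakk>x \<in> N\<rbrakk> \<Longrightarrow> \<not> \<top> \<sqsubseteq> \<pi> x"
  using pi_closed pi_not_top le_antisym top_higher top_closed by blast

lemma orth_pi_not_bottom: "\<lbrakk>x \<in> N\<rbrakk> \<Longrightarrow> \<not> orth L (\<pi> x) \<sqsubseteq> \<bottom>"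
  by (metis orth_bounds(2) orth_le_iff pi_closed not_top_le_pi top_closed)

lemma le_hi_lo_imp_L: "x \<in> C \<Longrightarrow> hi x \<sqsubseteq> lo x \<Longrightarrow> x \<in> carrier L"
  by (auto elim!: C_cases simp: not_top_le_pi orth_pi_not_bottom iota_D)

lemma leC_lo_mono: "leC x y \<Longrightarrow> lo x \<sqsubseteq> lo y"
proof -
  assume *: "leC x y"
  then have c: "x \<in> C" "y \<in> C" by (auto simp: leC_def)
  show ?thesis
  proof (cases "hi x \<sqsubseteq> lo y")
    case True
    then show ?thesis using le_trans[OF lo_le_hi[OF c(1)] True] c by simp
  next
    case False
    then consider "x \<in> N" "y \<in> N" "leN x y" | "x \<in> D" "y \<in> D"
      using * by (auto simp: leC_def)
    then show ?thesis by cases (auto intro: pi_mono)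
  qed
qed

lemma leC_antisym: "\<lbrakk>leC x y; leC y x\<rbrakk> \<Longrightarrow> x = y"
proof -
  assume *: "leC x y" "leC y x"
  then have c: "x \<in> C" "y \<in> C" by (auto simp: leC_def)
  note mon = leC_lo_mono
  \<comment> \<open>The four approximations in \<open>lo x \<sqsubseteq> hi x \<sqsubseteq> lo y \<sqsubseteq> hi y \<sqsubseteq> lo x\<close> coincide, hence \<open>x\<close> and \<open>y\<close> lie in \<open>L\<close>.\<close>
  have key: "x = y" if h: "hi x \<sqsubseteq> lo y" and xy: "leC x y" "leC y x" for x y
  proof -
    have c: "x \<in> C" "y \<in> C" using xy by (auto simp: leC_def)
    have "hi x \<sqsubseteq> lo x" using le_trans[OF h mon[OF xy(2)] hi_closed lo_closed lo_closed, OF c c(1)] .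
    then have x: "x \<in> carrier L" by (rule le_hi_lo_imp_L[OF c(1)])
    then have "x \<sqsubseteq> lo y" using h by simp
    moreover have "lo y \<sqsubseteq> x" using mon[OF xy(2)] x by simp
    ultimately have lo: "lo y = x" using le_antisym[of "lo y" x] c x by simp
    have "hi y \<sqsubseteq> lo x" using xy(2) x by (auto simp: leC_def L_disj)
    then have "hi y \<sqsubseteq> lo y" using lo x by simp
    then have "y \<in> carrier L" by (rule le_hi_lo_imp_L[OF c(2)])
    then show "x = y" using lo by simp
  qed
  show ?thesis
  proof (cases "hi x \<sqsubseteq> lo y \<or> hi y \<sqsubseteq> lo x")
    case True
    then show ?thesis using key[of x y] key[of y x] * by auto
  next
    case False
    then consider "x \<in> N" "y \<in> N" "leN x y" "leN y x"
      | "x \<in> D" "y \<in> D" "leN (\<iota> x) (\<iota> y)" "leN (\<iota> y) (\<iota> x)"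
      using * N_disj' by (auto simp: leC_def)
    then show ?thesis
    proof cases
      case 1
      then show ?thesis by (simp add: N_antisym)
    next
      case 2
      then have "\<iota> x = \<iota> y" by (simp add: N_antisym iota_D)
      then show ?thesis using 2 iota_D(2) by metis
    qed
  qed
qed

lemma leC_hi_mono: "leC x y \<Longrightarrow> hi x \<sqsubseteq> hi y"
proof -
  assume *: "leC x y"
  then have "x \<in> C" "y \<in> C" by (auto simp: leC_def)
  then have "lo (\<iota> y) \<sqsubseteq> lo (\<iota> x)" using leC_lo_mono leC_iota * by blast
  then show ?thesis using \<open>x \<in> C\<close> \<open>y \<in> C\<close> by (simp add: lo_iota orth_le_iff)
qed

lemma leC_trans: "\<lbrakk>leC x y; leC y z\<rbrakk> \<Longrightarrow> leC x z"
proof -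
  assume *: "leC x y" "leC y z"
  then have c: "x \<in> C" "y \<in> C" "z \<in> C" by (auto simp: leC_def)
  show ?thesis
  proof (cases "hi x \<sqsubseteq> lo y \<or> hi y \<sqsubseteq> lo z")
    case True
    then have "hi x \<sqsubseteq> lo z"
      using leC_hi_mono[OF *(1)] leC_lo_mono[OF *(2)] c by (meson hi_closed le_trans lo_closed)
    then show ?thesis using c by (simp add: leC_def)
  next
    case False
    then consider "x \<in> N" "y \<in> N" "z \<in> N" "leN x y" "leN y z"
      | "x \<in> D" "y \<in> D" "z \<in> D" "leN (\<iota> y) (\<iota> x)" "leN (\<iota> z) (\<iota> y)"
      using * N_disj' by (auto simp: leC_def)
    then show ?thesis
    proof cases
      case 1
      then have "leN x z" using N_trans by blast
      then show ?thesis using 1 c by (simp add: leC_def)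
    next
      case 2
      then have "leN (\<iota> z) (\<iota> x)" using N_trans iota_D by blast
      then show ?thesis using 2 c by (simp add: leC_def)
    qed
  qed
qed

text \<open>
  A set with a lower bound in \<open>N\<close> consists of elements of \<open>N\<close> and possibly \<open>\<top>\<close>; the crown provides the infimum of
  the former, and \<open>\<top>\<close> is the infimum if there are none. For any other set, the lower bounds are compared with its elements by means of \<open>lo\<close> alone, so the infimum is the one of \<open>lo ` A\<close> in \<open>L\<close>.
  The infimum is taken with respect to all of \<open>C\<close>, so that it serves both \<open>L1\<close> and \<open>Lbar\<close>.
\<close>

lemma L1_inf:
  assumes A: "A \<subseteq> carrier L \<union> N"
  shows "\<exists>g\<in>carrier L \<union> N. \<forall>y\<in>C. leC y g \<longleftrightarrow> (\<forall>a\<in>A. leC y a)"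
proof -
  have AC: "a \<in> C" if "a \<in> A" for a using A that by (auto simp: C_def)
  have hi_le: "leC y a \<longleftrightarrow> hi y \<sqsubseteq> lo a" if "y \<in> C" "y \<notin> N" "a \<in> carrier L \<union> N" for y a
    using that by (auto simp: leC_def C_def dest: D_disj)
  show ?thesis
  proof (cases "\<exists>l\<in>N. \<forall>a\<in>A. leC l a")
    case True
    then obtain l where l: "l \<in> N" "\<And>a. a \<in> A \<Longrightarrow> leC l a" by auto
    have top: "a = \<top>" if "a \<in> A" "a \<notin> N" for a
    proof -
      have "a \<in> carrier L" using that A by auto
      then have "\<top> \<sqsubseteq> a" using l(2)[OF that(1)] l(1) by (auto simp: leC_def L_disj)
      then show ?thesis using \<open>a \<in> carrier L\<close> le_antisym top_higher top_closed by blast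
    qed
    have top_le: "leC y \<top>" if "y \<in> C" for y using that by (auto simp: leC_def C_def[symmetric]) (auto simp: C_def)
    show ?thesis
    proof (cases "A \<inter> N = {}")
      case True
      then show ?thesis using top top_le by (intro bexI[of _ \<top>]) auto
    next
      case False
      have lN: "leN l b" if "b \<in> A \<inter> N" for b
      proof -
        have "\<not> hi l \<sqsubseteq> lo b" using that l(1) by (simp add: not_top_le_pi)
        then show ?thesis using that l(2)[of b] l(1) by (auto simp: leC_def dest: N_disj')
      qed
      obtain g where g: "g \<in> N" "\<forall>y\<in>N. leN y g \<longleftrightarrow> (\<forall>b\<in>A \<inter> N. leN y b)"
        "\<forall>z\<in>carrier L. z \<sqsubseteq> \<pi> g \<longleftrightarrow> (\<forall>b\<in>A \<inter> N. z \<sqsubseteq> \<pi> b)"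
        using N_inf[of "A \<inter> N" l] False l lN by auto
      have NN: "leC y b \<longleftrightarrow> leN y b" if "y \<in> N" "b \<in> N" for y b
        using that not_top_le_pi by (auto simp: leC_def C_def dest: N_disj')
      have "leC y g \<longleftrightarrow> (\<forall>a\<in>A \<inter> N. leC y a)" if "y \<in> C" for y
      proof (cases "y \<in> N")
        case True
        then show ?thesis using g NN by auto
      next
        case False
        then show ?thesis using g(1) g(3) hi_le[OF that False] that by auto
      qed
      moreover have "(\<forall>a\<in>A. leC y a) \<longleftrightarrow> (\<forall>a\<in>A \<inter> N. leC y a)" if "y \<in> C" for y
        using top top_le[OF that] by auto
      ultimately show ?thesis using g(1) by auto
    qed
  next
    case False
    let ?g = "\<Sqinter>(lo ` A)"
    have sub: "lo ` A \<subseteq> carrier L" using AC by auto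
    have g: "?g \<in> carrier L" using sub by auto
    have gle: "z \<sqsubseteq> ?g \<longleftrightarrow> (\<forall>a\<in>A. z \<sqsubseteq> lo a)" if "z \<in> carrier L" for z
      using le_Inf_iff[OF sub that] by simp
    have "leC y ?g \<longleftrightarrow> (\<forall>a\<in>A. leC y a)" if y: "y \<in> C" for y
    proof (cases "y \<in> N")
      case True
      have "\<not> leC y ?g"
      proof
        assume *: "leC y ?g"
        have "\<forall>a\<in>A. leC ?g a"
          using g gle[of ?g] AC by (auto simp: leC_def C_def)
        then show False using False True * leC_trans by blast
      qed
      then show ?thesis using False True by auto
    next
      case False
      then show ?thesis using hi_le[OF y False] g gle[of "hi y"] y A by (auto simp: subset_iff)
    qed
    then show ?thesis using g by (intro bexI[of _ ?g]) auto
  qed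
qed

text \<open>
  Below an element \<open>d\<close> of \<open>D\<close> there are only \<open>\<bottom>\<close> and elements of \<open>D\<close>. Hence if \<open>A\<close> meets \<open>D\<close>, its infimum
  is \<open>\<bottom>\<close> or \<open>\<iota> e\<close>, where \<open>e\<close> is the infimum of all \<open>m\<close> in \<open>N\<close> for which \<open>\<iota> m\<close> is a lower bound. The latter infimum exists in \<open>N\<close>
  because \<open>\<iota> d\<close> is below all these \<open>m\<close>; and \<open>\<iota> e\<close> is below the elements of \<open>A\<close> outside of \<open>D\<close> because \<open>\<pi>\<close> preserves the
  infimum.
\<close>

lemma C_inf:
  assumes A: "A \<subseteq> C"
  shows "\<exists>g\<in>C. \<forall>y\<in>C. leC y g \<longleftrightarrow> (\<forall>a\<in>A. leC y a)"
proof (cases "A \<inter> D = {}")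
  case True
  then have "A \<subseteq> carrier L \<union> N" using A by (auto simp: C_def)
  then show ?thesis using L1_inf[of A] by (auto simp: C_def)
next
  case False
  then obtain d where d: "d \<in> A" "d \<in> D" by auto
  define E where "E = {m \<in> N. \<forall>a\<in>A. leC (\<iota> m) a}"
  have bot_le: "leC \<bottom> y" if "y \<in> C" for y
    using that by (auto simp: leC_def C_def[symmetric]) (auto simp: C_def)
  have lower: "y = \<bottom> \<or> y \<in> D" if "leC y d" for y
  proof (rule disjCI)
    assume "y \<notin> D"
    then have y: "hi y \<sqsubseteq> \<bottom>" "y \<in> C" using that d D_disj by (auto simp: leC_def)
    have "y \<notin> N"
    proof
      assume "y \<in> N"
      then have "\<top> \<sqsubseteq> \<bottom>" using y by simp
      then have "\<top> \<sqsubseteq> \<pi> y"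
        using le_trans[of \<top> \<bottom> "\<pi> y"] pi_closed[OF \<open>y \<in> N\<close>] by simp
      then show False using not_top_le_pi[OF \<open>y \<in> N\<close>] by simp
    qed
    then have "y \<in> carrier L" using y \<open>y \<notin> D\<close> by (auto simp: C_def)
    then show "y = \<bottom>" using y le_antisym by auto
  qed
  show ?thesis
  proof (cases "E = {}")
    case True
    have "leC y \<bottom> \<longleftrightarrow> (\<forall>a\<in>A. leC y a)" if y: "y \<in> C" for y
    proof
      assume "leC y \<bottom>"
      then show "\<forall>a\<in>A. leC y a" using bot_le A leC_trans by blast
    next
      assume *: "\<forall>a\<in>A. leC y a"
      have "y \<notin> D"
      proof
        assume "y \<in> D"
        then have "\<iota> y \<in> E" using * by (auto simp: E_def iota_D)
        then show False using True by auto
      qed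
      then have "y = \<bottom>" using lower d * by auto
      then show "leC y \<bottom>" using y leC_refl by simp
    qed
    then show ?thesis by (intro bexI[of _ \<bottom>]) (auto simp: C_def)
  next
    case False
    have DD: "leC (\<iota> m) a \<longleftrightarrow> leN (\<iota> a) m" if "m \<in> N" "a \<in> D" for m a
      using that iota_in_D[OF that(1)] orth_pi_not_bottom[OF that(1)]
      by (auto simp: leC_def C_def iota_iota dest: D_disj)
    have DX: "leC (\<iota> m) a \<longleftrightarrow> orth L (lo a) \<sqsubseteq> \<pi> m" if "m \<in> N" "a \<in> C" "a \<notin> D" for m a
      using that iota_in_D[OF that(1)] orth_le_iff[of "\<pi> m" "orth L (lo a)"]
      by (auto simp: leC_def C_def iota_iota orth_orth orth_closed pi_closed dest: D_disj)
    have "leN (\<iota> d) b" if "b \<in> E" for b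
      using that d DD[of b d] by (auto simp: E_def)
    then obtain e where e: "e \<in> N" "\<forall>y\<in>N. leN y e \<longleftrightarrow> (\<forall>b\<in>E. leN y b)"
      "\<forall>z\<in>carrier L. z \<sqsubseteq> \<pi> e \<longleftrightarrow> (\<forall>b\<in>E. z \<sqsubseteq> \<pi> b)"
      using N_inf[OF _ False iota_D(1)[OF d(2)]] by (metis (no_types, lifting) E_def mem_Collect_eq subsetI)
    have e_lower: "leC (\<iota> e) a" if a: "a \<in> A" for a
    proof (cases "a \<in> D")
      case True
      then show ?thesis using e a DD by (auto simp: E_def iota_D)
    next
      case False
      then show ?thesis using e a DX A by (auto simp: E_def orth_closed subset_iff)
    qed
    have "leC y (\<iota> e) \<longleftrightarrow> (\<forall>a\<in>A. leC y a)" if y: "y \<in> C" for y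
    proof
      assume "leC y (\<iota> e)"
      then show "\<forall>a\<in>A. leC y a" using e_lower leC_trans by blast
    next
      assume *: "\<forall>a\<in>A. leC y a"
      show "leC y (\<iota> e)"
      proof (cases "y \<in> D")
        case True
        then have "\<iota> y \<in> E" using * by (auto simp: E_def iota_D)
        then have "leN e (\<iota> y)" using e N_refl by auto
        then show ?thesis using DD[of "\<iota> y" "\<iota> e"] True e by (simp add: iota_D iota_in_D iota_iota)
      next
        case False
        then have "y = \<bottom>" using lower d * by auto
        then show ?thesis using bot_le e iota_in_D by (auto simp: C_def)
      qed
    qed
    then show ?thesis using e iota_in_D by (intro bexI[of _ "\<iota> e"]) (auto simp: C_def)
  qed
qed

lemma iota_orth_image: "\<iota> ` carrier L = carrier L"
proof
  show "\<iota> ` carrier L \<subseteq> carrier L" by (auto simp: iota_L orth_closed)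
  show "carrier L \<subseteq> \<iota> ` carrier L"
  proof
    fix x assume x: "x \<in> carrier L"
    then have "x = \<iota> (orth L x)" by (simp add: iota_L orth_closed orth_orth)
    then show "x \<in> \<iota> ` carrier L" using x orth_closed by blast
  qed
qed

lemma carrier_Lbar [simp]: "carrier Lbar = C"
proof -
  have "\<iota> ` carrier L = carrier L"
    using iota_orth_image .
  then show ?thesis by (auto simp: Lbar_def ortho_along_def L1_def C_def D_def)
qed

lemma iota_image: "\<iota> ` (carrier L \<union> N) = carrier L \<union> D"
proof -
  show ?thesis by (simp add: image_Un iota_orth_image D_def)
qed

lemma inj_iota: "inj_on \<iota> C"
  by (metis inj_onI iota_invol)

lemma eq_Lbar [simp]: "eq Lbar = (=)"
  by (simp add: Lbar_def ortho_along_def)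

text \<open>
  The transitive closure adds only relations from \<open>D\<close> to \<open>N\<close>, and for these \<open>hi x\<close> is a stopover in \<open>L\<close>.
\<close>

lemma le_Lbar [simp]: "le Lbar = leC"
proof -
  define R where "R = {(u, v). u \<in> carrier L1 \<and> v \<in> carrier L1 \<and> le L1 u v} \<union>
               {(\<iota> u, \<iota> v) | u v. u \<in> carrier L1 \<and> v \<in> carrier L1 \<and> le L1 v u}"
  have sub: "carrier L1 \<subseteq> C" by (auto simp: L1_def C_def)
  have R: "leC x y" if "(x, y) \<in> R" for x y
    using that sub leC_iota unfolding R_def L1_def by auto
  have "leC x y" if "(x, y) \<in> R\<^sup>+" for x y
    using that by induction (auto intro: R leC_trans)
  moreover have "(x, y) \<in> R\<^sup>+" if le: "leC x y" for x y
  proof -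
    have c: "x \<in> C" "y \<in> C" using le by (auto simp: leC_def)
    have up: "(u, v) \<in> R" if "leC u v" "u \<in> carrier L \<union> N" "v \<in> carrier L \<union> N" for u v
      using that unfolding R_def L1_def by auto
    have dn: "(u, v) \<in> R" if "leC u v" "u \<in> carrier L \<union> D" "v \<in> carrier L \<union> D" for u v
    proof -
      have uv: "u \<in> C" "v \<in> C" using that by (auto simp: C_def)
      have *: "\<iota> w \<in> carrier L \<union> N" if "w \<in> carrier L \<union> D" for w
        using that by (auto simp: iota_D iota_L orth_closed)
      have "leC (\<iota> v) (\<iota> u)" using that uv leC_iota by auto
      moreover have "(\<iota> p, \<iota> q) \<in> R" if "p \<in> carrier L \<union> N" "q \<in> carrier L \<union> N" "leC q p" for p q
        using that unfolding R_def L1_def by auto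
      ultimately have "(\<iota> (\<iota> u), \<iota> (\<iota> v)) \<in> R" using * that by blast
      then show ?thesis using uv by (simp add: iota_invol)
    qed
    consider "x \<in> carrier L \<union> N" "y \<in> carrier L \<union> N" | "x \<in> carrier L \<union> D" "y \<in> carrier L \<union> D"
      | "x \<in> D" "y \<in> N" | "x \<in> N" "y \<in> D"
      using c by (auto simp: C_def)
    then show ?thesis
    proof cases
      case 3
      then have "hi x \<sqsubseteq> lo y" using le by (auto simp: leC_def dest: D_disj)
      moreover have "hi x \<in> carrier L" using c by simp
      ultimately have "leC x (hi x)" "leC (hi x) y"
        using c by (auto simp: leC_def C_def)
      then have "(x, hi x) \<in> R" "(hi x, y) \<in> R"
        using 3 \<open>hi x \<in> carrier L\<close> up[of "hi x" y] dn[of x "hi x"] by blast+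
      then show ?thesis by auto
    next
      case 4
      then have "\<top> \<sqsubseteq> \<bottom>" using le by (auto simp: leC_def dest: D_disj)
      then have "\<top> \<sqsubseteq> \<pi> x" using pi_closed[OF 4(1)] bottom_lower le_trans bottom_closed top_closed by blast
      then show ?thesis using not_top_le_pi 4 by auto
    qed (use le up dn in auto)
  qed
  ultimately show ?thesis
    unfolding Lbar_def ortho_along_def R_def[symmetric] by (auto simp: fun_eq_iff)
qed

lemma orth_Lbar: "x \<in> C \<Longrightarrow> orth Lbar x = \<iota> x"
proof -
  assume x: "x \<in> C"
  show ?thesis
  proof (cases "x \<in> carrier L1")
    case True
    then show ?thesis unfolding Lbar_def ortho_along_def by simp
  next
    case False
    then have "x \<in> D" using x by (auto simp: C_def L1_def)
    have "inj_on \<iota> (carrier L1)"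
      by (rule inj_on_subset[OF inj_iota]) (auto simp: C_def L1_def)
    then have "inv_into (carrier L1) \<iota> x = \<iota> x"
      using \<open>x \<in> D\<close> iota_D by (intro inv_into_f_eq) (auto simp: L1_def)
    then show ?thesis using False by (simp add: Lbar_def ortho_along_def)
  qed
qed

lemma complete_lattice_Lbar: "complete_lattice Lbar"
proof (rule complete_lattice_if_infs)
  show "partial_order Lbar"
    by (rule partial_orderI_eq) (auto intro: leC_refl leC_antisym leC_trans)
qed (use C_inf in auto)

lemma complete_lattice_L1: "complete_lattice L1"
proof (rule complete_lattice_if_infs)
  show "partial_order L1"
    by (rule partial_orderI_eq) (auto intro: leC_refl leC_antisym leC_trans simp: L1_def C_def)
  fix A assume A: "A \<subseteq> carrier L1"
  show "\<exists>g\<in>carrier L1. \<forall>y\<in>carrier L1. le L1 y g \<longleftrightarrow> (\<forall>a\<in>A. le L1 y a)"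
    using L1_inf[of A] A by (auto simp: L1_def C_def)
qed

lemma bounded_Lbar: "bounded_lattice Lbar" and bounded_L1: "bounded_lattice L1"
  using complete_lattice_Lbar complete_lattice_L1 complete_lattice_imp_bounded by auto

lemma leC_L_iff: "x \<in> carrier L \<Longrightarrow> leC x y \<longleftrightarrow> y \<in> C \<and> x \<sqsubseteq> lo y"
  "x \<in> carrier L \<Longrightarrow> leC y x \<longleftrightarrow> y \<in> C \<and> hi y \<sqsubseteq> x"
  by (auto simp: leC_def C_def L_disj)

lemma sublattice_of_leC:
  assumes "bounded_lattice M" "carrier L \<subseteq> carrier M" "carrier M \<subseteq> C" "le M = leC"
  shows "sublattice01 L M"
proof (rule sublattice01I)
  fix x y w
  assume *: "x \<in> carrier L" "y \<in> carrier L"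
  show "le M x y \<longleftrightarrow> x \<sqsubseteq> y" using * assms by (auto simp: leC_L_iff C_def)
  assume w: "w \<in> carrier M"
  { assume "le M x w" "le M y w"
    then show "le M (x \<squnion> y) w" using * w assms by (auto simp: leC_L_iff intro!: join_le) }
  { assume "le M w x" "le M w y"
    then show "le M w (x \<sqinter> y)" using * w assms by (auto simp: leC_L_iff intro!: meet_le) }
next
  fix w assume "w \<in> carrier M"
  then have "w \<in> C" using assms by auto
  then show "le M w \<top>" "le M \<bottom> w" using assms by (auto simp: leC_L_iff)
qed (use assms in \<open>auto intro: bounded_lattice_axioms\<close>)

lemma sublattice_Lbar: "sublattice01 L Lbar"
  by (rule sublattice_of_leC) (auto simp: bounded_Lbar C_def)

lemma top_Lbar: "\<top>\<^bsub>Lbar\<^esub> = \<top>" and bottom_Lbar: "\<bottom>\<^bsub>Lbar\<^esub> = \<bottom>"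
  using sublattice_Lbar by (auto simp: sublattice01_def)

lemma iota_swap: "x \<in> N \<Longrightarrow> \<iota> x \<notin> N" "x \<in> D \<Longrightarrow> \<iota> x \<notin> D"
  using iota_in_D iota_D D_disj by blast+

lemma ortholattice_Lbar: "ortholattice Lbar"
proof -
  interpret M: complete_lattice Lbar by (rule complete_lattice_Lbar)
  interpret M: bounded_lattice Lbar by (rule bounded_Lbar)
  \<comment> \<open>An upper bound \<open>w\<close> of \<open>x\<close> and \<open>\<iota> x\<close> cannot be compared with both within \<open>N\<close> or within \<open>D\<close>, so \<open>lo w\<close> is above a join of complements in \<open>L\<close>.\<close>
  have join: "x \<squnion>\<^bsub>Lbar\<^esub> \<iota> x = \<top>" if x: "x \<in> C" for x
  proof (rule M.join_eqI)
    fix w assume w: "w \<in> carrier Lbar" "le Lbar x w" "le Lbar (\<iota> x) w"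
    have wC: "w \<in> C" using w by simp
    have lohi: "lo w \<in> carrier L" "hi w \<in> carrier L" using wC by auto
    have "hi x \<sqsubseteq> lo w \<or> hi (\<iota> x) \<sqsubseteq> lo w"
      using w(2,3) iota_swap[of x] D_disj(2) unfolding le_Lbar leC_def by blast
    moreover have "lo x \<sqsubseteq> lo w" "lo (\<iota> x) \<sqsubseteq> lo w"
      using w leC_lo_mono by auto
    ultimately have "hi x \<squnion> orth L (hi x) \<sqsubseteq> lo w \<or> lo x \<squnion> orth L (lo x) \<sqsubseteq> lo w"
      using x lohi by (auto simp: lo_iota hi_iota orth_closed le_join_meet_iff)
    then have "\<top> \<sqsubseteq> lo w" using x by (simp add: join_orth)
    then show "le Lbar \<top> w" using wC by (simp add: leC_L_iff)
  qed (use x iota_closed in \<open>auto simp: leC_L_iff\<close>, simp add: C_def)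
  have meet: "x \<sqinter>\<^bsub>Lbar\<^esub> \<iota> x = \<bottom>" if x: "x \<in> C" for x
  proof (rule M.meet_eqI)
    fix w assume w: "w \<in> carrier Lbar" "le Lbar w x" "le Lbar w (\<iota> x)"
    have wC: "w \<in> C" using w by simp
    have lohi: "lo w \<in> carrier L" "hi w \<in> carrier L" using wC by auto
    have "hi w \<sqsubseteq> lo x \<or> hi w \<sqsubseteq> lo (\<iota> x)"
      using w(2,3) iota_swap[of x] D_disj(2) unfolding le_Lbar leC_def by blast
    moreover have "hi w \<sqsubseteq> hi x" "hi w \<sqsubseteq> hi (\<iota> x)"
      using w leC_hi_mono by auto
    ultimately have "hi w \<sqsubseteq> hi x \<sqinter> orth L (hi x) \<or> hi w \<sqsubseteq> lo x \<sqinter> orth L (lo x)"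
      using x lohi by (auto simp: lo_iota hi_iota orth_closed le_join_meet_iff)
    then have "hi w \<sqsubseteq> \<bottom>" using x by (simp add: meet_orth)
    then show "le Lbar w \<bottom>" using wC by (simp add: leC_L_iff)
  qed (use x iota_closed in \<open>auto simp: leC_L_iff\<close>, simp add: C_def)
  show ?thesis
    by unfold_locales
      (auto simp: orth_Lbar iota_closed iota_invol leC_iota join meet top_Lbar bottom_Lbar)
qed

theorem complete_ortholattice_Lbar: "complete_ortholattice Lbar"
  using ortholattice_Lbar complete_lattice_Lbar by (simp add: complete_ortholattice_def)

lemma subortholattice_Lbar: "subortholattice L Lbar"
  using ortholattice_Lbar sublattice_Lbar ortholattice_axioms
  by (auto simp: subortholattice_def orth_Lbar C_def iota_L)

lemma tri_sub_L1: "L \<unlhd> L1"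
proof -
  have sub: "sublattice01 L L1"
    by (rule sublattice_of_leC) (auto simp: bounded_L1, auto simp: L1_def C_def)
  then have top: "\<top>\<^bsub>L1\<^esub> = \<top>" by (simp add: sublattice01_def)
  have "\<exists>g. greatest L1 g {z \<in> carrier L. le L1 z x}" if "x \<in> carrier L1" for x
  proof -
    have "x \<in> C" using that by (auto simp: L1_def C_def)
    then have "greatest L1 (lo x) {z \<in> carrier L. le L1 z x}"
      by (auto simp: greatest_def L1_def leC_L_iff C_def[symmetric]) (auto simp: C_def)
    then show ?thesis ..
  qed
  moreover have "x \<in> carrier L"
    if "z \<in> carrier L - {\<top>}" "x \<in> carrier L1" "le L1 x z" for x z
  proof (rule ccontr)
    assume "x \<notin> carrier L"
    then have "x \<in> N" using that by (auto simp: L1_def)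
    then have "\<top> \<sqsubseteq> z" using that by (auto simp: L1_def leC_L_iff)
    then show False using that le_antisym by auto
  qed
  ultimately show ?thesis using sub top by (auto simp: tri_sub_def)
qed

lemma convex_L: "convex_in (carrier L) Lbar"
proof -
  have "x \<in> carrier L"
    if *: "a \<in> carrier L" "a' \<in> carrier L" "x \<in> C" "a \<noteq> \<bottom>" "leC a x" "leC x a'" "a' \<noteq> \<top>" for a a' x
    using *(3)
  proof (cases rule: C_cases)
    case N
    then have "\<top> \<sqsubseteq> a'" using * by (auto simp: leC_L_iff)
    then show ?thesis using * le_antisym by auto
  next
    case D
    then have "a \<sqsubseteq> \<bottom>" using * by (auto simp: leC_L_iff)
    then show ?thesis using * le_antisym by auto
  qed
  moreover have "carrier L \<subseteq> C" by (auto simp: C_def)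
  ultimately show ?thesis
    unfolding convex_in_def lless_def top_Lbar bottom_Lbar carrier_Lbar le_Lbar eq_Lbar by metis
qed

lemma is_ortho_Lbar:
  shows "is_ortho Lbar L1 L"
proof -
  have "inj_on \<iota> (carrier L1)"
    by (rule inj_on_subset[OF inj_iota]) (auto simp: C_def L1_def)
  moreover have "carrier L1 \<inter> \<iota> ` carrier L1 = carrier L"
    by (auto simp: L1_def iota_image dest: N_disj')
  ultimately show ?thesis
    using tri_sub_L1 ortholattice_axioms unfolding is_ortho_def
    by (auto intro!: exI[of _ \<iota>] simp: Lbar_def iota_L)
qed

end

context crowned
begin

text \<open>
  The joins and meets that occur in the evaluation of polynomials. The essential one is \<open>meet_NN_L\<close>:
  two new elements without a lower bound in \<open>N\<close> meet in \<open>L\<close>, which is how values return to \<open>L\<close>.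
\<close>

lemma leC_N_iff:
  assumes "x \<in> N"
  shows "leC x y \<longleftrightarrow> y \<in> N \<and> leN x y \<or> y = \<top>"
proof -
  have "y = \<top>" if "y \<in> C" "\<top> \<sqsubseteq> lo y"
  proof (rule ccontr)
    assume "y \<noteq> \<top>"
    then have "y \<notin> carrier L" using that le_antisym[of y \<top>] by auto
    then have "lo y \<noteq> \<top>" using that pi_not_top pi_closed
      by (cases rule: C_cases[OF that(1)])
        (auto, metis assms bottom_lower le_antisym pi_closed top_closed top_higher pi_not_top)
    then show False using that lo_closed[OF that(1)] le_antisym[of "lo y" \<top>] by auto
  qed
  moreover have "\<top> \<in> C" by (simp add: C_def)
  ultimately show ?thesis
    using assms N_disj'[OF assms] not_top_le_pi by (auto simp: leC_def) (auto simp: C_def)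
qed

lemma leC_iff_N:
  assumes "y \<in> N"
  shows "leC x y \<longleftrightarrow> x \<in> N \<and> leN x y \<or> x \<in> C \<and> x \<notin> N \<and> hi x \<sqsubseteq> \<pi> y"
  using assms N_disj'[OF assms] not_top_le_pi by (auto simp: leC_def C_def L_disj)

lemma po_Lbar: "partial_order Lbar"
  using complete_lattice_Lbar by (simp add: complete_lattice_def)

lemma N_sub_C: "x \<in> N \<Longrightarrow> x \<in> C" and L_sub_C: "x \<in> carrier L \<Longrightarrow> x \<in> C"
  by (auto simp: C_def)

lemma join_LN:
  assumes "x \<in> carrier L" "y \<in> N" "z \<in> N" "leN y z" "x \<sqsubseteq> \<pi> z"
    and "\<And>w. \<lbrakk>w \<in> N; leN y w; x \<sqsubseteq> \<pi> w\<rbrakk> \<Longrightarrow> leN z w"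
  shows "x \<squnion>\<^bsub>Lbar\<^esub> y = z"
  by (rule partial_order.join_eqI[OF po_Lbar])
    (use assms in \<open>auto simp: leC_N_iff leC_L_iff N_sub_C L_sub_C\<close>)

lemma join_LN_top:
  assumes "x \<in> carrier L" "y \<in> N"
    and "\<And>w. \<lbrakk>w \<in> N; leN y w\<rbrakk> \<Longrightarrow> \<not> x \<sqsubseteq> \<pi> w"
  shows "x \<squnion>\<^bsub>Lbar\<^esub> y = \<top>"
  by (rule partial_order.join_eqI[OF po_Lbar])
    (use assms in \<open>auto simp: leC_N_iff leC_L_iff N_sub_C L_sub_C\<close>)

lemma join_NN:
  assumes "x \<in> N" "y \<in> N" "z \<in> N" "leN x z" "leN y z"
    and "\<And>w. \<lbrakk>w \<in> N; leN x w; leN y w\<rbrakk> \<Longrightarrow> leN z w"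
  shows "x \<squnion>\<^bsub>Lbar\<^esub> y = z"
  by (rule partial_order.join_eqI[OF po_Lbar])
    (use assms in \<open>auto simp: leC_N_iff leC_L_iff N_sub_C L_sub_C\<close>)

lemma join_NN_top:
  assumes "x \<in> N" "y \<in> N"
    and "\<And>w. \<lbrakk>w \<in> N; leN x w\<rbrakk> \<Longrightarrow> \<not> leN y w"
  shows "x \<squnion>\<^bsub>Lbar\<^esub> y = \<top>"
  by (rule partial_order.join_eqI[OF po_Lbar])
    (use assms in \<open>auto simp: leC_N_iff leC_L_iff N_sub_C L_sub_C\<close>)

lemma meet_NN:
  assumes "x \<in> N" "y \<in> N" "z \<in> N" "leN z x" "leN z y"
    and "\<And>w. \<lbrakk>w \<in> N; leN w x; leN w y\<rbrakk> \<Longrightarrow> leN w z"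
  shows "x \<sqinter>\<^bsub>Lbar\<^esub> y = z"
proof (rule partial_order.meet_eqI[OF po_Lbar])
  have "\<exists>g\<in>N. (\<forall>z\<in>N. leN z g \<longleftrightarrow> (\<forall>b\<in>{x,y}. leN z b)) \<and>
      (\<forall>z\<in>carrier L. z \<sqsubseteq> \<pi> g \<longleftrightarrow> (\<forall>b\<in>{x,y}. z \<sqsubseteq> \<pi> b))"
    by (rule N_inf[OF _ _ assms(3)]) (use assms in auto)
  then obtain g where g: "g \<in> N" "\<And>z. z \<in> N \<Longrightarrow> leN z g \<longleftrightarrow> leN z x \<and> leN z y"
    "\<And>z. z \<in> carrier L \<Longrightarrow> z \<sqsubseteq> \<pi> g \<longleftrightarrow> z \<sqsubseteq> \<pi> x \<and> z \<sqsubseteq> \<pi> y"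
    by auto
  have "leN g z" using g(2)[OF g(1)] N_refl[OF g(1)] assms(6)[OF g(1)] by blast
  moreover have "leN z g" using g(2)[OF assms(3)] assms(4,5) by blast
  ultimately have z: "g = z" using N_antisym[OF g(1) assms(3)] by blast
  fix w assume "w \<in> carrier Lbar" "le Lbar w x" "le Lbar w y"
  then show "le Lbar w z"
    using assms(1,2,3) assms(6)[of w] g(3)[of "hi w"] z by (auto simp: leC_iff_N)
qed (use assms in \<open>auto simp: leC_iff_N N_sub_C\<close>)

lemma meet_NN_L:
  assumes "x \<in> N" "y \<in> N" "\<And>w. \<lbrakk>w \<in> N; leN w x\<rbrakk> \<Longrightarrow> \<not> leN w y"
  shows "x \<sqinter>\<^bsub>Lbar\<^esub> y = \<pi> x \<sqinter> \<pi> y"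
  by (rule partial_order.meet_eqI[OF po_Lbar])
    (use assms in \<open>auto simp: leC_iff_N leC_L_iff N_sub_C L_sub_C L_disj pi_closed meet_left meet_right intro!: meet_le\<close>)

end

section \<open>The gadget of a function\<close>

text \<open>
  \<open>Box u v\<close> stands for the interval of all \<open>y\<close> in \<open>L\<^sup>n\<close> with \<open>u ! i \<sqsubseteq> y ! i \<sqsubseteq> v ! i\<close> for all \<open>i\<close>, and boxes are ordered by
  inclusion. \<open>Rail\<close> and \<open>Peak\<close> are two copies of \<open>L\<close>, the second above the first, with \<open>Tip x\<close> above the rail up to
  \<open>f x\<close> and above the one-point box \<open>Box x x\<close>.
\<close>

datatype 'e piece =
    is_Box: Box "'e list" "'e list"
  | is_Tip: Tip "'e list"
  | is_Rail: Rail 'e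
  | is_Peak: Peak 'e

fun gadget_le :: "('e, 'm) gorder_scheme \<Rightarrow> nat \<Rightarrow> ('e list \<Rightarrow> 'e) \<Rightarrow> 'e piece \<Rightarrow> 'e piece \<Rightarrow> bool" where
  "gadget_le L n f (Box u v) (Box u' v') \<longleftrightarrow>
     (\<forall>i<n. u' ! i \<sqsubseteq>\<^bsub>L\<^esub> u ! i \<and> v ! i \<sqsubseteq>\<^bsub>L\<^esub> v' ! i)"
| "gadget_le L n f (Box u v) (Tip x) \<longleftrightarrow> u = x \<and> v = x"
| "gadget_le L n f (Tip x) (Tip y) \<longleftrightarrow> x = y"
| "gadget_le L n f (Rail w) (Tip x) \<longleftrightarrow> w \<sqsubseteq>\<^bsub>L\<^esub> f x"
| "gadget_le L n f (Rail w) (Rail w') \<longleftrightarrow> w \<sqsubseteq>\<^bsub>L\<^esub> w'"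
| "gadget_le L n f (Rail w) (Peak w') \<longleftrightarrow> w \<sqsubseteq>\<^bsub>L\<^esub> w'"
| "gadget_le L n f (Peak w) (Peak w') \<longleftrightarrow> w \<sqsubseteq>\<^bsub>L\<^esub> w'"
| "gadget_le L n f _ _ \<longleftrightarrow> False"

text \<open>
  The largest box and the largest peak are left out: in the extension their role is played by \<open>\<top>\<close>.
\<close>

definition gadget :: "('e, 'm) gorder_scheme \<Rightarrow> nat \<Rightarrow> 'e piece set" where
  "gadget L n =
     {Box u v | u v. u \<in> tuples L n \<and> v \<in> tuples L n \<and> (\<forall>i<n. u ! i \<sqsubseteq>\<^bsub>L\<^esub> v ! i) \<and>
                     (\<exists>i<n. u ! i \<noteq> \<bottom>\<^bsub>L\<^esub> \<or> v ! i \<noteq> \<top>\<^bsub>L\<^esub>)} \<union>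
     Tip ` tuples L n \<union> Rail ` carrier L \<union> Peak ` (carrier L - {\<top>\<^bsub>L\<^esub>})"

text \<open>
  With this value on boxes, an element \<open>z\<close> of \<open>L\<close> is below \<open>Box u v\<close> iff \<open>z \<sqsubseteq> v ! i\<close> and \<open>u ! i \<sqsubseteq> orth L z\<close> for
  all \<open>i\<close>. Thus a join with \<open>x ! i\<close> turns the box \<open>y ! i = \<bottom>\<close> into \<open>y ! i \<sqsubseteq> x ! i\<close>, and a join with the complement of \<open>x ! i\<close>
  turns the box \<open>y ! i = \<top>\<close> into \<open>x ! i \<sqsubseteq> y ! i\<close>.
\<close>

fun gadget_floor :: "('e, 'm) ortholat_scheme \<Rightarrow> 'e piece \<Rightarrow> 'e" where
  "gadget_floor L (Box u v) = \<Sqinter>\<^bsub>L\<^esub>(set v \<union> orth L ` set u)"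
| "gadget_floor L (Tip x) = \<bottom>\<^bsub>L\<^esub>"
| "gadget_floor L (Rail w) = \<bottom>\<^bsub>L\<^esub>"
| "gadget_floor L (Peak w) = w"

lemma tuples_iff: "xs \<in> tuples M n \<longleftrightarrow> length xs = n \<and> (\<forall>i<n. xs ! i \<in> carrier M)"
  by (auto simp: tuples_def subset_iff in_set_conv_nth)

lemma tuples_nth: "xs \<in> tuples M n \<Longrightarrow> i < n \<Longrightarrow> xs ! i \<in> carrier M"
  by (simp add: tuples_iff)

context complete_ortholattice
begin

lemma le_floor_Box:
  assumes "u \<in> tuples L n" "v \<in> tuples L n" "z \<in> carrier L"
  shows "z \<sqsubseteq> gadget_floor L (Box u v) \<longleftrightarrow> (\<forall>i<n. u ! i \<sqsubseteq> orth L z \<and> z \<sqsubseteq> v ! i)"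
proof -
  have "set v \<union> orth L ` set u \<subseteq> carrier L"
    using assms by (auto simp: tuples_def orth_closed)
  then have "z \<sqsubseteq> gadget_floor L (Box u v) \<longleftrightarrow>
      (\<forall>a\<in>set v. z \<sqsubseteq> a) \<and> (\<forall>a\<in>set u. z \<sqsubseteq> orth L a)"
    using assms by (simp add: le_Inf_iff) blast
  also have "\<dots> \<longleftrightarrow> (\<forall>i<n. z \<sqsubseteq> v ! i) \<and> (\<forall>i<n. z \<sqsubseteq> orth L (u ! i))"
    using assms by (simp add: tuples_def all_set_conv_all_nth)
  finally have "z \<sqsubseteq> gadget_floor L (Box u v) \<longleftrightarrow>
      (\<forall>i<n. z \<sqsubseteq> v ! i) \<and> (\<forall>i<n. z \<sqsubseteq> orth L (u ! i))" .
  then show ?thesis using assms by (auto simp: le_orth_iff tuples_iff)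
qed

lemma Box_in_gadget:
  "Box u v \<in> gadget L n \<longleftrightarrow> u \<in> tuples L n \<and> v \<in> tuples L n \<and> (\<forall>i<n. u ! i \<sqsubseteq> v ! i) \<and>
                     (\<exists>i<n. u ! i \<noteq> \<bottom> \<or> v ! i \<noteq> \<top>)"
  and Tip_in_gadget: "Tip x \<in> gadget L n \<longleftrightarrow> x \<in> tuples L n"
  and Rail_in_gadget: "Rail w \<in> gadget L n \<longleftrightarrow> w \<in> carrier L"
  and Peak_in_gadget: "Peak w \<in> gadget L n \<longleftrightarrow> w \<in> carrier L \<and> w \<noteq> \<top>"
  by (auto simp: gadget_def)

lemmas in_gadget = Box_in_gadget Tip_in_gadget Rail_in_gadget Peak_in_gadget

lemma floor_Box_point:
  assumes "x \<in> tuples L n" "0 < n"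
  shows "gadget_floor L (Box x x) = \<bottom>"
proof -
  have sub: "set x \<union> orth L ` set x \<subseteq> carrier L"
    using assms by (auto simp: tuples_def orth_closed)
  let ?z = "gadget_floor L (Box x x)"
  have z: "?z \<in> carrier L" using sub by simp
  then have *: "x ! 0 \<sqsubseteq> orth L ?z" "?z \<sqsubseteq> x ! 0" using le_floor_Box[of x n x ?z] assms by auto
  have x: "x ! 0 \<in> carrier L" using assms by (auto simp: tuples_iff)
  have "?z \<sqsubseteq> orth L (x ! 0)" using * le_orth_iff[OF x z] by simp
  then have "?z \<sqsubseteq> x ! 0 \<sqinter> orth L (x ! 0)" using * x z by (intro meet_le) (auto simp: orth_closed)
  then show ?thesis using z x by (simp add: meet_orth le_bottom_iff)
qed

text \<open>
  Intersections of boxes are boxes, infima of peaks are peaks, and both are preserved by the floor. The other sets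
  with at least two elements that have a lower bound contain a tip or a rail element, so the floor of their infimum has to
  be \<open>\<bottom>\<close>. If the lower bound is a box, then it is below some \<open>Tip x\<close>, hence equal to \<open>Box x x\<close>, and it is the infimum.
  If it is on the rail, then so is the infimum. The two cases do not interfere: since a tip has a single box below it,
  and different tips have different ones, no box is below two tips, nor below a tip and an element of the rail.
\<close>

lemma gadget_crown:
  assumes nontriv: "\<top> \<noteq> \<bottom>" and f: "f \<in> tuples L n \<rightarrow> carrier L"
  shows "crown L (gadget L n) (gadget_le L n f) (gadget_floor L)"
proof -
  let ?N = "gadget L n" and ?le = "gadget_le L n f" and ?\<pi> = "gadget_floor L"
  have f': "f x \<in> carrier L" if "x \<in> tuples L n" for x using f that by auto
  have point: "u = x \<and> v = x"
    if "u \<in> tuples L n" "v \<in> tuples L n" "x \<in> tuples L n" "\<forall>i<n. u ! i \<sqsubseteq> v ! i"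
      "\<forall>i<n. x ! i \<sqsubseteq> u ! i \<and> v ! i \<sqsubseteq> x ! i" for u v x
  proof -
    have "u ! i = x ! i \<and> v ! i = x ! i" if "i < n" for i
      using that \<open>\<forall>i<n. u ! i \<sqsubseteq> v ! i\<close> \<open>\<forall>i<n. x ! i \<sqsubseteq> u ! i \<and> v ! i \<sqsubseteq> x ! i\<close>
        tuples_nth[OF \<open>u \<in> _\<close>] tuples_nth[OF \<open>v \<in> _\<close>] tuples_nth[OF \<open>x \<in> _\<close>]
      by (meson le_antisym le_trans)
    then show ?thesis using that by (auto simp: tuples_def intro!: nth_equalityI)
  qed
  have trans: "?le x z" if xyz: "x \<in> ?N" "y \<in> ?N" "z \<in> ?N" "?le x y" "?le y z" for x y z
  proof (cases "is_Box y \<and> is_Tip z")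
    case True
    then have "\<exists>t. y = Box t t \<and> z = Tip t" using xyz(5) by (cases y; cases z) simp_all
    then obtain t where t: "y = Box t t" "z = Tip t" by blast
    then have "\<exists>u v. x = Box u v" using xyz(4) by (cases x) simp_all
    then obtain u v where uv: "x = Box u v" by blast
    have "u = t \<and> v = t"
      by (rule point) (use xyz t uv in \<open>auto simp: in_gadget\<close>)
    then show ?thesis using uv t by simp
  next
    case False
    then show ?thesis using xyz
      by (cases x; cases y; cases z) (simp_all add: in_gadget, (meson le_trans f' tuples_nth)+)
  qed
  have refl: "?le x x" if "x \<in> ?N" for x
    using that by (cases x) (auto simp: in_gadget tuples_iff)
  have antisym: "x = y" if "x \<in> ?N" "y \<in> ?N" "?le x y" "?le y x" for x y
  proof (cases x)
    case (Box u v)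
    have "\<exists>u' v'. y = Box u' v'" using that(4) Box by (cases y) simp_all
    then obtain u' v' where y: "y = Box u' v'" by blast
    have t: "u \<in> tuples L n" "v \<in> tuples L n" "u' \<in> tuples L n" "v' \<in> tuples L n"
      using that(1,2) Box y by (simp_all add: in_gadget)
    have "u ! i = u' ! i \<and> v ! i = v' ! i" if "i < n" for i
      using \<open>?le x y\<close> \<open>?le y x\<close> that Box y t[THEN tuples_nth, OF that] by (simp add: le_antisym)
    then show ?thesis using Box y t by (auto simp: tuples_def intro!: nth_equalityI)
  qed (use that in \<open>cases y; simp add: in_gadget le_antisym\<close>)+
  have closed: "?\<pi> x \<in> carrier L" if "x \<in> ?N" for x
    using that by (cases x) (auto simp: in_gadget tuples_def orth_closed intro!: inf_closed)
  have not_top: "?\<pi> x \<noteq> \<top>" if x: "x \<in> ?N" for x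
  proof (cases x)
    case (Box u v)
    then have uv: "u \<in> tuples L n" "v \<in> tuples L n" "\<exists>i<n. u ! i \<noteq> \<bottom> \<or> v ! i \<noteq> \<top>"
      using x by (auto simp: in_gadget)
    show ?thesis
    proof
      assume "?\<pi> x = \<top>"
      then have "\<top> \<sqsubseteq> ?\<pi> (Box u v)" using Box by simp
      then have "\<forall>i<n. u ! i \<sqsubseteq> orth L \<top> \<and> \<top> \<sqsubseteq> v ! i" using le_floor_Box[OF uv(1,2)] by simp
      then show False using uv by (auto simp: tuples_iff le_bottom_iff top_le_iff orth_bounds)
    qed
  qed (use x nontriv in \<open>auto simp: in_gadget\<close>)
  have inf: "\<exists>g\<in>?N. (\<forall>y\<in>?N. ?le y g \<longleftrightarrow> (\<forall>b\<in>B. ?le y b)) \<and>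
          (\<forall>z\<in>carrier L. z \<sqsubseteq> ?\<pi> g \<longleftrightarrow> (\<forall>b\<in>B. z \<sqsubseteq> ?\<pi> b))"
    if B: "B \<subseteq> ?N" "B \<noteq> {}" and l: "l \<in> ?N" and lB: "\<And>b. b \<in> B \<Longrightarrow> ?le l b" for B l
  proof -
    consider (single) b where "B = {b}"
      | (boxes) "\<forall>b\<in>B. is_Box b"
      | (peaks) "\<forall>b\<in>B. is_Peak b"
      | (other) "\<nexists>b. B = {b}" "\<not> (\<forall>b\<in>B. is_Box b)" "\<not> (\<forall>b\<in>B. is_Peak b)"
      by blast
    then show ?thesis
    proof cases
      case single
      then show ?thesis using B by auto
    next
      case boxes
      define U where "U = map (\<lambda>i. \<Squnion>{u ! i | u v. Box u v \<in> B}) [0..<n]"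
      define V where "V = map (\<lambda>i. \<Sqinter>{v ! i | u v. Box u v \<in> B}) [0..<n]"
      have B': "u \<in> tuples L n" "v \<in> tuples L n" "\<forall>i<n. u ! i \<sqsubseteq> v ! i"
        "\<exists>i<n. u ! i \<noteq> \<bottom> \<or> v ! i \<noteq> \<top>" if "Box u v \<in> B" for u v
        using B(1) that in_gadget(1)[of u v n] by blast+
      have subU: "{u ! i | u v. Box u v \<in> B} \<subseteq> carrier L"
        and subV: "{v ! i | u v. Box u v \<in> B} \<subseteq> carrier L" if "i < n" for i
        using B' that by (auto simp: tuples_iff)
      have U: "U \<in> tuples L n" and V: "V \<in> tuples L n"
        using subU subV by (auto simp: tuples_iff U_def V_def)
      have U_le: "U ! i \<sqsubseteq> z \<longleftrightarrow> (\<forall>u v. Box u v \<in> B \<longrightarrow> u ! i \<sqsubseteq> z)"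
        and le_V: "z \<sqsubseteq> V ! i \<longleftrightarrow> (\<forall>u v. Box u v \<in> B \<longrightarrow> z \<sqsubseteq> v ! i)"
        if "i < n" "z \<in> carrier L" for i z
      proof -
        have "U ! i \<sqsubseteq> z \<longleftrightarrow> (\<forall>a\<in>{u ! i | u v. Box u v \<in> B}. a \<sqsubseteq> z)"
          using Sup_le_iff[OF subU[OF that(1)] that(2)] that(1) by (simp add: U_def V_def)
        then show "U ! i \<sqsubseteq> z \<longleftrightarrow> (\<forall>u v. Box u v \<in> B \<longrightarrow> u ! i \<sqsubseteq> z)" by blast
        have "z \<sqsubseteq> V ! i \<longleftrightarrow> (\<forall>a\<in>{v ! i | u v. Box u v \<in> B}. z \<sqsubseteq> a)"
          using le_Inf_iff[OF subV[OF that(1)] that(2)] that(1) by (simp add: U_def V_def)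
        then show "z \<sqsubseteq> V ! i \<longleftrightarrow> (\<forall>u v. Box u v \<in> B \<longrightarrow> z \<sqsubseteq> v ! i)" by blast
      qed
      have box_iff: "(\<forall>b\<in>B. P b) \<longleftrightarrow> (\<forall>u v. Box u v \<in> B \<longrightarrow> P (Box u v))" for P
        using boxes by (metis piece.collapse(1))
      obtain b0 where "b0 \<in> B" using B by auto
      then obtain u0 v0 where b0: "Box u0 v0 \<in> B" using boxes by (metis piece.collapse(1))
      obtain p q where l': "l = Box p q" using lB[OF b0] by (cases l) auto
      have pq: "p \<in> tuples L n" "q \<in> tuples L n" "\<forall>i<n. p ! i \<sqsubseteq> q ! i"
        using l l' by (auto simp: in_gadget)
      have g: "Box U V \<in> ?N"
      proof -
        have "U ! i \<sqsubseteq> V ! i" if i: "i < n" for i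
        proof -
          have c: "p ! i \<in> carrier L" "q ! i \<in> carrier L" "U ! i \<in> carrier L" "V ! i \<in> carrier L"
            using pq U V i unfolding tuples_iff by blast+
          have "U ! i \<sqsubseteq> p ! i" using U_le[OF i c(1)] lB l' i by fastforce
          moreover have "q ! i \<sqsubseteq> V ! i" using le_V[OF i c(2)] lB l' i by fastforce
          ultimately show ?thesis using pq i c le_trans by meson
        qed
        moreover have "\<exists>i<n. U ! i \<noteq> \<bottom> \<or> V ! i \<noteq> \<top>"
        proof -
          obtain i where i: "i < n" "u0 ! i \<noteq> \<bottom> \<or> v0 ! i \<noteq> \<top>" using B'(4)[OF b0] by blast
          have c: "u0 ! i \<in> carrier L" "v0 ! i \<in> carrier L" "U ! i \<in> carrier L" "V ! i \<in> carrier L"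
            using B'(1,2)[OF b0] U V i unfolding tuples_iff by blast+
          have "u0 ! i \<sqsubseteq> U ! i" using U_le[OF i(1) c(3)] b0 c by blast
          moreover have "V ! i \<sqsubseteq> v0 ! i" using le_V[OF i(1) c(4)] b0 c by blast
          ultimately have "U ! i \<noteq> \<bottom> \<or> V ! i \<noteq> \<top>"
            using i c by (metis le_bottom_iff top_le_iff)
          then show ?thesis using i by blast
        qed
        ultimately show ?thesis using U V unfolding Box_in_gadget by blast
      qed
      have "?le y (Box U V) \<longleftrightarrow> (\<forall>b\<in>B. ?le y b)" if y: "y \<in> ?N" for y
      proof (cases y)
        case (Box u v)
        then have uv: "u \<in> tuples L n" "v \<in> tuples L n" using y by (auto simp: in_gadget)
        have "?le y (Box U V) \<longleftrightarrow> (\<forall>i<n. \<forall>p q. Box p q \<in> B \<longrightarrow> p ! i \<sqsubseteq> u ! i \<and> v ! i \<sqsubseteq> q ! i)"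
          using U_le le_V uv[THEN tuples_nth] by (simp add: Box) blast
        then show ?thesis unfolding box_iff by (simp add: Box) blast
      qed (use b0 in \<open>force+\<close>)
      moreover have "z \<sqsubseteq> ?\<pi> (Box U V) \<longleftrightarrow> (\<forall>b\<in>B. z \<sqsubseteq> ?\<pi> b)" if z: "z \<in> carrier L" for z
      proof -
        have "z \<sqsubseteq> ?\<pi> (Box U V) \<longleftrightarrow>
            (\<forall>i<n. \<forall>p q. Box p q \<in> B \<longrightarrow> p ! i \<sqsubseteq> orth L z \<and> z \<sqsubseteq> q ! i)"
          unfolding le_floor_Box[OF U V z] using U_le[OF _ orth_closed[OF z]] le_V[OF _ z] by simp blast
        also have "\<dots> \<longleftrightarrow> (\<forall>p q. Box p q \<in> B \<longrightarrow> z \<sqsubseteq> ?\<pi> (Box p q))"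
          using le_floor_Box[OF B'(1,2) z] by (simp del: gadget_floor.simps) blast
        finally show ?thesis unfolding box_iff .
      qed
      ultimately show ?thesis using g by blast
    next
      case peaks
      let ?W = "{w. Peak w \<in> B}"
      have sub: "?W \<subseteq> carrier L" using B by (auto simp: in_gadget)
      have peak_iff: "(\<forall>b\<in>B. P b) \<longleftrightarrow> (\<forall>w\<in>?W. P (Peak w))" for P
        using peaks by (metis (mono_tags) mem_Collect_eq piece.collapse(4))
      obtain w0 where w0: "w0 \<in> ?W" using B peaks by (metis (mono_tags) all_not_in_conv mem_Collect_eq piece.collapse(4))
      then have "w0 \<noteq> \<top>" "w0 \<in> carrier L" using B by (auto simp: in_gadget)
      moreover have "\<Sqinter>?W \<sqsubseteq> w0" using inf_lower[OF sub w0] .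
      ultimately have "Peak (\<Sqinter>?W) \<in> ?N" using sub unfolding in_gadget by (metis inf_closed top_le_iff)
      moreover have "?le y (Peak (\<Sqinter>?W)) \<longleftrightarrow> (\<forall>b\<in>B. ?le y b)" if "y \<in> ?N" for y
        unfolding peak_iff using that w0 le_Inf_iff[OF sub] by (cases y) (auto simp: in_gadget)
      moreover have "z \<sqsubseteq> ?\<pi> (Peak (\<Sqinter>?W)) \<longleftrightarrow> (\<forall>b\<in>B. z \<sqsubseteq> ?\<pi> b)" if "z \<in> carrier L" for z
        unfolding peak_iff using le_Inf_iff[OF sub that] by simp
      ultimately show ?thesis by blast
    next
      case other
      have two: False if "\<And>b. b \<in> B \<Longrightarrow> b = a" for a
        using that B(2) other(1) by blast
      show ?thesis
      proof (cases l)
        case (Box u v)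
        obtain b x where b: "b \<in> B" "b = Tip x"
          using other(2) lB Box by (metis gadget_le.simps piece.exhaust piece.disc(1))
        have uv: "u = x" "v = x" using lB[OF b(1)] b Box by auto
        have x: "x \<in> tuples L n" and n: "0 < n" using l Box uv by (auto simp: in_gadget)
        obtain b' where b': "b' \<in> B" "b' \<noteq> Tip x" using two by blast
        have "is_Box b'" using lB[OF b'(1)] b' Box uv by (cases b') auto
        then have Bx: "?le y l \<longleftrightarrow> (\<forall>b\<in>B. ?le y b)" if "y \<in> ?N" for y
        proof -
          have "?le y l" if *: "\<forall>b\<in>B. ?le y b"
          proof -
            have "is_Box y" using * b' \<open>is_Box b'\<close> by (cases y; cases b') (auto dest!: bspec)
            moreover have "?le y (Tip x)" using * b by auto
            ultimately have "y = l" using Box uv by (cases y) auto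
            then show ?thesis using refl l by simp
          qed
          moreover have "?le y b" if "?le y l" "b \<in> B" for b
            using trans[OF \<open>y \<in> ?N\<close> l _ that(1) lB[OF that(2)]] B that by blast
          ultimately show ?thesis by blast
        qed
        have \<pi>l: "?\<pi> l = \<bottom>" using floor_Box_point[OF x n] Box uv by simp
        have \<pi>b: "?\<pi> b = \<bottom>" using b by simp
        have "z \<sqsubseteq> ?\<pi> l \<longleftrightarrow> (\<forall>b\<in>B. z \<sqsubseteq> ?\<pi> b)" if z: "z \<in> carrier L" for z
        proof
          assume "z \<sqsubseteq> ?\<pi> l"
          then have "z = \<bottom>" using z \<pi>l by (simp add: le_bottom_iff)
          then show "\<forall>b\<in>B. z \<sqsubseteq> ?\<pi> b" using closed B by auto
        qed (use b \<pi>b \<pi>l in auto)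
        then show ?thesis using Bx l by blast
      next
        case (Tip x)
        have "b = Tip x" if "b \<in> B" for b using lB[OF that] Tip by (cases b) auto
        then show ?thesis using two by blast
      next
        case (Peak w)
        have "is_Peak b" if "b \<in> B" for b using lB[OF that] Peak by (cases b) auto
        then show ?thesis using other by blast
      next
        case (Rail r)
        \<comment> \<open>The rail element over \<open>w\<close> is below \<open>b\<close> iff \<open>w \<sqsubseteq> lab b\<close>, as \<open>B\<close> contains no boxes.\<close>
        define lab where "lab b = (case b of Tip x \<Rightarrow> f x | Rail w \<Rightarrow> w | Peak w \<Rightarrow> w | Box u v \<Rightarrow> \<bottom>)" for b
        have nobox: "\<not> is_Box b" if "b \<in> B" for b using lB[OF that] Rail by (cases b) auto
        have lab: "lab b \<in> carrier L" if "b \<in> B" for b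
          using that B(1) f' by (cases b) (auto simp: lab_def in_gadget)
        have sub: "lab ` B \<subseteq> carrier L" using lab by auto
        have rail_le: "?le (Rail w) b \<longleftrightarrow> w \<sqsubseteq> lab b" if "b \<in> B" for w b
          using nobox[OF that] by (cases b) (auto simp: lab_def)
        let ?g = "Rail (\<Sqinter>(lab ` B))"
        have only: "is_Rail y" if y: "\<forall>b\<in>B. ?le y b" for y
        proof (cases y)
          case (Box u v)
          have "b = Tip u" if "b \<in> B" for b
            using y that Box nobox[OF that] by (cases b) (auto dest!: bspec)
          then show ?thesis using two by blast
        next
          case (Tip x)
          have "b = Tip x" if "b \<in> B" for b using y that Tip by (cases b) (auto dest!: bspec)
          then show ?thesis using two by blast
        next
          case (Peak w)
          have "is_Peak b" if "b \<in> B" for b using y that Peak by (cases b) (auto dest!: bspec)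
          then show ?thesis using other by blast
        qed simp
        have "?le y ?g \<longleftrightarrow> (\<forall>b\<in>B. ?le y b)" if y: "y \<in> ?N" for y
        proof (cases y)
          case (Rail w)
          then show ?thesis using y le_Inf_iff[OF sub, of w] rail_le by (auto simp: in_gadget)
        qed (use only[of y] in auto)
        moreover have "z \<sqsubseteq> ?\<pi> ?g \<longleftrightarrow> (\<forall>b\<in>B. z \<sqsubseteq> ?\<pi> b)" if z: "z \<in> carrier L" for z
        proof
          obtain b where b: "b \<in> B" "\<not> is_Peak b" using other by blast
          then have \<pi>b: "?\<pi> b = \<bottom>" using nobox[OF b(1)] by (cases b) auto
          assume "\<forall>b\<in>B. z \<sqsubseteq> ?\<pi> b"
          then show "z \<sqsubseteq> ?\<pi> ?g" using b \<pi>b by auto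
        next
          assume "z \<sqsubseteq> ?\<pi> ?g"
          then have "z = \<bottom>" using z by (simp add: le_bottom_iff)
          then show "\<forall>b\<in>B. z \<sqsubseteq> ?\<pi> b" using closed B by auto
        qed
        moreover have "?g \<in> ?N" using sub by (simp add: in_gadget)
        ultimately show ?thesis by blast
      qed
    qed
  qed
  show ?thesis
  proof (unfold_locales, goal_cases)
    case (6 B l)
    show ?case by (rule inf[OF 6(1,2,3)]) (use 6(4) in blast)
  qed (use refl antisym closed not_top in \<open>auto intro: trans\<close>)
qed

end

section \<open>Interpolation by a pair of gadgets\<close>

text \<open>
  The crown \<open>K\<close> sits inside of \<open>N\<close>, embedded by \<open>e\<close>, without relations to the rest of \<open>N\<close>. Least upper and
  greatest lower bounds in \<open>K\<close> therefore remain such in \<open>N\<close>.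
\<close>

locale crown_part = crowned +
  fixes K :: "'k set" and leK :: "'k \<Rightarrow> 'k \<Rightarrow> bool" and \<rho> :: "'k \<Rightarrow> 'a" and e :: "'k \<Rightarrow> 'a"
  assumes e_in: "p \<in> K \<Longrightarrow> e p \<in> N"
    and e_le: "\<lbrakk>p \<in> K; q \<in> K\<rbrakk> \<Longrightarrow> leN (e p) (e q) \<longleftrightarrow> leK p q"
    and e_up: "\<lbrakk>p \<in> K; y \<in> N; leN (e p) y\<rbrakk> \<Longrightarrow> y \<in> e ` K"
    and e_down: "\<lbrakk>p \<in> K; y \<in> N; leN y (e p)\<rbrakk> \<Longrightarrow> y \<in> e ` K"
    and pi_e: "p \<in> K \<Longrightarrow> \<pi> (e p) = \<rho> p"

locale gadget_component =
  crown_part L N leN \<pi> \<iota> "gadget L n" "gadget_le L n f" "gadget_floor L" e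
  for L :: "('a, 'm) ortholat_scheme" (structure) and N leN \<pi> \<iota> e
    and n :: nat and f :: "'a list \<Rightarrow> 'a" +
  assumes nontriv: "\<top> \<noteq> \<bottom>"
    and f_closed: "x \<in> tuples L n \<Longrightarrow> f x \<in> carrier L"
begin

definition box_elem where
  "box_elem u v = (if \<forall>i<n. u ! i = \<bottom> \<and> v ! i = \<top> then \<top> else e (Box u v))"

lemma box_elem_cases:
  assumes "u \<in> tuples L n" "v \<in> tuples L n" "\<forall>i<n. u ! i \<sqsubseteq> v ! i"
  obtains "Box u v \<in> gadget L n" "box_elem u v = e (Box u v)"
    | "\<forall>i<n. u ! i = \<bottom> \<and> v ! i = \<top>" "box_elem u v = \<top>"
proof (cases "\<forall>i<n. u ! i = \<bottom> \<and> v ! i = \<top>")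
  case True
  then show ?thesis using that(2) by (simp add: box_elem_def)
next
  case False
  then have "Box u v \<in> gadget L n" using assms by (auto simp: Box_in_gadget)
  moreover have "box_elem u v = e (Box u v)" using False unfolding box_elem_def by (rule if_not_P)
  ultimately show ?thesis by (rule that(1))
qed

lemma box_elem_closed:
  assumes "u \<in> tuples L n" "v \<in> tuples L n" "\<forall>i<n. u ! i \<sqsubseteq> v ! i"
  shows "box_elem u v \<in> C"
  by (rule box_elem_cases[OF assms]) (auto simp: N_sub_C L_sub_C e_in)

lemma leC_top: "y \<in> C \<Longrightarrow> leC y \<top>"
  by (simp add: leC_L_iff)

lemma leC_e: "\<lbrakk>p \<in> gadget L n; q \<in> gadget L n\<rbrakk> \<Longrightarrow> leC (e p) (e q) \<longleftrightarrow> gadget_le L n f p q"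
  by (simp add: leC_iff_N e_in e_le)

lemma box_le_box_elem:
  assumes "u \<in> tuples L n" "v \<in> tuples L n" "\<forall>i<n. u ! i \<sqsubseteq> v ! i" "Box p q \<in> gadget L n"
  shows "leC (e (Box p q)) (box_elem u v) \<longleftrightarrow> (\<forall>i<n. u ! i \<sqsubseteq> p ! i \<and> q ! i \<sqsubseteq> v ! i)"
proof (rule box_elem_cases[OF assms(1-3)])
  assume "\<forall>i<n. u ! i = \<bottom> \<and> v ! i = \<top>" "box_elem u v = \<top>"
  moreover have "\<forall>i<n. p ! i \<in> carrier L \<and> q ! i \<in> carrier L"
    using assms(4) by (simp add: Box_in_gadget tuples_iff)
  ultimately show ?thesis by (simp add: leC_top N_sub_C e_in assms(4))
qed (simp add: leC_e assms(4))

lemma not_N_le_box_elem: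
  assumes "u \<in> tuples L n" "v \<in> tuples L n" "\<forall>i<n. u ! i \<sqsubseteq> v ! i" "y \<in> C" "y \<notin> N"
  shows "leC y (box_elem u v) \<longleftrightarrow> (\<forall>i<n. u ! i \<sqsubseteq> orth L (hi y) \<and> hi y \<sqsubseteq> v ! i)"
proof (rule box_elem_cases[OF assms(1-3)])
  assume "\<forall>i<n. u ! i = \<bottom> \<and> v ! i = \<top>" "box_elem u v = \<top>"
  then show ?thesis using assms by (simp add: leC_top orth_closed)
next
  assume "Box u v \<in> gadget L n" "box_elem u v = e (Box u v)"
  then show ?thesis using assms
    by (simp add: leC_iff_N e_in pi_e le_floor_Box del: gadget_floor.simps)
qed

lemma below_some_box:
  assumes "Box u v \<in> gadget L n" "y \<in> N" "leC y (e (Box u v))"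
  obtains p q where "Box p q \<in> gadget L n" "y = e (Box p q)"
proof -
  have "leN y (e (Box u v))" using assms by (simp add: leC_iff_N e_in)
  then obtain r where r: "r \<in> gadget L n" "y = e r" using e_down assms by blast
  then have "gadget_le L n f r (Box u v)" using assms by (simp add: leC_e)
  then have "is_Box r" by (cases r) auto
  then show ?thesis using that r by (cases r) auto
qed

definition bots where "bots = replicate n \<bottom>"
definition tops where "tops = replicate n \<top>"

lemma bots_tops: "i < n \<Longrightarrow> bots ! i = \<bottom>" "i < n \<Longrightarrow> tops ! i = \<top>" "length bots = n" "length tops = n"
  by (auto simp: bots_def tops_def)

lemma update_tuples: "w \<in> carrier L \<Longrightarrow> bots[i := w] \<in> tuples L n" "w \<in> carrier L \<Longrightarrow> tops[i := w] \<in> tuples L n"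
  "bots \<in> tuples L n" "tops \<in> tuples L n"
  by (auto simp: tuples_def bots_def tops_def dest!: set_update_subset_insert[THEN subsetD])

lemma bots_le: "u \<in> tuples L n \<Longrightarrow> \<forall>i<n. bots ! i \<sqsubseteq> u ! i"
  and le_tops: "u \<in> tuples L n \<Longrightarrow> \<forall>i<n. u ! i \<sqsubseteq> tops ! i"
  by (auto simp: bots_tops tuples_iff)

lemma upper_Box_N:
  assumes "Box u v \<in> gadget L n" "w \<in> N" "leN (e (Box u v)) w"
  obtains p q where "w = e (Box p q)" "Box p q \<in> gadget L n" "gadget_le L n f (Box u v) (Box p q)"
  | "\<pi> w = \<bottom>"
proof -
  obtain r where r: "r \<in> gadget L n" "w = e r" using e_up assms by blast
  then have "gadget_le L n f (Box u v) r" using assms by (simp add: e_le)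
  then show ?thesis using that r by (cases r) (auto simp: pi_e simp del: gadget_le.simps(1))
qed

text \<open>
  The least box of floor at least \<open>w\<close> that contains the box of \<open>a\<close> and \<open>b\<close>. Tips above this box do not
  interfere, since their floor is \<open>\<bottom>\<close>.
\<close>

lemma join_Box:
  assumes w: "w \<in> carrier L" and ab: "Box a b \<in> gadget L n"
  shows "w \<squnion>\<^bsub>Lbar\<^esub> e (Box a b) = box_elem (map (\<lambda>x. x \<sqinter> orth L w) a) (map (\<lambda>x. x \<squnion> w) b)"
proof -
  let ?u = "map (\<lambda>x. x \<sqinter> orth L w) a" and ?v = "map (\<lambda>x. x \<squnion> w) b"
  have w': "orth L w \<in> carrier L" using w by (rule orth_closed)
  have t: "a \<in> tuples L n" "b \<in> tuples L n" "\<forall>i<n. a ! i \<sqsubseteq> b ! i" "length a = n" "length b = n"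
    using ab by (simp_all add: Box_in_gadget tuples_iff)
  note c = tuples_nth[OF t(1)] tuples_nth[OF t(2)]
  have uv: "?u \<in> tuples L n" "?v \<in> tuples L n" using t c w w' by (auto simp: tuples_iff)
  have "?u ! i \<sqsubseteq> ?v ! i" if i: "i < n" for i
  proof -
    note ci = c(1)[OF i] c(2)[OF i]
    have "a ! i \<sqinter> orth L w \<sqsubseteq> b ! i"
      using le_trans[OF meet_left[OF ci(1) w'] _ _ ci] t(3) i ci w' by simp
    then show ?thesis
      using le_trans[OF _ join_left[OF ci(2) w]] ci w w' i t(4,5) by simp
  qed
  then have uv_le: "\<forall>i<n. ?u ! i \<sqsubseteq> ?v ! i" by blast
  have iff: "gadget_le L n f (Box a b) (Box p q) \<and> w \<sqsubseteq> \<pi> (e (Box p q)) \<longleftrightarrow>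
      (\<forall>i<n. p ! i \<sqsubseteq> ?u ! i \<and> ?v ! i \<sqsubseteq> q ! i)" if pq: "Box p q \<in> gadget L n" for p q
  proof -
    have p: "p \<in> tuples L n" "q \<in> tuples L n" using pq by (simp_all add: Box_in_gadget)
    have "w \<sqsubseteq> \<pi> (e (Box p q)) \<longleftrightarrow> (\<forall>i<n. p ! i \<sqsubseteq> orth L w \<and> w \<sqsubseteq> q ! i)"
      unfolding pi_e[OF pq] by (rule le_floor_Box[OF p w])
    then show ?thesis
      using tuples_nth[OF p(1)] tuples_nth[OF p(2)] c w w' t(4,5) by (auto simp: le_join_meet_iff)
  qed
  show ?thesis
  proof (cases "w = \<bottom>")
    case True
    have "?u ! i = a ! i" "?v ! i = b ! i" if "i < n" for i
      using c[OF that] t(4,5) that True by (auto simp: orth_bounds intro: meet_eqI join_eqI)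
    then have "?u = a" "?v = b" using t(4,5) by (auto intro: nth_equalityI)
    moreover have "box_elem a b = e (Box a b)" using ab by (auto simp: box_elem_def Box_in_gadget)
    moreover have "w \<squnion>\<^bsub>Lbar\<^esub> e (Box a b) = e (Box a b)"
      using True e_in[OF ab] N_refl pi_closed by (intro join_LN) auto
    ultimately show ?thesis by simp
  next
    case False
    have upper: "\<exists>p q. y = e (Box p q) \<and> Box p q \<in> gadget L n \<and> (\<forall>i<n. p ! i \<sqsubseteq> ?u ! i \<and> ?v ! i \<sqsubseteq> q ! i)"
      if y: "y \<in> N" "leN (e (Box a b)) y" "w \<sqsubseteq> \<pi> y" for y
      by (rule upper_Box_N[OF ab y(1,2)]) (use iff y(3) False w le_bottom_iff in \<open>metis\<close>)+
    show ?thesis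
    proof (cases rule: box_elem_cases[OF uv uv_le])
      case 1
      have "gadget_le L n f (Box a b) (Box ?u ?v) \<and> w \<sqsubseteq> \<pi> (e (Box ?u ?v))"
        using iff[OF 1(1)] uv[THEN tuples_nth] by simp
      moreover have "leN (e (Box ?u ?v)) y" if "y \<in> N" "leN (e (Box a b)) y" "w \<sqsubseteq> \<pi> y" for y
        using upper[OF that] 1(1) e_le by fastforce
      ultimately show ?thesis
        unfolding 1(2) using e_in ab 1(1) e_le by (intro join_LN w) auto
    next
      case 2
      have "\<not> w \<sqsubseteq> \<pi> y" if y: "y \<in> N" "leN (e (Box a b)) y" for y
      proof
        assume "w \<sqsubseteq> \<pi> y"
        then obtain p q where pq: "Box p q \<in> gadget L n" "\<forall>i<n. p ! i \<sqsubseteq> ?u ! i \<and> ?v ! i \<sqsubseteq> q ! i"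
          using upper y by blast
        then have "\<forall>i<n. p ! i = \<bottom> \<and> q ! i = \<top>"
          using 2(1) by (simp add: Box_in_gadget tuples_iff le_bottom_iff top_le_iff)
        then show False using pq(1) by (auto simp: Box_in_gadget)
      qed
      then show ?thesis unfolding 2(2) by (intro join_LN_top w e_in ab)
    qed
  qed
qed

lemma join_half_spaces:
  assumes w: "w \<in> carrier L" and i: "i < n"
  shows "w \<squnion>\<^bsub>Lbar\<^esub> e (Box bots (tops[i := \<bottom>])) = box_elem bots (tops[i := w])"
    and "orth L w \<squnion>\<^bsub>Lbar\<^esub> e (Box (bots[i := \<top>]) tops) = box_elem (bots[i := w]) tops"
proof -
  have ops: "\<bottom> \<sqinter> x = \<bottom>" "\<top> \<sqinter> x = x" "\<bottom> \<squnion> x = x" "\<top> \<squnion> x = \<top>" if "x \<in> carrier L" for x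
    using that bottom_meet top_meet bottom_join top_join by (simp_all add: eq_is_equal)
  have "Box bots (tops[i := \<bottom>]) \<in> gadget L n" "Box (bots[i := \<top>]) tops \<in> gadget L n"
    unfolding Box_in_gadget using i nontriv bots_le le_tops update_tuples
    by (auto simp: bots_tops nth_list_update)
  from join_Box[OF w this(1)] join_Box[OF orth_closed[OF w] this(2)]
  show "w \<squnion>\<^bsub>Lbar\<^esub> e (Box bots (tops[i := \<bottom>])) = box_elem bots (tops[i := w])"
    "orth L w \<squnion>\<^bsub>Lbar\<^esub> e (Box (bots[i := \<top>]) tops) = box_elem (bots[i := w]) tops"
    using w by (simp_all add: bots_def tops_def map_update ops orth_closed orth_orth)
qed

definition meets :: "'a orthoterm list \<Rightarrow> 'a orthoterm" where
  "meets ps = foldr Meet ps (Coeff \<top>)"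

lemma eval_meets:
  assumes "\<And>p. p \<in> set ps \<Longrightarrow> eval_orthoterm Lbar p xs \<in> C"
  shows "eval_orthoterm Lbar (meets ps) xs \<in> C \<and>
    (\<forall>y\<in>C. leC y (eval_orthoterm Lbar (meets ps) xs) \<longleftrightarrow> (\<forall>p\<in>set ps. leC y (eval_orthoterm Lbar p xs)))"
  using assms
proof (induction ps)
  case Nil
  then show ?case by (simp add: meets_def leC_top L_sub_C)
next
  case (Cons p ps)
  interpret M: bounded_lattice Lbar by (rule bounded_Lbar)
  let ?a = "eval_orthoterm Lbar p xs" and ?b = "eval_orthoterm Lbar (meets ps) xs"
  have a: "?a \<in> C" using Cons.prems by simp
  have b: "?b \<in> C" "\<forall>y\<in>C. leC y ?b \<longleftrightarrow> (\<forall>p\<in>set ps. leC y (eval_orthoterm Lbar p xs))"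
    using Cons by auto
  have "eval_orthoterm Lbar (meets (p # ps)) xs = ?a \<sqinter>\<^bsub>Lbar\<^esub> ?b"
    by (simp add: meets_def)
  moreover have "?a \<sqinter>\<^bsub>Lbar\<^esub> ?b \<in> C" using M.meet_closed[of ?a ?b] a b by simp
  moreover have "leC y (?a \<sqinter>\<^bsub>Lbar\<^esub> ?b) \<longleftrightarrow> leC y ?a \<and> leC y ?b" if "y \<in> C" for y
    using M.le_join_meet_iff(2)[of ?a ?b y] a b that by simp
  ultimately show ?case using b by simp
qed

definition point_term :: "'a orthoterm" where
  "point_term = meets (concat (map (\<lambda>i.
     [Join (Var i) (Coeff (e (Box bots (tops[i := \<bottom>])))),
      Join (Orth (Var i)) (Coeff (e (Box (bots[i := \<top>]) tops)))]) [0..<n]))"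

lemma Box_point: "\<lbrakk>0 < n; x \<in> tuples L n\<rbrakk> \<Longrightarrow> Box x x \<in> gadget L n"
  using nontriv by (auto simp: Box_in_gadget tuples_iff)

text \<open>
  The half-spaces \<open>y ! i \<sqsubseteq> x ! i\<close> and \<open>x ! i \<sqsubseteq> y ! i\<close> for all \<open>i\<close> intersect in the single tuple \<open>x\<close>. Their meet in \<open>Lbar\<close> is
  determined by comparing lower bounds; one half-space in coordinate \<open>0\<close> is a proper box, and so the lower bounds in \<open>N\<close> are boxes.
\<close>

lemma eval_point_term:
  assumes x: "x \<in> tuples L n" and n: "0 < n"
  shows "eval_orthoterm Lbar point_term x = e (Box x x)"
proof -
  have xi: "x ! i \<in> carrier L" if "i < n" for i using x that by (rule tuples_nth)
  have orth_xi: "orth Lbar (x ! i) = orth L (x ! i)" if "i < n" for i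
    using xi[OF that] by (simp add: orth_Lbar L_sub_C iota_L)
  let ?E = "eval_orthoterm Lbar point_term x"
  let ?P = "\<lambda>y. \<forall>i<n. leC y (box_elem bots (tops[i := x ! i])) \<and> leC y (box_elem (bots[i := x ! i]) tops)"
  have up_t: "bots \<in> tuples L n" "tops[i := x ! i] \<in> tuples L n" "\<forall>j<n. bots ! j \<sqsubseteq> tops[i := x ! i] ! j"
    and dn_t: "bots[i := x ! i] \<in> tuples L n" "tops \<in> tuples L n" "\<forall>j<n. bots[i := x ! i] ! j \<sqsubseteq> tops ! j"
    if "i < n" for i
    using update_tuples xi[OF that] bots_le[OF update_tuples(2)[OF xi[OF that]]] le_tops[OF update_tuples(1)[OF xi[OF that]]] by auto
  note closed = box_elem_closed[OF up_t] box_elem_closed[OF dn_t]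
  have E: "?E \<in> C \<and> (\<forall>y\<in>C. leC y ?E \<longleftrightarrow> ?P y)"
  proof -
    define ps where "ps = concat (map (\<lambda>i.
      [Join (Var i) (Coeff (e (Box bots (tops[i := \<bottom>])))),
       Join (Orth (Var i)) (Coeff (e (Box (bots[i := \<top>]) tops)))]) [0..<n])"
    have ball: "(\<forall>p\<in>set ps. Q (eval_orthoterm Lbar p x)) \<longleftrightarrow>
        (\<forall>i<n. Q (box_elem bots (tops[i := x ! i])) \<and> Q (box_elem (bots[i := x ! i]) tops))" for Q
      using xi by (auto simp: ps_def join_half_spaces orth_xi)
    have "eval_orthoterm Lbar p x \<in> C" if "p \<in> set ps" for p
      using ball[of "\<lambda>c. c \<in> C"] closed that by blast
    from eval_meets[of ps x, OF this] show ?thesis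
      unfolding ball point_term_def ps_def[symmetric] by blast
  qed
  have Bx: "Box x x \<in> gadget L n" using Box_point n x by blast
  have main: "leC y (e (Box x x)) \<longleftrightarrow> ?P y" if y: "y \<in> C" for y
  proof (cases "y \<in> N")
    case False
    have "leC y (e (Box x x)) \<longleftrightarrow> (\<forall>i<n. x ! i \<sqsubseteq> orth L (hi y) \<and> hi y \<sqsubseteq> x ! i)"
      using False y x Bx by (simp add: leC_iff_N e_in pi_e le_floor_Box del: gadget_floor.simps)
    also have "\<dots> \<longleftrightarrow> ?P y"
      using not_N_le_box_elem[OF up_t y False] not_N_le_box_elem[OF dn_t y False] y
      by (auto simp: bots_tops nth_list_update orth_closed)
    finally show ?thesis .
  next
    case True
    have box: "leC (e (Box p q)) (e (Box x x)) \<longleftrightarrow> ?P (e (Box p q))" if pq: "Box p q \<in> gadget L n" for p q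
    proof -
      have "p ! i \<in> carrier L" "q ! i \<in> carrier L" if "i < n" for i
        using pq that by (auto simp: Box_in_gadget tuples_iff)
      then show ?thesis
        using box_le_box_elem[OF up_t pq] box_le_box_elem[OF dn_t pq] pq Bx
        by (auto simp: leC_e bots_tops nth_list_update)
    qed
    have ex: "\<exists>p q. Box p q \<in> gadget L n \<and> y = e (Box p q)" if "leC y (e (Box x x)) \<or> ?P y"
      using that
    proof
      assume "leC y (e (Box x x))"
      then show ?thesis using below_some_box[OF Bx True] by blast
    next
      assume P: "?P y"
      show ?thesis
      proof (cases "x ! 0 = \<top>")
        case False
        show ?thesis
        proof (cases rule: box_elem_cases[OF up_t[OF n]])
          case 1
          then have "leC y (e (Box bots (tops[0 := x ! 0])))" using P n by metis
          then show ?thesis using below_some_box[OF 1(1) True] by blast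
        next
          case 2
          then show ?thesis using False n by (auto simp: bots_tops)
        qed
      next
        case x0: True
        show ?thesis
        proof (cases rule: box_elem_cases[OF dn_t[OF n]])
          case 1
          then have "leC y (e (Box (bots[0 := x ! 0]) tops))" using P n by metis
          then show ?thesis using below_some_box[OF 1(1) True] by blast
        next
          case 2
          then show ?thesis using x0 n nontriv by (auto simp: bots_tops)
        qed
      qed
    qed
    show ?thesis
    proof
      assume "leC y (e (Box x x))"
      then show "?P y" using ex box by blast
    next
      assume "?P y"
      then obtain p q where "Box p q \<in> gadget L n" "y = e (Box p q)" using ex by blast
      then show "leC y (e (Box x x))" using box \<open>?P y\<close> by blast
    qed
  qed
  have eC: "e (Box x x) \<in> C" using Bx by (simp add: N_sub_C e_in)
  have "leC ?E (e (Box x x))" using main E leC_refl by blast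
  moreover have "leC (e (Box x x)) ?E" using main[OF eC] E eC leC_refl by blast
  ultimately show ?thesis by (rule leC_antisym)
qed

definition peak_elem where "peak_elem w = (if w = \<top> then \<top> else e (Peak w))"

definition value_term :: "'a orthoterm" where
  "value_term = Join (Meet (Join point_term (Coeff (e (Rail \<bottom>)))) (Coeff (e (Rail \<top>)))) (Coeff (e (Peak \<bottom>)))"

text \<open>
  The values on the way are \<open>Box x x\<close>, \<open>Tip x\<close>, \<open>Rail (f x)\<close> and the peak over \<open>f x\<close>. The first join turns \<open>Box x x\<close> into
  \<open>Tip x\<close>, since no other element is above both a box and an element of the rail.
\<close>

lemma eval_value_term:
  assumes x: "x \<in> tuples L n" and n: "0 < n"
  shows "eval_orthoterm Lbar value_term x = peak_elem (f x)"
proof -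
  have fx: "f x \<in> carrier L" using x by (rule f_closed)
  note in_g = Box_point[OF n x] Tip_in_gadget[THEN iffD2, OF x]
    Rail_in_gadget[THEN iffD2, OF bottom_closed] Rail_in_gadget[THEN iffD2, OF top_closed]
    Rail_in_gadget[THEN iffD2, OF fx]
  have pb: "Peak \<bottom> \<in> gadget L n" using nontriv by (simp add: Peak_in_gadget)
  have 1: "e (Box x x) \<squnion>\<^bsub>Lbar\<^esub> e (Rail \<bottom>) = e (Tip x)"
  proof (rule join_NN)
    fix w assume w: "w \<in> N" "leN (e (Box x x)) w" "leN (e (Rail \<bottom>)) w"
    then obtain q where q: "q \<in> gadget L n" "w = e q" using e_up in_g by blast
    then have "gadget_le L n f (Box x x) q" "gadget_le L n f (Rail \<bottom>) q" using w in_g by (auto simp: e_le)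
    then have "q = Tip x" by (cases q) auto
    then show "leN (e (Tip x)) w" using q by (simp add: e_le)
  qed (use in_g fx in \<open>auto simp: e_in e_le\<close>)
  have 2: "e (Tip x) \<sqinter>\<^bsub>Lbar\<^esub> e (Rail \<top>) = e (Rail (f x))"
  proof (rule meet_NN)
    fix w assume w: "w \<in> N" "leN w (e (Tip x))" "leN w (e (Rail \<top>))"
    then obtain q where q: "q \<in> gadget L n" "w = e q" using e_down in_g by blast
    then have "gadget_le L n f q (Tip x)" "gadget_le L n f q (Rail \<top>)" using w in_g by (auto simp: e_le)
    then show "leN w (e (Rail (f x)))" using q in_g by (cases q) (auto simp: e_le)
  qed (use in_g fx in \<open>auto simp: e_in e_le\<close>)
  have upper: "\<exists>w'. w = e (Peak w') \<and> Peak w' \<in> gadget L n \<and> f x \<sqsubseteq> w'"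
    if w: "w \<in> N" "leN (e (Rail (f x))) w" "leN (e (Peak \<bottom>)) w" for w
  proof -
    obtain q where q: "q \<in> gadget L n" "w = e q" using e_up in_g w by blast
    then have "gadget_le L n f (Rail (f x)) q" "gadget_le L n f (Peak \<bottom>) q" using w in_g pb by (auto simp: e_le)
    then show ?thesis using q by (cases q) auto
  qed
  have 3: "e (Rail (f x)) \<squnion>\<^bsub>Lbar\<^esub> e (Peak \<bottom>) = peak_elem (f x)"
  proof (cases "f x = \<top>")
    case True
    have "\<not> leN (e (Peak \<bottom>)) w" if "w \<in> N" "leN (e (Rail (f x))) w" for w
      using upper[OF that] True top_le_iff by (auto simp: Peak_in_gadget)
    then show ?thesis using True in_g pb by (simp add: peak_elem_def join_NN_top e_in)
  next
    case False
    then have pf: "Peak (f x) \<in> gadget L n" using fx by (simp add: Peak_in_gadget)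
    have "e (Rail (f x)) \<squnion>\<^bsub>Lbar\<^esub> e (Peak \<bottom>) = e (Peak (f x))"
    proof (rule join_NN)
      fix w assume "w \<in> N" "leN (e (Rail (f x))) w" "leN (e (Peak \<bottom>)) w"
      then show "leN (e (Peak (f x))) w" using upper[of w] pf by (auto simp: e_le)
    qed (use in_g fx pb pf in \<open>auto simp: e_in e_le\<close>)
    then show ?thesis using False by (simp add: peak_elem_def)
  qed
  show ?thesis by (simp add: value_term_def eval_point_term[OF x n] 1 2 3)
qed

lemma orthopolynomial_value_term: "orthopolynomial Lbar n value_term"
proof -
  have *: "orthopolynomial Lbar n (meets ps) \<longleftrightarrow> (\<forall>p\<in>set ps. orthopolynomial Lbar n p)" for ps
    by (induction ps) (auto simp: meets_def L_sub_C)
  have c: "Box bots (tops[i := \<bottom>]) \<in> gadget L n" "Box (bots[i := \<top>]) tops \<in> gadget L n" if "i < n" for i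
    unfolding Box_in_gadget using that nontriv bots_le le_tops update_tuples by (auto simp: bots_tops nth_list_update)
  show ?thesis
    unfolding value_term_def point_term_def using nontriv
    by (auto simp: * c e_in N_sub_C Rail_in_gadget Peak_in_gadget)
qed

end

text \<open>
  The peaks over \<open>f x\<close> in the two copies have the floor \<open>f x\<close> and no common lower bound in \<open>N\<close>, so they meet in \<open>f x\<close>.
  If \<open>f x = \<top>\<close>, both peaks are \<open>\<top>\<close>, and so is their meet.
\<close>

lemma gadget_pair_interpolates:
  assumes c0: "gadget_component L N leN \<pi> \<iota> e0 n f" and c1: "gadget_component L N leN \<pi> \<iota> e1 n f"
    and disj: "e0 ` gadget L n \<inter> e1 ` gadget L n = {}" and n: "0 < n"
  shows "\<exists>p. orthopolynomial (crowned.Lbar L N leN \<pi> \<iota>) n p \<and>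
    (\<forall>x\<in>tuples L n. eval_orthoterm (crowned.Lbar L N leN \<pi> \<iota>) p x = f x)"
proof -
  interpret c0: gadget_component L N leN \<pi> \<iota> e0 n f by fact
  interpret c1: gadget_component L N leN \<pi> \<iota> e1 n f by fact
  have "c0.peak_elem w \<sqinter>\<^bsub>c0.Lbar\<^esub> c1.peak_elem w = w" if w: "w \<in> carrier L" for w
  proof (cases "w = \<top>\<^bsub>L\<^esub>")
    case True
    then show ?thesis
      by (auto simp: c0.peak_elem_def c1.peak_elem_def c0.L_sub_C c0.leC_refl intro!: partial_order.meet_eqI[OF c0.po_Lbar])
  next
    case False
    then have pk: "Peak w \<in> gadget L n" using w by (simp add: c0.Peak_in_gadget)
    have "e0 (Peak w) \<sqinter>\<^bsub>c0.Lbar\<^esub> e1 (Peak w) = \<pi> (e0 (Peak w)) \<sqinter>\<^bsub>L\<^esub> \<pi> (e1 (Peak w))"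
    proof (rule c0.meet_NN_L[OF c0.e_in[OF pk] c1.e_in[OF pk]])
      fix v assume v: "v \<in> N" "leN v (e0 (Peak w))"
      then have "v \<notin> e1 ` gadget L n" using c0.e_down[OF pk v] disj by blast
      then show "\<not> leN v (e1 (Peak w))" using c1.e_down[OF pk v(1)] by blast
    qed
    also have "\<dots> = w" using pk w
      by (auto simp: c0.pi_e c1.pi_e intro!: c0.meet_eqI)
    finally show ?thesis using False by (simp add: c0.peak_elem_def c1.peak_elem_def)
  qed
  then have "\<forall>x\<in>tuples L n. eval_orthoterm c0.Lbar (Meet c0.value_term c1.value_term) x = f x"
    using n by (simp add: c0.eval_value_term c1.eval_value_term c0.f_closed)
  moreover have "orthopolynomial c0.Lbar n (Meet c0.value_term c1.value_term)"
    using c0.orthopolynomial_value_term c1.orthopolynomial_value_term by simp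
  ultimately show ?thesis by blast
qed

section \<open>Squares of sublattices and ideals\<close>

lemma partial_order_restrict:
  assumes "partial_order M" "S \<subseteq> carrier M"
  shows "partial_order (M\<lparr>carrier := S\<rparr>)"
proof -
  interpret partial_order M by fact
  show ?thesis
    by (rule partial_orderI_eq) (use assms(2) eq_is_equal in \<open>auto intro: le_trans le_antisym\<close>)
qed

lemma sublattice_set_ops:
  assumes "lattice M" "sublattice_set S M"
  shows "lattice (M\<lparr>carrier := S\<rparr>)"
    and "\<lbrakk>x \<in> S; y \<in> S\<rbrakk> \<Longrightarrow> x \<squnion>\<^bsub>M\<lparr>carrier := S\<rparr>\<^esub> y = x \<squnion>\<^bsub>M\<^esub> y"
    and "\<lbrakk>x \<in> S; y \<in> S\<rbrakk> \<Longrightarrow> x \<sqinter>\<^bsub>M\<lparr>carrier := S\<rparr>\<^esub> y = x \<sqinter>\<^bsub>M\<^esub> y"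
proof -
  interpret M: lattice M by fact
  have S: "S \<subseteq> carrier M" "\<And>x y. \<lbrakk>x \<in> S; y \<in> S\<rbrakk> \<Longrightarrow> x \<squnion>\<^bsub>M\<^esub> y \<in> S \<and> x \<sqinter>\<^bsub>M\<^esub> y \<in> S"
    using assms(2) by (auto simp: sublattice_set_def)
  interpret S: partial_order "M\<lparr>carrier := S\<rparr>"
    by (rule partial_order_restrict[OF M.partial_order_axioms S(1)])
  have lub: "least (M\<lparr>carrier := S\<rparr>) (x \<squnion>\<^bsub>M\<^esub> y) (Upper (M\<lparr>carrier := S\<rparr>) {x, y})"
    and glb: "greatest (M\<lparr>carrier := S\<rparr>) (x \<sqinter>\<^bsub>M\<^esub> y) (Lower (M\<lparr>carrier := S\<rparr>) {x, y})"
    if "x \<in> S" "y \<in> S" for x y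
  proof -
    have c: "x \<in> carrier M" "y \<in> carrier M" using that S(1) by auto
    show "least (M\<lparr>carrier := S\<rparr>) (x \<squnion>\<^bsub>M\<^esub> y) (Upper (M\<lparr>carrier := S\<rparr>) {x, y})"
      using that c S M.join_left[OF c] M.join_right[OF c] M.join_le[OF _ _ c]
      by (intro least_UpperI) (auto simp: Upper_def)
    show "greatest (M\<lparr>carrier := S\<rparr>) (x \<sqinter>\<^bsub>M\<^esub> y) (Lower (M\<lparr>carrier := S\<rparr>) {x, y})"
      using that c S M.meet_left[OF c] M.meet_right[OF c] M.meet_le[OF _ _ c]
      by (intro greatest_LowerI) (auto simp: Lower_def)
  qed
  show "lattice (M\<lparr>carrier := S\<rparr>)"
    by unfold_locales (use lub glb in \<open>simp; blast\<close>)+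
  show "x \<squnion>\<^bsub>M\<lparr>carrier := S\<rparr>\<^esub> y = x \<squnion>\<^bsub>M\<^esub> y" "x \<sqinter>\<^bsub>M\<lparr>carrier := S\<rparr>\<^esub> y = x \<sqinter>\<^bsub>M\<^esub> y"
    if "x \<in> S" "y \<in> S"
    using lub[OF that] glb[OF that] S.least_unique S.greatest_unique
    unfolding join_def[of "M\<lparr>carrier := S\<rparr>"] meet_def[of "M\<lparr>carrier := S\<rparr>"] sup_def[of "M\<lparr>carrier := S\<rparr>"] inf_def[of "M\<lparr>carrier := S\<rparr>"]
    by (metis (no_types, lifting) someI_ex)+
qed

lemma lattice_prod:
  assumes "lattice A" "lattice B"
  shows "lattice (prod_lattice A B)"
proof -
  interpret A: lattice A by fact
  interpret B: lattice B by fact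
  interpret P: partial_order "prod_lattice A B"
    by (rule partial_orderI_eq) (auto simp: prod_lattice_def intro: A.le_trans B.le_trans)
  show ?thesis
  proof (unfold_locales, goal_cases)
    case (1 x y)
    then have "least (prod_lattice A B) (fst x \<squnion>\<^bsub>A\<^esub> fst y, snd x \<squnion>\<^bsub>B\<^esub> snd y) (Upper (prod_lattice A B) {x, y})"
      by (intro least_UpperI) (auto simp: Upper_def prod_lattice_def A.join_left A.join_right B.join_left B.join_right A.join_le B.join_le)
    then show ?case ..
  next
    case (2 x y)
    then have "greatest (prod_lattice A B) (fst x \<sqinter>\<^bsub>A\<^esub> fst y, snd x \<sqinter>\<^bsub>B\<^esub> snd y) (Lower (prod_lattice A B) {x, y})"
      by (intro greatest_LowerI) (auto simp: Lower_def prod_lattice_def A.meet_left A.meet_right B.meet_left B.meet_right A.meet_le B.meet_le)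
    then show ?case ..
  qed
qed

lemma lattice_iso_restrict:
  assumes M: "lattice M" and A: "lattice A" and inj: "inj_on h (carrier A)"
    and sub: "h ` carrier A \<subseteq> carrier M" and ne: "carrier A \<noteq> {}"
    and h: "\<And>x y. \<lbrakk>x \<in> carrier A; y \<in> carrier A\<rbrakk> \<Longrightarrow>
      h (x \<squnion>\<^bsub>A\<^esub> y) = h x \<squnion>\<^bsub>M\<^esub> h y \<and> h (x \<sqinter>\<^bsub>A\<^esub> y) = h x \<sqinter>\<^bsub>M\<^esub> h y"
  shows "sublattice_set (h ` carrier A) M" "lattice_iso A (M\<lparr>carrier := h ` carrier A\<rparr>) h"
proof -
  interpret A: lattice A by fact
  show S: "sublattice_set (h ` carrier A) M"
    unfolding sublattice_set_def
  proof (intro conjI ballI)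
    fix x y assume "x \<in> h ` carrier A" "y \<in> h ` carrier A"
    then obtain a b where ab: "a \<in> carrier A" "b \<in> carrier A" "x = h a" "y = h b" by auto
    then show "x \<squnion>\<^bsub>M\<^esub> y \<in> h ` carrier A" "x \<sqinter>\<^bsub>M\<^esub> y \<in> h ` carrier A"
      using h[OF ab(1,2)] A.join_closed[OF ab(1,2)] A.meet_closed[OF ab(1,2)] by (metis imageI)+
  qed (use sub ne in auto)
  show "lattice_iso A (M\<lparr>carrier := h ` carrier A\<rparr>) h"
    using inj h sublattice_set_ops(2,3)[OF M S] by (auto simp: lattice_iso_def bij_betw_def)
qed

lemma square_of_singleton:
  assumes "lattice M" "sublattice_set {a} M"
  shows "\<exists>h. lattice_iso (prod_lattice (M\<lparr>carrier := {a}\<rparr>) (M\<lparr>carrier := {a}\<rparr>)) (M\<lparr>carrier := {a}\<rparr>) h"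
proof -
  let ?S = "M\<lparr>carrier := {a}\<rparr>" let ?P = "prod_lattice ?S ?S"
  interpret S: lattice ?S by (rule sublattice_set_ops[OF assms])
  interpret P: lattice ?P by (rule lattice_prod) unfold_locales
  have car: "carrier ?P = {(a, a)}" by (simp add: prod_lattice_def)
  have P: "(a, a) \<squnion>\<^bsub>?P\<^esub> (a, a) = (a, a)" "(a, a) \<sqinter>\<^bsub>?P\<^esub> (a, a) = (a, a)"
    using P.join_closed[of "(a, a)" "(a, a)"] P.meet_closed[of "(a, a)" "(a, a)"] car by auto
  have S: "a \<squnion>\<^bsub>?S\<^esub> a = a" "a \<sqinter>\<^bsub>?S\<^esub> a = a"
    using S.join_closed[of a a] S.meet_closed[of a a] by auto
  have "lattice_iso ?P ?S fst"
    unfolding lattice_iso_def car by (simp add: P S bij_betw_def)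
  then show ?thesis by (rule exI[of _ fst])
qed

text \<open>
  The nonempty ideals of the lattice ordered by \<open>r\<close>, phrased so as to make sense for every relation \<open>r\<close>: the last
  condition closes an ideal under those least upper bounds that exist.
\<close>

definition rel_ideals :: "'u rel \<Rightarrow> 'u set set" where
  "rel_ideals r = {I. I \<noteq> {} \<and> I \<subseteq> Field r \<and> (\<forall>x y. (x, y) \<in> r \<longrightarrow> y \<in> I \<longrightarrow> x \<in> I) \<and>
     (\<forall>x\<in>I. \<forall>y\<in>I. \<forall>z. (x, z) \<in> r \<longrightarrow> (y, z) \<in> r \<longrightarrow>
        (\<forall>w. (x, w) \<in> r \<longrightarrow> (y, w) \<in> r \<longrightarrow> (z, w) \<in> r) \<longrightarrow> z \<in> I)}"

text \<open>
  Intersections of ideals are ideals unless they are empty, and the constant \<open>\<bottom>\<close> preserves infima of nonempty families.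
\<close>

lemma (in complete_ortholattice) rel_ideals_crown:
  assumes nontriv: "\<top> \<noteq> \<bottom>"
  shows "crown L (rel_ideals r) (\<subseteq>) (\<lambda>_. \<bottom>)"
proof (unfold_locales, goal_cases)
  case (6 B l)
  have "\<Inter>B \<in> rel_ideals r"
    unfolding rel_ideals_def
  proof (intro CollectI conjI)
    have "l \<subseteq> \<Inter>B" "l \<noteq> {}" using 6 by (auto simp: rel_ideals_def)
    then show "\<Inter>B \<noteq> {}" by auto
    have *: "b \<in> rel_ideals r" if "b \<in> B" for b using 6(1) that by auto
    show "\<Inter>B \<subseteq> Field r" using 6(2) * unfolding rel_ideals_def by blast
    show "\<forall>x y. (x, y) \<in> r \<longrightarrow> y \<in> \<Inter>B \<longrightarrow> x \<in> \<Inter>B"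
      using * unfolding rel_ideals_def by blast
    show "\<forall>x\<in>\<Inter>B. \<forall>y\<in>\<Inter>B. \<forall>z. (x, z) \<in> r \<longrightarrow> (y, z) \<in> r \<longrightarrow>
        (\<forall>w. (x, w) \<in> r \<longrightarrow> (y, w) \<in> r \<longrightarrow> (z, w) \<in> r) \<longrightarrow> z \<in> \<Inter>B"
      using * unfolding rel_ideals_def by blast
  qed
  then show ?case using 6(2) by (intro bexI[of _ "\<Inter>B"]) auto
qed (use nontriv in auto)

locale ideal_component =
  crown_part L N leN \<pi> \<iota> "rel_ideals r" "(\<subseteq>)" "\<lambda>_. \<bottom>\<^bsub>L\<^esub>" e
  for L :: "('a, 'm) ortholat_scheme" (structure) and N leN \<pi> \<iota> and e :: "'u set \<Rightarrow> 'a" and r :: "'u rel"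
begin

text \<open>
  The embedding takes \<open>x\<close> to the principal ideal of its code. Principal ideals intersect in the principal ideal of the
  meet, and the principal ideal of the join is the least ideal above two of them.
\<close>

lemma embed_lattice:
  fixes A :: "'s gorder" and c :: "'s \<Rightarrow> 'u"
  assumes A: "lattice A" and ne: "carrier A \<noteq> {}" and inj: "inj_on c (carrier A)"
    and r: "r = {(c x, c y) | x y. x \<in> carrier A \<and> y \<in> carrier A \<and> x \<sqsubseteq>\<^bsub>A\<^esub> y}"
  shows "\<exists>h. sublattice_set (h ` carrier A) Lbar \<and> lattice_iso A (Lbar\<lparr>carrier := h ` carrier A\<rparr>) h"
proof -
  interpret A: lattice A by fact
  interpret B: complete_lattice Lbar by (rule complete_lattice_Lbar)
  define dn where "dn x = {c y | y. y \<in> carrier A \<and> y \<sqsubseteq>\<^bsub>A\<^esub> x}" for x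
  have r_iff: "(c x, c y) \<in> r \<longleftrightarrow> x \<sqsubseteq>\<^bsub>A\<^esub> y" if "x \<in> carrier A" "y \<in> carrier A" for x y
    using inj that unfolding r by (auto dest: inj_onD)
  have Field: "Field r = c ` carrier A" unfolding r Field_def by auto
  have in_dn: "c y \<in> dn x \<longleftrightarrow> y \<sqsubseteq>\<^bsub>A\<^esub> x" if "x \<in> carrier A" "y \<in> carrier A" for x y
    using inj that unfolding dn_def by (auto dest: inj_onD)
  have dn_ideal: "dn x \<in> rel_ideals r" if x: "x \<in> carrier A" for x
    unfolding rel_ideals_def
  proof (intro CollectI conjI allI ballI impI)
    show "dn x \<noteq> {}" using x by (auto simp: dn_def)
    show "dn x \<subseteq> Field r" by (auto simp: dn_def Field)
    fix p q assume "(p, q) \<in> r" "q \<in> dn x"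
    then obtain a b where ab: "p = c a" "q = c b" "a \<in> carrier A" "b \<in> carrier A" "a \<sqsubseteq>\<^bsub>A\<^esub> b"
      unfolding r by auto
    then have "b \<sqsubseteq>\<^bsub>A\<^esub> x" using \<open>q \<in> dn x\<close> in_dn x by auto
    then show "p \<in> dn x" using ab in_dn x A.le_trans by meson
  next
    fix p q s assume *: "p \<in> dn x" "q \<in> dn x" "(p, s) \<in> r" "(q, s) \<in> r"
      "\<forall>w. (p, w) \<in> r \<longrightarrow> (q, w) \<in> r \<longrightarrow> (s, w) \<in> r"
    then have "(p, c x) \<in> r" "(q, c x) \<in> r" using x r by (auto simp: dn_def)
    then have "(s, c x) \<in> r" using * by blast
    then show "s \<in> dn x" using inj x unfolding r dn_def by (auto dest: inj_onD)
  qed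
  have dn_sub: "dn x \<subseteq> J \<longleftrightarrow> c x \<in> J" if "x \<in> carrier A" "J \<in> rel_ideals r" for x J
  proof
    assume "dn x \<subseteq> J" then show "c x \<in> J" using in_dn that by auto
  next
    assume "c x \<in> J"
    then show "dn x \<subseteq> J" using that r_iff unfolding dn_def rel_ideals_def by blast
  qed
  define h where "h x = e (dn x)" for x
  have hN: "h x \<in> N" if "x \<in> carrier A" for x using that e_in dn_ideal by (simp add: h_def)
  have "inj_on h (carrier A)"
  proof (rule inj_onI)
    fix x y assume xy: "x \<in> carrier A" "y \<in> carrier A" "h x = h y"
    then have "leN (h x) (h y)" "leN (h y) (h x)" using N_refl hN by metis+
    then have "dn x \<subseteq> dn y" "dn y \<subseteq> dn x" using xy dn_ideal by (auto simp: h_def e_le)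
    then show "x = y" using xy dn_sub dn_ideal in_dn by (intro A.le_antisym) auto
  qed
  moreover have "h (x \<squnion>\<^bsub>A\<^esub> y) = h x \<squnion>\<^bsub>Lbar\<^esub> h y \<and> h (x \<sqinter>\<^bsub>A\<^esub> y) = h x \<sqinter>\<^bsub>Lbar\<^esub> h y"
    if xy: "x \<in> carrier A" "y \<in> carrier A" for x y
  proof
    have j: "x \<squnion>\<^bsub>A\<^esub> y \<in> carrier A" and m: "x \<sqinter>\<^bsub>A\<^esub> y \<in> carrier A" using xy by auto
    have le: "leN (h a) (h b) \<longleftrightarrow> a \<sqsubseteq>\<^bsub>A\<^esub> b" if "a \<in> carrier A" "b \<in> carrier A" for a b
      using that dn_ideal by (simp add: h_def e_le dn_sub in_dn)
    have "h x \<squnion>\<^bsub>Lbar\<^esub> h y = h (x \<squnion>\<^bsub>A\<^esub> y)"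
    proof (rule join_NN)
      fix w assume w: "w \<in> N" "leN (h x) w" "leN (h y) w"
      then obtain J where J: "J \<in> rel_ideals r" "w = e J"
        using e_up[OF dn_ideal[OF xy(1)]] unfolding h_def by blast
      then have "c x \<in> J" "c y \<in> J" using w xy dn_ideal by (auto simp: h_def e_le dn_sub)
      moreover have "(c x, c (x \<squnion>\<^bsub>A\<^esub> y)) \<in> r" "(c y, c (x \<squnion>\<^bsub>A\<^esub> y)) \<in> r"
        using xy j A.join_left A.join_right by (auto simp: r_iff)
      moreover have "(c (x \<squnion>\<^bsub>A\<^esub> y), z) \<in> r" if "(c x, z) \<in> r" "(c y, z) \<in> r" for z
      proof -
        have "\<exists>a\<in>carrier A. z = c a" using that unfolding r by blast
        then obtain a where a: "a \<in> carrier A" "z = c a" by blast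
        then show ?thesis using that xy j by (simp add: r_iff A.join_le)
      qed
      ultimately have "c (x \<squnion>\<^bsub>A\<^esub> y) \<in> J" using J(1) unfolding rel_ideals_def by blast
      then show "leN (h (x \<squnion>\<^bsub>A\<^esub> y)) w" using J j dn_ideal by (simp add: h_def e_le dn_sub)
    qed (use xy j hN le A.join_left A.join_right in auto)
    then show "h (x \<squnion>\<^bsub>A\<^esub> y) = h x \<squnion>\<^bsub>Lbar\<^esub> h y" ..
    have "h x \<sqinter>\<^bsub>Lbar\<^esub> h y = h (x \<sqinter>\<^bsub>A\<^esub> y)"
    proof (rule meet_NN)
      fix w assume w: "w \<in> N" "leN w (h x)" "leN w (h y)"
      then obtain J where J: "J \<in> rel_ideals r" "w = e J"
        using e_down[OF dn_ideal[OF xy(1)]] unfolding h_def by blast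
      then have "J \<subseteq> dn x" "J \<subseteq> dn y" using w xy dn_ideal by (auto simp: h_def e_le)
      moreover have "dn x \<inter> dn y \<subseteq> dn (x \<sqinter>\<^bsub>A\<^esub> y)"
        using xy m inj by (auto simp: dn_def dest!: inj_onD intro!: A.meet_le)
      ultimately have "J \<subseteq> dn (x \<sqinter>\<^bsub>A\<^esub> y)" by blast
      then show "leN w (h (x \<sqinter>\<^bsub>A\<^esub> y))" using J m dn_ideal by (simp add: h_def e_le)
    qed (use xy m hN le A.meet_left A.meet_right in auto)
    then show "h (x \<sqinter>\<^bsub>A\<^esub> y) = h x \<sqinter>\<^bsub>Lbar\<^esub> h y" ..
  qed
  moreover have "lattice Lbar" by unfold_locales
  moreover have "h ` carrier A \<subseteq> carrier Lbar" using hN by (auto simp: N_sub_C)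
  ultimately show ?thesis using lattice_iso_restrict[of Lbar A h] A ne by blast
qed

end

text \<open>
  The square of a sublattice \<open>S\<close> is again of size at most \<open>\<kappa>\<close>: for infinite \<open>\<kappa>\<close> by cardinal arithmetic, and for
  \<open>\<kappa> \<le> 1\<close> because \<open>S\<close> is a singleton, in which case \<open>S\<close> is its own square.
\<close>

lemma card_power_closedI:
  fixes \<kappa> :: "'k rel" and M :: "'a ortholat"
  assumes M: "lattice M" and \<kappa>: "Card_order \<kappa>" "finite (Field \<kappa>) \<longrightarrow> card (Field \<kappa>) \<le> 1"
    and square: "\<And>S. \<lbrakk>sublattice_set S M; |S| \<le>o \<kappa>; |S \<times> S| \<le>o \<kappa>\<rbrakk> \<Longrightarrow>
      (\<exists>a. S = {a}) \<or> (\<exists>h. sublattice_set (h ` (S \<times> S)) M \<and>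
        lattice_iso (prod_lattice (M\<lparr>carrier := S\<rparr>) (M\<lparr>carrier := S\<rparr>)) (M\<lparr>carrier := h ` (S \<times> S)\<rparr>) h)"
  shows "card_power_closed \<kappa> M"
  unfolding card_power_closed_def power_closed_def
proof (intro ballI)
  fix A assume "A \<in> {M\<lparr>carrier := S\<rparr> |S. sublattice_set S M \<and> |S| \<le>o \<kappa>}"
  then obtain S where S: "A = M\<lparr>carrier := S\<rparr>" "sublattice_set S M" "|S| \<le>o \<kappa>" by blast
  have F: "|Field \<kappa>| =o \<kappa>" by (rule card_of_Field_ordIso[OF \<kappa>(1)])
  have SF: "|S| \<le>o |Field \<kappa>|" using S(3) F ordIso_symmetric ordLeq_ordIso_trans by blast
  have SS: "|S \<times> S| \<le>o \<kappa>"
  proof (cases "finite (Field \<kappa>)")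
    case True
    then have fin: "finite S" using SF card_of_ordLeq_finite by blast
    then obtain g where g: "inj_on g S" "g ` S \<subseteq> Field \<kappa>" using SF card_of_ordLeq by metis
    then have "card S \<le> 1" using \<kappa>(2) True card_inj_on_le[of g S "Field \<kappa>"] by auto
    then have "S \<times> S \<subseteq> (\<lambda>x. (x, x)) ` S" using fin by (auto simp: card_le_Suc0_iff_eq)
    then have "|S \<times> S| \<le>o |S|" by (meson card_of_image card_of_mono1 ordLeq_transitive)
    then show ?thesis using S(3) ordLeq_transitive by blast
  next
    case False
    have "|S \<times> S| \<le>o |Field \<kappa> \<times> Field \<kappa>|"
      using card_of_Times_mono1[OF SF, of S] card_of_Times_mono2[OF SF, of "Field \<kappa>"] ordLeq_transitive by blast
    then show ?thesis using card_of_Times_same_infinite[OF False] F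
      by (meson ordLeq_ordIso_trans)
  qed
  consider a where "S = {a}" | h where "sublattice_set (h ` (S \<times> S)) M"
    "lattice_iso (prod_lattice A A) (M\<lparr>carrier := h ` (S \<times> S)\<rparr>) h"
    using square[OF S(2,3) SS] S(1) by blast
  then show "\<exists>S'\<in>{M\<lparr>carrier := S\<rparr> |S. sublattice_set S M \<and> |S| \<le>o \<kappa>}. \<exists>h. lattice_iso (prod_lattice A A) S' h"
  proof cases
    case 1
    then show ?thesis using square_of_singleton[OF M, of a] S by blast
  next
    case 2
    have "|h ` (S \<times> S)| \<le>o \<kappa>" using SS card_of_image ordLeq_transitive by blast
    then show ?thesis using 2 by blast
  qed
qed

section \<open>One extension step\<close>

text \<open>
  At most \<open>2\<close> to the \<open>|'u|\<close> elements. Sets of this size, and fresh copies of them, can be accommodated in the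
  type \<open>'u set set\<close> by Cantor's theorem.
\<close>

definition fits :: "'u itself \<Rightarrow> 'x set \<Rightarrow> bool" where
  "fits _ A \<longleftrightarrow> |A| \<le>o |UNIV :: 'u set set|"

lemma fits_mono: "\<lbrakk>fits TYPE('u) A; B \<subseteq> A\<rbrakk> \<Longrightarrow> fits TYPE('u) B"
  unfolding fits_def using card_of_mono1 ordLeq_transitive by blast

lemma fits_image: "fits TYPE('u) A \<Longrightarrow> fits TYPE('u) (f ` A)"
  unfolding fits_def using card_of_image ordLeq_transitive by blast

lemma fits_UNIV: "fits TYPE('u) (A :: 'u set set)"
  unfolding fits_def by (rule card_of_mono1) simp

lemma infinite_sets: "infinite (UNIV :: 'u set) \<Longrightarrow> infinite (UNIV :: 'u set set)"
  by (simp add: Finite_Set.finite_set)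

lemma fits_Sigma:
  assumes "infinite (UNIV :: 'u set)" "fits TYPE('u) A" "\<And>a. a \<in> A \<Longrightarrow> fits TYPE('u) (B a)"
  shows "fits TYPE('u) (Sigma A B)"
  using card_of_Sigma_ordLeq_infinite[OF infinite_sets[OF assms(1)]] assms unfolding fits_def by blast

lemma fits_UN:
  assumes "infinite (UNIV :: 'u set)" "fits TYPE('u) A" "\<And>a. a \<in> A \<Longrightarrow> fits TYPE('u) (B a)"
  shows "fits TYPE('u) (\<Union>a\<in>A. B a)"
  using card_of_UNION_ordLeq_infinite[OF infinite_sets[OF assms(1)]] assms unfolding fits_def by blast

lemma fits_finite:
  assumes "infinite (UNIV :: 'u set)" "finite A"
  shows "fits TYPE('u) A"
proof -
  have "\<not> |UNIV :: 'u set set| \<le>o |A|"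
    using card_of_ordLeq_infinite[OF _ infinite_sets[OF assms(1)]] assms(2) by blast
  then show ?thesis
    unfolding fits_def using ordLeq_total[OF card_of_Well_order card_of_Well_order] by blast
qed

lemma fits_Un:
  assumes "infinite (UNIV :: 'u set)" "fits TYPE('u) A" "fits TYPE('u) B"
  shows "fits TYPE('u) (A \<union> B)"
proof -
  have "fits TYPE('u) (\<Union>b\<in>{True, False}. if b then A else B)"
  proof (rule fits_UN[OF assms(1)])
    show "fits TYPE('u) (if b then A else B)" for b using assms(2,3) by (cases b) simp_all
  qed (rule fits_finite[OF assms(1)], simp)
  then show ?thesis by (simp add: Un_commute)
qed

lemma fits_nat: "infinite (UNIV :: 'u set) \<Longrightarrow> fits TYPE('u) (A :: nat set)"
  using infinite_iff_card_of_nat[of "UNIV :: 'u set set"] infinite_sets fits_mono[of UNIV A]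
  unfolding fits_def by blast

lemma fits_lists:
  assumes inf: "infinite (UNIV :: 'u set)" and A: "fits TYPE('u) A"
  shows "fits TYPE('u) (lists A)"
proof -
  have "fits TYPE('u) {xs \<in> lists A. length xs = n}" for n
  proof (induction n)
    case 0
    have "{xs \<in> lists A. length xs = 0} = {[]}" by auto
    then show ?case by (simp add: fits_finite[OF inf])
  next
    case (Suc n)
    have "fits TYPE('u) ((\<lambda>(x, xs). x # xs) ` (A \<times> {xs \<in> lists A. length xs = n}))"
      by (intro fits_image fits_Sigma inf A Suc)
    then show ?case
      by (rule fits_mono) (auto simp: length_Suc_conv image_iff)
  qed
  then have "fits TYPE('u) (\<Union>n\<in>UNIV. {xs \<in> lists A. length xs = n})"
    by (intro fits_UN inf fits_nat)
  then show ?thesis by (rule fits_mono) auto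
qed

lemma fits_rel:
  assumes inf: "infinite (UNIV :: 'u set)"
  shows "fits TYPE('u) (A :: 'u rel set)"
proof -
  have "|UNIV \<times> UNIV :: ('u \<times> 'u) set| =o |UNIV :: 'u set|"
    by (rule card_of_Times_same_infinite[OF inf])
  then have "|UNIV :: ('u \<times> 'u) set| \<le>o |UNIV :: 'u set|"
    by (simp add: ordIso_iff_ordLeq)
  then obtain h :: "'u \<times> 'u \<Rightarrow> 'u" where "inj h"
    using card_of_ordLeq[of "UNIV :: ('u \<times> 'u) set" "UNIV :: 'u set"] by blast
  then have "inj (\<lambda>R. h ` R)" by (auto intro!: injI simp: inj_image_eq_iff)
  then have "|UNIV :: 'u rel set| \<le>o |UNIV :: 'u set set|"
    using card_of_ordLeq by blast
  then show ?thesis using fits_mono[of UNIV A] by (simp add: fits_def)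
qed

text \<open>
  With elements of \<open>A\<close> coded as subsets of \<open>'u\<close>, a function into \<open>A\<close> is a binary relation on \<open>'u\<close>.
\<close>

lemma fits_funs:
  assumes inf: "infinite (UNIV :: 'u set)" and A: "fits TYPE('u) A"
  shows "fits TYPE('u) {g :: 'u \<Rightarrow> 'x. range g \<subseteq> A}"
proof -
  obtain h :: "'x \<Rightarrow> 'u set" where h: "inj_on h A"
    using A card_of_ordLeq[of A "UNIV :: 'u set set"] unfolding fits_def by blast
  have "inj_on (\<lambda>g. {(a, b). b \<in> h (g a)}) {g :: 'u \<Rightarrow> 'x. range g \<subseteq> A}"
  proof (rule inj_onI, rule ext)
    fix g g' :: "'u \<Rightarrow> 'x" and a
    assume *: "g \<in> {g. range g \<subseteq> A}" "g' \<in> {g. range g \<subseteq> A}"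
      "{(a, b). b \<in> h (g a)} = {(a, b). b \<in> h (g' a)}"
    then have "h (g a) = h (g' a)" by blast
    moreover have "g a \<in> A" "g' a \<in> A" using * by auto
    ultimately show "g a = g' a" by (rule inj_onD[OF h])
  qed
  then have "|{g :: 'u \<Rightarrow> 'x. range g \<subseteq> A}| \<le>o |UNIV :: 'u rel set|"
    using card_of_ordLeq[of "{g :: 'u \<Rightarrow> 'x. range g \<subseteq> A}" "UNIV :: 'u rel set"] by blast
  then show ?thesis using fits_rel[OF inf, of UNIV] ordLeq_transitive unfolding fits_def by blast
qed

lemma fresh_copy:
  fixes X :: "'u set set set"
  assumes inf: "infinite (UNIV :: 'u set)" and X: "fits TYPE('u) X" and A: "fits TYPE('u) A"
  obtains h :: "'x \<Rightarrow> 'u set set" where "inj_on h A" "h ` A \<inter> X = {}"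
proof -
  have "\<not> fits TYPE('u) (- X)"
  proof
    assume "fits TYPE('u) (- X)"
    then have "fits TYPE('u) (UNIV :: 'u set set set)" using fits_Un[OF inf X, of "- X"] by simp
    then have "|Pow (UNIV :: 'u set set)| \<le>o |UNIV :: 'u set set|" by (simp add: fits_def)
    then show False using card_of_Pow[of "UNIV :: 'u set set"] not_ordLess_ordLeq by blast
  qed
  then have "|UNIV :: 'u set set| \<le>o |- X|"
    unfolding fits_def using ordLeq_total[OF card_of_Well_order card_of_Well_order] by blast
  then have "|A| \<le>o |- X|" using A ordLeq_transitive unfolding fits_def by blast
  then obtain h where "inj_on h A" "h ` A \<subseteq> - X" using card_of_ordLeq by metis
  then show ?thesis using that by blast
qed

lemma crowned_copy:
  fixes L :: "'u set set ortholat"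
  assumes L: "complete_ortholattice L" and inf: "infinite (UNIV :: 'u set)"
    and fL: "fits TYPE('u) (carrier L)" and fA: "fits TYPE('u) A"
    and crown: "crown L A leA \<rho>"
  obtains N leN \<pi> \<iota> h where "crowned L N leN \<pi> \<iota>" "inj_on h A" "N = h ` A"
    "\<And>x y. \<lbrakk>x \<in> A; y \<in> A\<rbrakk> \<Longrightarrow> leN (h x) (h y) \<longleftrightarrow> leA x y" "\<And>x. x \<in> A \<Longrightarrow> \<pi> (h x) = \<rho> x"
    "fits TYPE('u) (crowned.C L N \<iota>)"
proof -
  interpret crown L A leA \<rho> by fact
  interpret complete_ortholattice L by fact
  have "fits TYPE('u) (A \<times> (UNIV :: bool set))"
    by (intro fits_Sigma inf fA fits_finite) auto
  from fresh_copy[OF inf fL this] obtain k :: "_ \<times> bool \<Rightarrow> 'u set set"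
    where k: "inj_on k (A \<times> UNIV)" "k ` (A \<times> UNIV) \<inter> carrier L = {}" .
  define h where "h x = k (x, True)" for x
  define d where "d x = k (x, False)" for x
  have h: "inj_on h A" and d: "inj_on d A" using k(1) by (auto simp: inj_on_def h_def d_def)
  have hd: "h ` A \<inter> d ` A = {}" using k(1) by (auto simp: h_def d_def dest: inj_onD)
  have hL: "h ` A \<inter> carrier L = {}" "d ` A \<inter> carrier L = {}" using k(2) by (auto simp: h_def d_def)
  define \<iota> where "\<iota> y = (if y \<in> carrier L then orth L y else if y \<in> h ` A then d (inv_into A h y)
    else h (inv_into A d y))" for y
  have iota: "\<iota> (h x) = d x" "\<iota> (d x) = h x" if "x \<in> A" for x
  proof -
    have "h x \<notin> carrier L" "d x \<notin> carrier L" "d x \<notin> h ` A" "h x \<in> h ` A" using that hd hL by auto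
    then show "\<iota> (h x) = d x" "\<iota> (d x) = h x" using that h d by (simp_all add: \<iota>_def)
  qed
  have cr: "crowned L (h ` A) (\<lambda>x y. leA (inv_into A h x) (inv_into A h y)) (\<lambda>x. \<rho> (inv_into A h x)) \<iota>"
  proof (intro crowned.intro crowned_axioms.intro)
    show "crown L (h ` A) (\<lambda>x y. leA (inv_into A h x) (inv_into A h y)) (\<lambda>x. \<rho> (inv_into A h x))"
      by (rule crown_image) (use h in simp_all)
    show "h ` A \<inter> carrier L = {}" by (rule hL)
    show "\<iota> x = orth L x" if "x \<in> carrier L" for x using that by (simp add: \<iota>_def)
    show "\<iota> x \<notin> carrier L \<union> h ` A" if "x \<in> h ` A" for x
    proof -
      from that obtain a where "a \<in> A" "x = h a" by blast
      then have "\<iota> x \<in> d ` A" using iota by simp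
      then show ?thesis using hL(2) hd by (metis Un_iff disjoint_iff)
    qed
    show "\<iota> (\<iota> x) = x" if "x \<in> h ` A" for x
    proof -
      from that obtain a where "a \<in> A" "x = h a" by blast
      then show ?thesis using iota by simp
    qed
  qed fact
  interpret c: crowned L "h ` A" "\<lambda>x y. leA (inv_into A h x) (inv_into A h y)" "\<lambda>x. \<rho> (inv_into A h x)" \<iota>
    by (rule cr)
  have "fits TYPE('u) c.C"
    unfolding c.C_def c.D_def by (intro fits_Un fits_image inf fL fA)
  then show ?thesis
    by (intro that[OF cr h]) (auto simp: h)
qed

lemma crown_part_of_copy:
  assumes "crowned L N leN \<pi> \<iota>" and N: "N = h ` A"
    and le: "\<And>x y. \<lbrakk>x \<in> A; y \<in> A\<rbrakk> \<Longrightarrow> leN (h x) (h y) \<longleftrightarrow> leA x y"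
    and pi: "\<And>x. x \<in> A \<Longrightarrow> \<pi> (h x) = \<rho>A x"
    and c: "\<And>p. p \<in> K \<Longrightarrow> c p \<in> A" "\<And>p. p \<in> K \<Longrightarrow> \<rho>A (c p) = \<rho> p"
      "\<And>p q. \<lbrakk>p \<in> K; q \<in> K\<rbrakk> \<Longrightarrow> leA (c p) (c q) \<longleftrightarrow> leK p q"
    and isolated: "\<And>p z. \<lbrakk>p \<in> K; z \<in> A; leA (c p) z \<or> leA z (c p)\<rbrakk> \<Longrightarrow> z \<in> c ` K"
  shows "crown_part L N leN \<pi> \<iota> K leK \<rho> (\<lambda>p. h (c p))"
proof -
  have "y \<in> (\<lambda>p. h (c p)) ` K" if "p \<in> K" "y \<in> N" "leN (h (c p)) y \<or> leN y (h (c p))" for p y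
  proof -
    from that(2) obtain z where "z \<in> A" "y = h z" using N by blast
    then have "z \<in> c ` K" using that isolated[of p z] le c(1) by blast
    then show ?thesis using \<open>y = h z\<close> by blast
  qed
  then show ?thesis
    by (intro crown_part.intro crown_part_axioms.intro assms(1)) (simp_all add: N le pi c)
qed

text \<open>
  The functions are those on \<open>L\<close>, while the coefficients of the orthopolynomials come from \<open>M\<close>.
\<close>

definition interpolates :: "'u itself \<Rightarrow> ('e, 'm) ortholat_scheme \<Rightarrow> ('e, 'm) ortholat_scheme \<Rightarrow> bool" where
  "interpolates _ L M \<longleftrightarrow> (\<forall>n. \<forall>f\<in>tuples L n \<rightarrow> carrier L. \<forall>A. A \<subseteq> tuples L n \<and> |A| \<le>o |UNIV :: 'u set| \<longrightarrow>
     (\<exists>p. orthopolynomial M n p \<and> (\<forall>xs\<in>A. eval_orthoterm M p xs = f xs)))"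

definition squares_embed :: "'u itself \<Rightarrow> 'e ortholat \<Rightarrow> bool" where
  "squares_embed _ M \<longleftrightarrow> (\<forall>S. sublattice_set S M \<and> |S \<times> S| \<le>o |UNIV :: 'u set| \<longrightarrow>
     (\<exists>a. S = {a}) \<or> (\<exists>h. sublattice_set (h ` (S \<times> S)) M \<and>
        lattice_iso (prod_lattice (M\<lparr>carrier := S\<rparr>) (M\<lparr>carrier := S\<rparr>)) (M\<lparr>carrier := h ` (S \<times> S)\<rparr>) h))"

text \<open>
  The function with the graph enumerated by \<open>g\<close>, extended by \<open>\<bottom>\<close>. Gadgets are indexed by enumerations of graphs,
  because an ortholattice that fits may have too many functions on it. The enumerations fit, and on any nonempty set of at
  most \<open>|'u|\<close> points every function agrees with one that is given by an enumeration.
\<close>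

definition graph_fun :: "('e, 'm) gorder_scheme \<Rightarrow> ('u \<Rightarrow> 'e list \<times> 'e) \<Rightarrow> 'e list \<Rightarrow> 'e" where
  "graph_fun L g x = (if \<exists>y. (x, y) \<in> range g then SOME y. (x, y) \<in> range g else \<bottom>\<^bsub>L\<^esub>)"

text \<open>
  The crown consists of two copies of the gadget for each arity and each enumerated graph, and of the ideals for each
  binary relation on \<open>'u\<close>. If \<open>L\<close> has only one element, then \<open>\<pi>\<close> has no value to take below the top, and
  the empty crown will do.
\<close>

lemma extension_step:
  fixes L :: "'u set set ortholat"
  assumes L: "complete_ortholattice L" and inf: "infinite (UNIV :: 'u set)"
    and fL: "fits TYPE('u) (carrier L)"
  shows "\<exists>(L1 :: 'u set set gorder) M.
    complete_ortholattice M \<and> subortholattice L M \<and> convex_in (carrier L) M \<and>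
    L \<unlhd> L1 \<and> is_ortho M L1 L \<and> fits TYPE('u) (carrier M) \<and>
    interpolates TYPE('u) L M \<and> squares_embed TYPE('u) M"
proof -
  interpret complete_ortholattice L by fact
  show ?thesis
  proof (cases "\<top>\<^bsub>L\<^esub> = \<bottom>\<^bsub>L\<^esub>")
    case True
    have "crown L ({} :: unit set) (\<lambda>_ _. True) (\<lambda>_. \<bottom>\<^bsub>L\<^esub>)" by unfold_locales auto
    from crowned_copy[OF L inf fL fits_finite[OF inf] this] obtain N leN \<pi> \<iota>
      where c: "crowned L N leN \<pi> \<iota>" "N = {}" "fits TYPE('u) (crowned.C L N \<iota>)"
      by (metis finite.emptyI image_empty)
    interpret c: crowned L N leN \<pi> \<iota> by (rule c)
    have one: "x = \<bottom>\<^bsub>L\<^esub>" if "x \<in> carrier L" for x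
      using that True bottom_lower top_higher by (metis le_antisym bottom_closed)
    have car: "carrier c.Lbar = {\<bottom>\<^bsub>L\<^esub>}"
    proof -
      have "carrier c.Lbar = carrier L" unfolding c.carrier_Lbar c.C_def c.D_def using c(2) by simp
      moreover have "carrier L = {\<bottom>\<^bsub>L\<^esub>}" using one bottom_closed by blast
      ultimately show ?thesis by simp
    qed
    have "interpolates TYPE('u) L c.Lbar"
      unfolding interpolates_def
    proof (intro allI ballI impI exI conjI)
      fix n f A xs assume "f \<in> tuples L n \<rightarrow> carrier L" "A \<subseteq> tuples L n \<and> |A| \<le>o |UNIV :: 'u set|" "xs \<in> A"
      then have "f xs = \<bottom>\<^bsub>L\<^esub>" using one by blast
      then show "eval_orthoterm c.Lbar (Coeff \<bottom>\<^bsub>L\<^esub>) xs = f xs" by simp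
    qed (use car in auto)
    moreover have "squares_embed TYPE('u) c.Lbar"
      unfolding squares_embed_def sublattice_set_def car by blast
    ultimately show ?thesis
      using c.complete_ortholattice_Lbar c.subortholattice_Lbar c.convex_L c.tri_sub_L1 c.is_ortho_Lbar c(3)
      by (intro exI[of _ c.L1] exI[of _ c.Lbar]) simp
  next
    case False
    note nontriv = False
    \<comment> \<open>An index consists of the arity, the graph, and the number of the copy.\<close>
    define I where "I = (UNIV :: nat set) \<times>
       ({g. range g \<subseteq> lists (carrier L) \<times> carrier L} :: ('u \<Rightarrow> 'u set set list \<times> 'u set set) set) \<times> (UNIV :: bool set)"
    define leG where "leG = (\<lambda>(n, g, b :: bool). gadget_le L n (graph_fun L (g :: 'u \<Rightarrow> 'u set set list \<times> 'u set set)))"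
    define G where "G = Sigma I (\<lambda>(n, g, b). gadget L n)"
    define leA where "leA = rel_sum (\<lambda>(i, x) (j, y). i = j \<and> leG i x y)
      (\<lambda>(i :: 'u rel, x) (j, y). i = j \<and> x \<subseteq> (y :: 'u set))"
    define \<rho> where "\<rho> = case_sum (\<lambda>(i :: nat \<times> ('u \<Rightarrow> 'u set set list \<times> 'u set set) \<times> bool, x). gadget_floor L x)
      (\<lambda>(i :: 'u rel, x :: 'u set). \<bottom>\<^bsub>L\<^esub>)"
    define J where "J = Sigma (UNIV :: 'u rel set) rel_ideals"
    have graph_closed: "graph_fun L g x \<in> carrier L" if "range g \<subseteq> lists (carrier L) \<times> carrier L" for g :: "'u \<Rightarrow> _" and x
    proof (cases "\<exists>y. (x, y) \<in> range g")
      case True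
      then have "(x, SOME y. (x, y) \<in> range g) \<in> range g" by (rule someI_ex)
      then have "(SOME y. (x, y) \<in> range g) \<in> carrier L" using that by blast
      then show ?thesis using True by (simp add: graph_fun_def)
    next
      case False
      then show ?thesis by (simp add: graph_fun_def)
    qed
    have "crown L G (\<lambda>(i, x) (j, y). i = j \<and> leG i x y) (\<lambda>(i, x). gadget_floor L x)"
      unfolding G_def
    proof (rule crown_Sigma)
      fix i assume "i \<in> I"
      then show "crown L (case i of (n, g, b) \<Rightarrow> gadget L n) (leG i) (gadget_floor L)"
        using nontriv graph_closed by (auto simp: I_def leG_def intro!: gadget_crown)
    qed
    moreover have "crown L J (\<lambda>(i, x) (j, y). i = j \<and> x \<subseteq> y) (\<lambda>(i, x). \<bottom>\<^bsub>L\<^esub>)"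
      unfolding J_def by (rule crown_Sigma) (rule rel_ideals_crown[OF nontriv])
    ultimately have crown: "crown L (G <+> J) leA \<rho>"
      unfolding leA_def \<rho>_def by (rule crown_Plus)
    have fits: "fits TYPE('u) (G <+> J)"
    proof -
      have fl: "fits TYPE('u) (lists (carrier L))" by (rule fits_lists[OF inf fL])
      have "fits TYPE('u) I"
        unfolding I_def by (intro fits_Sigma fits_funs inf fits_nat fl fL fits_finite) auto
      moreover have "fits TYPE('u) (gadget L n)" for n
      proof -
        have t: "fits TYPE('u) (tuples L n)"
          by (rule fits_mono[OF fl]) (auto simp: tuples_def lists_eq_set)
        have "fits TYPE('u) ((\<lambda>(u, v). Box u v) ` (tuples L n \<times> tuples L n) \<union> Tip ` tuples L n \<union>
            Rail ` carrier L \<union> Peak ` carrier L)"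
          by (intro fits_Un fits_image fits_Sigma inf t fL)
        then show ?thesis by (rule fits_mono) (auto simp: gadget_def)
      qed
      ultimately have "fits TYPE('u) G" unfolding G_def by (intro fits_Sigma inf) auto
      moreover have "fits TYPE('u) J" unfolding J_def by (intro fits_Sigma inf fits_rel fits_UNIV)
      ultimately show ?thesis unfolding Plus_def by (intro fits_Un fits_image inf)
    qed
    obtain N leN \<pi> \<iota> h where c: "crowned L N leN \<pi> \<iota>" and h: "inj_on h (G <+> J)" and N: "N = h ` (G <+> J)"
      and le: "\<And>x y. \<lbrakk>x \<in> G <+> J; y \<in> G <+> J\<rbrakk> \<Longrightarrow> leN (h x) (h y) \<longleftrightarrow> leA x y"
      and pi: "\<And>x. x \<in> G <+> J \<Longrightarrow> \<pi> (h x) = \<rho> x"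
      and fC: "fits TYPE('u) (crowned.C L N \<iota>)"
      using crowned_copy[OF L inf fL fits crown] by blast
    interpret c: crowned L N leN \<pi> \<iota> by (rule c)
    have gadget: "gadget_component L N leN \<pi> \<iota> (\<lambda>p. h (Inl ((n, g, b), p))) n (graph_fun L g)"
      if i: "(n, g, b) \<in> I" for n g b
    proof (intro gadget_component.intro gadget_component_axioms.intro nontriv)
      show "crown_part L N leN \<pi> \<iota> (gadget L n) (gadget_le L n (graph_fun L g)) (gadget_floor L)
          (\<lambda>p. h (Inl ((n, g, b), p)))"
        by (rule crown_part_of_copy[OF c N le pi])
          (use i in \<open>auto simp: G_def leA_def \<rho>_def leG_def elim!: rel_sum.cases\<close>)
    qed (use graph_closed i in \<open>auto simp: I_def\<close>)
    have ideal: "ideal_component L N leN \<pi> \<iota> (\<lambda>p. h (Inr (r, p))) r" for r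
      by (rule ideal_component.intro, rule crown_part_of_copy[OF c N le pi])
        (auto simp: J_def leA_def \<rho>_def elim!: rel_sum.cases)
    have "interpolates TYPE('u) L c.Lbar"
      unfolding interpolates_def
    proof (intro allI ballI impI)
      fix n f A assume f: "f \<in> tuples L n \<rightarrow> carrier L" and A: "A \<subseteq> tuples L n \<and> |A| \<le>o |UNIV :: 'u set|"
      show "\<exists>p. orthopolynomial c.Lbar n p \<and> (\<forall>xs\<in>A. eval_orthoterm c.Lbar p xs = f xs)"
      proof (cases "A = {} \<or> n = 0")
        case True
        have "f [] \<in> carrier L" if "n = 0" using f that by (auto simp: tuples_def)
        then show ?thesis
          using True A by (intro exI[of _ "Coeff (if n = 0 then f [] else \<bottom>\<^bsub>L\<^esub>)"]) (auto simp: c.L_sub_C tuples_def)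
      next
        case False
        then obtain s :: "'u \<Rightarrow> _" where s: "range s = A" using A card_of_ordLeq2[of A "UNIV :: 'u set"] by auto
        define g where "g u = (s u, f (s u))" for u
        have g: "range g \<subseteq> lists (carrier L) \<times> carrier L"
          using s A f by (auto simp: g_def tuples_def lists_eq_set)
        then have gI: "(n, g, b) \<in> I" for b by (simp add: I_def)
        have "graph_fun L g x = f x" if "x \<in> A" for x
        proof -
          have "(x, y) \<in> range g \<longleftrightarrow> y = f x" for y using that s by (auto simp: g_def)
          then show ?thesis by (simp add: graph_fun_def)
        qed
        moreover have "\<exists>p. orthopolynomial c.Lbar n p \<and> (\<forall>x\<in>tuples L n. eval_orthoterm c.Lbar p x = graph_fun L g x)"
        proof (rule gadget_pair_interpolates[OF gadget[OF gI[of True]] gadget[OF gI[of False]]])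
          show "(\<lambda>p. h (Inl ((n, g, True), p))) ` gadget L n \<inter> (\<lambda>p. h (Inl ((n, g, False), p))) ` gadget L n = {}"
          proof (rule ccontr)
            assume "\<not> ?thesis"
            then obtain p q where "p \<in> gadget L n" "q \<in> gadget L n"
              and eq: "h (Inl ((n, g, True), p)) = h (Inl ((n, g, False), q))" by auto
            then have "Inl ((n, g, True), p) \<in> G <+> J" "Inl ((n, g, False), q) \<in> G <+> J"
              using gI[of True] gI[of False] by (auto simp: G_def)
            from inj_onD[OF h eq this] show False by simp
          qed
        qed (use False in auto)
        ultimately show ?thesis using A by (metis subsetD)
      qed
    qed
    moreover have "squares_embed TYPE('u) c.Lbar"
      unfolding squares_embed_def
    proof (intro allI impI disjI2)
      fix S assume S: "sublattice_set S c.Lbar \<and> |S \<times> S| \<le>o |UNIV :: 'u set|"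
      then obtain e :: "_ \<Rightarrow> 'u" where e: "inj_on e (S \<times> S)"
        using card_of_ordLeq[of "S \<times> S" "UNIV :: 'u set"] by blast
      let ?A = "prod_lattice (c.Lbar\<lparr>carrier := S\<rparr>) (c.Lbar\<lparr>carrier := S\<rparr>)"
      define r where "r = {(e x, e y) | x y. x \<in> carrier ?A \<and> y \<in> carrier ?A \<and> x \<sqsubseteq>\<^bsub>?A\<^esub> y}"
      interpret i: ideal_component L N leN \<pi> \<iota> "\<lambda>p. h (Inr (r, p))" r by (rule ideal)
      interpret B: complete_lattice c.Lbar by (rule c.complete_lattice_Lbar)
      have "lattice ?A"
        using S sublattice_set_ops(1)[OF B.lattice_axioms] by (intro lattice_prod) auto
      moreover have "carrier ?A = S \<times> S" by (simp add: prod_lattice_def)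
      ultimately show "\<exists>h. sublattice_set (h ` (S \<times> S)) c.Lbar \<and> lattice_iso ?A (c.Lbar\<lparr>carrier := h ` (S \<times> S)\<rparr>) h"
        using i.embed_lattice[of ?A e] e r_def S by (auto simp: sublattice_set_def)
    qed
    ultimately show ?thesis
      using c.complete_ortholattice_Lbar c.subortholattice_Lbar c.convex_L c.tri_sub_L1 c.is_ortho_Lbar fC
      by (intro exI[of _ c.L1] exI[of _ c.Lbar]) simp
  qed
qed

section \<open>Unions of convex chains\<close>

definition convex_ext :: "('e, 'm) ortholat_scheme \<Rightarrow> ('e, 'm) ortholat_scheme \<Rightarrow> bool" where
  "convex_ext L M \<longleftrightarrow> subortholattice L M \<and> convex_in (carrier L) M"

lemma subortholatticeD:
  assumes "subortholattice L M"
  shows "ortholattice L" "ortholattice M" "sublattice01 L M" "carrier L \<subseteq> carrier M"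
    "\<And>x. x \<in> carrier L \<Longrightarrow> orth L x = orth M x"
    "\<And>x y. \<lbrakk>x \<in> carrier L; y \<in> carrier L\<rbrakk> \<Longrightarrow> x \<squnion>\<^bsub>L\<^esub> y = x \<squnion>\<^bsub>M\<^esub> y"
    "\<And>x y. \<lbrakk>x \<in> carrier L; y \<in> carrier L\<rbrakk> \<Longrightarrow> x \<sqinter>\<^bsub>L\<^esub> y = x \<sqinter>\<^bsub>M\<^esub> y"
    "\<And>x y. \<lbrakk>x \<in> carrier L; y \<in> carrier L\<rbrakk> \<Longrightarrow> x \<sqsubseteq>\<^bsub>M\<^esub> y \<longleftrightarrow> x \<sqsubseteq>\<^bsub>L\<^esub> y"
    "\<bottom>\<^bsub>L\<^esub> = \<bottom>\<^bsub>M\<^esub>" "\<top>\<^bsub>L\<^esub> = \<top>\<^bsub>M\<^esub>"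
proof -
  show sub: "sublattice01 L M" using assms by (simp add: subortholattice_def)
  show "ortholattice L" "ortholattice M" using assms by (simp_all add: subortholattice_def)
  show "x \<sqsubseteq>\<^bsub>M\<^esub> y \<longleftrightarrow> x \<sqsubseteq>\<^bsub>L\<^esub> y" if "x \<in> carrier L" "y \<in> carrier L" for x y
    by (rule sublattice01_le_iff[OF sub that])
  show "orth L x = orth M x" if "x \<in> carrier L" for x
    using assms that by (simp add: subortholattice_def)
  show "carrier L \<subseteq> carrier M" "\<bottom>\<^bsub>L\<^esub> = \<bottom>\<^bsub>M\<^esub>" "\<top>\<^bsub>L\<^esub> = \<top>\<^bsub>M\<^esub>"
    using sub by (simp_all only: sublattice01_def)
  have "\<forall>x\<in>carrier L. \<forall>y\<in>carrier L. x \<squnion>\<^bsub>L\<^esub> y = x \<squnion>\<^bsub>M\<^esub> y \<and> x \<sqinter>\<^bsub>L\<^esub> y = x \<sqinter>\<^bsub>M\<^esub> y"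
    using sub unfolding sublattice01_def by (elim conjE)
  then show "x \<squnion>\<^bsub>L\<^esub> y = x \<squnion>\<^bsub>M\<^esub> y" "x \<sqinter>\<^bsub>L\<^esub> y = x \<sqinter>\<^bsub>M\<^esub> y" if "x \<in> carrier L" "y \<in> carrier L" for x y
    using that by blast+
qed

lemma subortholattice_refl: "ortholattice L \<Longrightarrow> subortholattice L L"
  by (auto simp: subortholattice_def sublattice01_def ortholattice_def)

lemma subortholattice_trans:
  assumes "subortholattice L M" "subortholattice M K"
  shows "subortholattice L K"
proof -
  note LM = subortholatticeD[OF assms(1)] and MK = subortholatticeD[OF assms(2)]
  have sub: "\<And>x. x \<in> carrier L \<Longrightarrow> x \<in> carrier M" using LM(4) by blast
  have "sublattice01 L K"
    unfolding sublattice01_def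
  proof (intro conjI ballI)
    show "bounded_lattice L" "bounded_lattice K" using LM(1) MK(2) by (simp_all add: ortholattice_def)
    show "carrier L \<subseteq> carrier K" using LM(4) MK(4) by (rule subset_trans)
    show "\<bottom>\<^bsub>L\<^esub> = \<bottom>\<^bsub>K\<^esub>" by (rule trans[OF LM(9) MK(9)])
    show "\<top>\<^bsub>L\<^esub> = \<top>\<^bsub>K\<^esub>" by (rule trans[OF LM(10) MK(10)])
    fix x y assume x: "x \<in> carrier L" "y \<in> carrier L"
    show "x \<squnion>\<^bsub>L\<^esub> y = x \<squnion>\<^bsub>K\<^esub> y" by (rule trans[OF LM(6)[OF x] MK(6)[OF x[THEN sub]]])
    show "x \<sqinter>\<^bsub>L\<^esub> y = x \<sqinter>\<^bsub>K\<^esub> y" by (rule trans[OF LM(7)[OF x] MK(7)[OF x[THEN sub]]])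
  qed
  moreover have "orth L x = orth K x" if "x \<in> carrier L" for x
    by (rule trans[OF LM(5)[OF that] MK(5)[OF sub[OF that]]])
  ultimately show ?thesis using LM(1) MK(2) by (simp add: subortholattice_def)
qed

lemma ortholattice_eq: "ortholattice L \<Longrightarrow> eq L = (=)"
proof -
  assume "ortholattice L"
  then interpret ortholattice L .
  show "eq L = (=)" by (rule eq_is_equal)
qed

lemma convex_ext_refl: "ortholattice L \<Longrightarrow> convex_ext L L"
  by (simp add: convex_ext_def subortholattice_refl convex_in_def)

lemma convex_ext_D:
  assumes "convex_ext L M" "a \<in> carrier L" "b \<in> carrier L" "x \<in> carrier M"
    "a \<noteq> \<bottom>\<^bsub>M\<^esub>" "b \<noteq> \<top>\<^bsub>M\<^esub>" "a \<sqsubseteq>\<^bsub>M\<^esub> x" "x \<sqsubseteq>\<^bsub>M\<^esub> b"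
  shows "x \<in> carrier L"
proof -
  have sub: "subortholattice L M" using assms(1) by (simp add: convex_ext_def)
  interpret M: ortholattice M by (rule subortholatticeD[OF sub])
  have "a \<in> carrier M" "b \<in> carrier M" using assms(2,3) subortholatticeD(4)[OF sub] by auto
  then have "\<bottom>\<^bsub>M\<^esub> \<sqsubset>\<^bsub>M\<^esub> a" "b \<sqsubset>\<^bsub>M\<^esub> \<top>\<^bsub>M\<^esub>"
    using assms(5,6) by (auto simp: lless_def M.eq_is_equal)
  then show ?thesis using assms unfolding convex_ext_def convex_in_def by blast
qed

lemma convex_extI:
  assumes "subortholattice L M"
    and "\<And>a b x. \<lbrakk>a \<in> carrier L; b \<in> carrier L; x \<in> carrier M; a \<noteq> \<bottom>\<^bsub>M\<^esub>; b \<noteq> \<top>\<^bsub>M\<^esub>;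
      a \<sqsubseteq>\<^bsub>M\<^esub> x; x \<sqsubseteq>\<^bsub>M\<^esub> b\<rbrakk> \<Longrightarrow> x \<in> carrier L"
  shows "convex_ext L M"
  unfolding convex_ext_def convex_in_def lless_def ortholattice_eq[OF subortholatticeD(2)[OF assms(1)]]
  by (intro conjI ballI impI assms(1) subortholatticeD(4)[OF assms(1)]; elim conjE; rule assms(2)) auto

lemma convex_ext_trans:
  assumes "convex_ext L M" "convex_ext M K"
  shows "convex_ext L K"
proof (rule convex_extI)
  have LM: "subortholattice L M" and MK: "subortholattice M K" using assms by (auto simp: convex_ext_def)
  then show "subortholattice L K" by (rule subortholattice_trans)
  fix a b x assume *: "a \<in> carrier L" "b \<in> carrier L" "x \<in> carrier K" "a \<noteq> \<bottom>\<^bsub>K\<^esub>" "b \<noteq> \<top>\<^bsub>K\<^esub>"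
      "a \<sqsubseteq>\<^bsub>K\<^esub> x" "x \<sqsubseteq>\<^bsub>K\<^esub> b"
  then have ab: "a \<in> carrier M" "b \<in> carrier M" using subortholatticeD(4)[OF LM] by auto
  then have x: "x \<in> carrier M" using convex_ext_D[OF assms(2) _ _ *(3)] * by blast
  show "x \<in> carrier L"
    using convex_ext_D[OF assms(1) *(1,2) x] * ab x subortholatticeD(8-10)[OF MK] by auto
qed

lemma eval_subortholattice:
  assumes "subortholattice M K" "xs \<in> tuples M n" "orthopolynomial M n p"
  shows "orthopolynomial K n p \<and> eval_orthoterm K p xs = eval_orthoterm M p xs \<and> eval_orthoterm M p xs \<in> carrier M"
proof -
  note D = subortholatticeD[OF assms(1)]
  interpret M: ortholattice M by (rule D)
  have sub: "\<And>x. x \<in> carrier M \<Longrightarrow> x \<in> carrier K" using D(4) by blast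
  show ?thesis using assms(3)
    by (induction p)
      (use tuples_nth[OF assms(2)] in \<open>simp_all add: sub D(5-7)[symmetric] M.orth_closed\<close>)
qed

lemma orthopolynomial_mono:
  assumes "carrier M \<subseteq> carrier K" "orthopolynomial M n p"
  shows "orthopolynomial K n p"
  using assms(2) by (induction p) (use assms(1) in auto)

lemma interpolates_mono:
  assumes "interpolates TYPE('u) L M" "subortholattice L M" "subortholattice M K"
  shows "interpolates TYPE('u) L K"
  unfolding interpolates_def
proof (intro allI ballI impI)
  fix n f A assume *: "f \<in> tuples L n \<rightarrow> carrier L" "A \<subseteq> tuples L n \<and> |A| \<le>o |UNIV :: 'u set|"
  then obtain p where p: "orthopolynomial M n p" "\<forall>xs\<in>A. eval_orthoterm M p xs = f xs"
    using assms(1) unfolding interpolates_def by blast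
  have "A \<subseteq> tuples M n" using * subortholatticeD(4)[OF assms(2)] by (fastforce simp: tuples_def)
  then have "\<forall>xs\<in>A. eval_orthoterm K p xs = f xs"
    using eval_subortholattice[OF assms(3) _ p(1)] p(2) by auto
  then show "\<exists>p. orthopolynomial K n p \<and> (\<forall>xs\<in>A. eval_orthoterm K p xs = f xs)"
    using orthopolynomial_mono[OF subortholatticeD(4)[OF assms(3)] p(1)] by blast
qed

text \<open>
  The choice in the orthocomplement does not matter on chains of subortholattices (lemma \<open>orth_U\<close>).
\<close>

definition chain_union :: "'e ortholat set \<Rightarrow> 'e ortholat" where
  "chain_union T = \<lparr>carrier = (\<Union>M\<in>T. carrier M), eq = (=),
     le = (\<lambda>x y. \<exists>M\<in>T. x \<in> carrier M \<and> y \<in> carrier M \<and> x \<sqsubseteq>\<^bsub>M\<^esub> y),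
     orth = (\<lambda>x. orth (SOME M. M \<in> T \<and> x \<in> carrier M) x)\<rparr>"

locale convex_chain =
  fixes T :: "'e ortholat set"
  assumes T_nonempty: "T \<noteq> {}"
    and T_complete: "M \<in> T \<Longrightarrow> complete_ortholattice M"
    and T_chain: "\<lbrakk>M \<in> T; K \<in> T\<rbrakk> \<Longrightarrow> convex_ext M K \<or> convex_ext K M"
begin

abbreviation "U \<equiv> chain_union T"

abbreviation leU (infix \<open>\<preceq>\<close> 50) where "x \<preceq> y \<equiv> x \<sqsubseteq>\<^bsub>U\<^esub> y"

lemma carrier_U: "carrier U = (\<Union>M\<in>T. carrier M)" and eq_U: "eq U = (=)"
  by (simp_all add: chain_union_def)

lemma carrier_sub: "M \<in> T \<Longrightarrow> x \<in> carrier M \<Longrightarrow> x \<in> carrier U"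
  by (auto simp: carrier_U)

lemma T_ortho: "M \<in> T \<Longrightarrow> ortholattice M"
  using T_complete by (simp add: complete_ortholattice_def)

lemma same_ops:
  assumes "M \<in> T" "K \<in> T" "x \<in> carrier M" "x \<in> carrier K" "y \<in> carrier M" "y \<in> carrier K"
  shows "x \<sqsubseteq>\<^bsub>M\<^esub> y \<longleftrightarrow> x \<sqsubseteq>\<^bsub>K\<^esub> y" "orth M x = orth K x" "x \<squnion>\<^bsub>M\<^esub> y = x \<squnion>\<^bsub>K\<^esub> y" "x \<sqinter>\<^bsub>M\<^esub> y = x \<sqinter>\<^bsub>K\<^esub> y"
proof -
  have "subortholattice M K \<or> subortholattice K M"
    using T_chain[OF assms(1,2)] by (auto simp: convex_ext_def)
  then have "(x \<sqsubseteq>\<^bsub>M\<^esub> y \<longleftrightarrow> x \<sqsubseteq>\<^bsub>K\<^esub> y) \<and> orth M x = orth K x \<and> x \<squnion>\<^bsub>M\<^esub> y = x \<squnion>\<^bsub>K\<^esub> y \<and> x \<sqinter>\<^bsub>M\<^esub> y = x \<sqinter>\<^bsub>K\<^esub> y"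
  proof
    assume "subortholattice M K"
    from subortholatticeD(5-8)[OF this] show ?thesis using assms(3,5) by simp
  next
    assume "subortholattice K M"
    from subortholatticeD(5-8)[OF this] show ?thesis using assms(4,6) by simp
  qed
  then show "x \<sqsubseteq>\<^bsub>M\<^esub> y \<longleftrightarrow> x \<sqsubseteq>\<^bsub>K\<^esub> y" "orth M x = orth K x" "x \<squnion>\<^bsub>M\<^esub> y = x \<squnion>\<^bsub>K\<^esub> y" "x \<sqinter>\<^bsub>M\<^esub> y = x \<sqinter>\<^bsub>K\<^esub> y"
    by simp_all
qed

lemma same_bounds: "\<lbrakk>M \<in> T; K \<in> T\<rbrakk> \<Longrightarrow> \<bottom>\<^bsub>M\<^esub> = \<bottom>\<^bsub>K\<^esub> \<and> \<top>\<^bsub>M\<^esub> = \<top>\<^bsub>K\<^esub>"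
  using T_chain[of M K] subortholatticeD(9,10) unfolding convex_ext_def by metis

lemma le_U: "\<lbrakk>M \<in> T; x \<in> carrier M; y \<in> carrier M\<rbrakk> \<Longrightarrow> x \<preceq> y \<longleftrightarrow> x \<sqsubseteq>\<^bsub>M\<^esub> y"
proof -
  assume *: "M \<in> T" "x \<in> carrier M" "y \<in> carrier M"
  have "x \<sqsubseteq>\<^bsub>M\<^esub> y" if "K \<in> T" "x \<in> carrier K" "y \<in> carrier K" "x \<sqsubseteq>\<^bsub>K\<^esub> y" for K
    using same_ops(1)[OF *(1) that(1) *(2) that(2) *(3) that(3)] that(4) by simp
  then show ?thesis using * unfolding chain_union_def by (simp, blast)
qed

lemma orth_U: "\<lbrakk>M \<in> T; x \<in> carrier M\<rbrakk> \<Longrightarrow> orth U x = orth M x"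
proof -
  assume *: "M \<in> T" "x \<in> carrier M"
  let ?K = "SOME M. M \<in> T \<and> x \<in> carrier M"
  have "?K \<in> T \<and> x \<in> carrier ?K" by (rule someI[of _ M]) (use * in auto)
  then show ?thesis using same_ops(2)[of ?K M x x] * by (simp add: chain_union_def)
qed

lemma above:
  assumes "M \<in> T" "w \<in> carrier U"
  obtains K where "K \<in> T" "w \<in> carrier K" "convex_ext M K"
proof -
  obtain K where K: "K \<in> T" "w \<in> carrier K" using assms(2) by (auto simp: carrier_U)
  show ?thesis
  proof (cases "convex_ext M K")
    case False
    then have "convex_ext K M" using T_chain[OF assms(1) K(1)] by blast
    then have "w \<in> carrier M" using K subortholatticeD(4) unfolding convex_ext_def by blast
    then show ?thesis using that[of M] assms(1) convex_ext_refl[OF T_ortho] by blast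
  qed (use that K in blast)
qed

lemma carrier_mono: "convex_ext M K \<Longrightarrow> x \<in> carrier M \<Longrightarrow> x \<in> carrier K"
  using subortholatticeD(4) unfolding convex_ext_def by blast

lemma common:
  assumes "x \<in> carrier U" "y \<in> carrier U"
  obtains K where "K \<in> T" "x \<in> carrier K" "y \<in> carrier K"
proof -
  obtain M where M: "M \<in> T" "x \<in> carrier M" using assms(1) by (auto simp: carrier_U)
  obtain K where K: "K \<in> T" "y \<in> carrier K" "convex_ext M K" using above[OF M(1) assms(2)] .
  show ?thesis by (rule that[OF K(1) carrier_mono[OF K(3) M(2)] K(2)])
qed

lemma join_le_U:
  assumes "M \<in> T" "x \<in> carrier M" "y \<in> carrier M" "w \<in> carrier U"
  shows "x \<squnion>\<^bsub>M\<^esub> y \<preceq> w \<longleftrightarrow> x \<preceq> w \<and> y \<preceq> w"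
    and "w \<preceq> x \<sqinter>\<^bsub>M\<^esub> y \<longleftrightarrow> w \<preceq> x \<and> w \<preceq> y"
proof -
  obtain K where K: "K \<in> T" "w \<in> carrier K" "convex_ext M K" using above[OF assms(1,4)] .
  interpret K: ortholattice K by (rule T_ortho[OF K(1)])
  have xy: "x \<in> carrier K" "y \<in> carrier K" using carrier_mono[OF K(3)] assms by auto
  have "x \<squnion>\<^bsub>M\<^esub> y = x \<squnion>\<^bsub>K\<^esub> y" "x \<sqinter>\<^bsub>M\<^esub> y = x \<sqinter>\<^bsub>K\<^esub> y" using same_ops(3,4) assms K xy by blast+
  then show "x \<squnion>\<^bsub>M\<^esub> y \<preceq> w \<longleftrightarrow> x \<preceq> w \<and> y \<preceq> w"
    "w \<preceq> x \<sqinter>\<^bsub>M\<^esub> y \<longleftrightarrow> w \<preceq> x \<and> w \<preceq> y"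
    using K.le_join_meet_iff[OF xy K(2)] le_U[OF K(1)] xy K(2) by auto
qed

lemma partial_order_U: "partial_order U"
proof (rule partial_orderI_eq[OF eq_U])
  fix x assume "x \<in> carrier U"
  then obtain M where M: "M \<in> T" "x \<in> carrier M" by (auto simp: carrier_U)
  interpret M: ortholattice M by (rule T_ortho[OF M(1)])
  show "x \<preceq> x" using M by (simp add: le_U[OF M(1)])
next
  fix x y assume *: "x \<preceq> y" "y \<preceq> x" "x \<in> carrier U" "y \<in> carrier U"
  obtain M where M: "M \<in> T" "x \<in> carrier M" "y \<in> carrier M" using common[OF *(3,4)] .
  interpret M: ortholattice M by (rule T_ortho[OF M(1)])
  show "x = y" using * M by (intro M.le_antisym) (auto simp: le_U[OF M(1)])
next
  fix x y z assume *: "x \<preceq> y" "y \<preceq> z" "x \<in> carrier U" "y \<in> carrier U" "z \<in> carrier U"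
  obtain M where M: "M \<in> T" "x \<in> carrier M" "y \<in> carrier M" using common[OF *(3,4)] .
  obtain K where K: "K \<in> T" "z \<in> carrier K" "convex_ext M K" using above[OF M(1) *(5)] .
  interpret K: ortholattice K by (rule T_ortho[OF K(1)])
  have "x \<in> carrier K" "y \<in> carrier K" using carrier_mono[OF K(3)] M by auto
  then show "x \<preceq> z" using * K K.le_trans[of x y z] by (simp add: le_U[OF K(1)])
qed

lemma bounds_U:
  assumes "M \<in> T" "x \<in> carrier U"
  shows "\<bottom>\<^bsub>M\<^esub> \<preceq> x" "x \<preceq> \<top>\<^bsub>M\<^esub>"
proof -
  obtain K where K: "K \<in> T" "x \<in> carrier K" using assms(2) by (auto simp: carrier_U)
  interpret K: ortholattice K by (rule T_ortho[OF K(1)])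
  have "\<bottom>\<^bsub>K\<^esub> \<preceq> x" "x \<preceq> \<top>\<^bsub>K\<^esub>" using K by (simp_all add: le_U[OF K(1)])
  then show "\<bottom>\<^bsub>M\<^esub> \<preceq> x" "x \<preceq> \<top>\<^bsub>M\<^esub>" using same_bounds[OF assms(1) K(1)] by auto
qed

lemma between_U:
  assumes M: "M \<in> T" "a \<in> carrier M" "b \<in> carrier M" and x: "x \<in> carrier U"
    and "a \<noteq> \<bottom>\<^bsub>M\<^esub>" "b \<noteq> \<top>\<^bsub>M\<^esub>" "a \<preceq> x" "x \<preceq> b"
  shows "x \<in> carrier M"
proof -
  obtain K where K: "K \<in> T" "x \<in> carrier K" "convex_ext M K" using above[OF M(1) x] .
  have "a \<in> carrier K" "b \<in> carrier K" using carrier_mono[OF K(3)] M by auto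
  then show ?thesis
    using convex_ext_D[OF K(3) M(2,3) K(2)] assms(5-8) K same_bounds[OF M(1) K(1)] by (simp add: le_U[OF K(1)])
qed

text \<open>
  The infimum of \<open>A\<close> is sought only if some \<open>a0\<close> in \<open>A\<close> is not the top and some lower bound \<open>y0\<close> of \<open>A\<close> is not
  the bottom. Then \<open>y0\<close> and \<open>a0\<close> belong to a common member \<open>M\<close> of the chain, and by convexity \<open>M\<close> contains all
  lower bounds of \<open>A\<close> above \<open>y0\<close>. Their supremum in \<open>M\<close> is the infimum of \<open>A\<close>: for \<open>a\<close> in \<open>A\<close>, the meet of \<open>a\<close> and \<open>a0\<close> also lies
  between \<open>y0\<close> and \<open>a0\<close>, hence in \<open>M\<close>, and bounds that supremum.
\<close>

lemma complete_lattice_U: "complete_lattice U"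
proof (rule complete_lattice_if_infs[OF partial_order_U])
  interpret U: partial_order U by (rule partial_order_U)
  obtain M0 where M0: "M0 \<in> T" using T_nonempty by auto
  interpret M0: ortholattice M0 by (rule T_ortho[OF M0])
  let ?b = "\<bottom>\<^bsub>M0\<^esub>" and ?t = "\<top>\<^bsub>M0\<^esub>"
  have bt: "?b \<in> carrier U" "?t \<in> carrier U" using carrier_sub[OF M0] by auto
  fix A assume A: "A \<subseteq> carrier U"
  show "\<exists>g\<in>carrier U. \<forall>y\<in>carrier U. y \<preceq> g \<longleftrightarrow> (\<forall>a\<in>A. y \<preceq> a)"
  proof (cases "A \<subseteq> {?t}")
    case True
    then show ?thesis using bt bounds_U[OF M0] by (intro bexI[of _ ?t]) auto
  next
    case False
    then obtain a0 where a0: "a0 \<in> A" "a0 \<noteq> ?t" by blast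
    define Y0 where "Y0 = {y \<in> carrier U. \<forall>a\<in>A. y \<preceq> a}"
    show ?thesis
    proof (cases "Y0 \<subseteq> {?b}")
      case True
      have "y \<preceq> ?b \<longleftrightarrow> (\<forall>a\<in>A. y \<preceq> a)" if y: "y \<in> carrier U" for y
      proof
        assume "y \<preceq> ?b"
        then show "\<forall>a\<in>A. y \<preceq> a"
          using U.le_trans[OF _ bounds_U(1)[OF M0] y bt(1)] subsetD[OF A] by simp
      next
        assume "\<forall>a\<in>A. y \<preceq> a"
        then have "y = ?b" using True y unfolding Y0_def by blast
        then show "y \<preceq> ?b" using bt U.le_refl by simp
      qed
      then show ?thesis using bt by blast
    next
      case False
      then obtain y0 where y0: "y0 \<in> Y0" "y0 \<noteq> ?b" by blast
      have c: "y0 \<in> carrier U" "a0 \<in> carrier U" using y0 a0 A by (auto simp: Y0_def)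
      obtain M where M: "M \<in> T" "y0 \<in> carrier M" "a0 \<in> carrier M" using common[OF c] .
      interpret M: complete_ortholattice M by (rule T_complete[OF M(1)])
      have ne: "y0 \<noteq> \<bottom>\<^bsub>M\<^esub>" "a0 \<noteq> \<top>\<^bsub>M\<^esub>" using y0 a0 same_bounds[OF M(1) M0] by auto
      define Y where "Y = {y \<in> Y0. y0 \<preceq> y}"
      have YM: "Y \<subseteq> carrier M"
        using between_U[OF M _ ne] a0(1) unfolding Y_def Y0_def by blast
      let ?g = "\<Squnion>\<^bsub>M\<^esub>Y"
      have g: "?g \<in> carrier M" using YM by simp
      have gU: "?g \<in> carrier U" using carrier_sub[OF M(1) g] .
      have y0Y: "y0 \<in> Y" using y0 c U.le_refl by (simp add: Y_def)
      have g_le: "?g \<preceq> a" if a: "a \<in> A" for a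
      proof -
        have aU: "a \<in> carrier U" using a A by auto
        obtain K where K: "K \<in> T" "a \<in> carrier K" "convex_ext M K" using above[OF M(1) aU] .
        interpret K: ortholattice K by (rule T_ortho[OF K(1)])
        have a0K: "a0 \<in> carrier K" using carrier_mono[OF K(3) M(3)] .
        let ?m = "a \<sqinter>\<^bsub>K\<^esub> a0"
        have mK: "?m \<in> carrier K" using K a0K by simp
        have mU: "?m \<in> carrier U" using carrier_sub[OF K(1) mK] .
        have le_m: "y \<preceq> ?m" if "y \<in> Y" for y
          using that a a0(1) join_le_U(2)[OF K(1,2) a0K, of y] unfolding Y_def Y0_def by blast
        have "?m \<preceq> a" "?m \<preceq> a0" using join_le_U(2)[OF K(1,2) a0K mU] U.le_refl[OF mU] by auto
        then have mM: "?m \<in> carrier M" using between_U[OF M mU ne] le_m[OF y0Y] by blast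
        have "?g \<sqsubseteq>\<^bsub>M\<^esub> ?m"
          using le_m YM mM by (intro M.sup_least) (auto simp: le_U[OF M(1), symmetric])
        then have "?g \<preceq> ?m" using le_U[OF M(1) g mM] by simp
        then show ?thesis by (rule U.le_trans[OF _ \<open>?m \<preceq> a\<close> gU mU aU])
      qed
      have "y \<preceq> ?g \<longleftrightarrow> (\<forall>a\<in>A. y \<preceq> a)" if y: "y \<in> carrier U" for y
      proof
        assume "y \<preceq> ?g"
        then show "\<forall>a\<in>A. y \<preceq> a"
          using U.le_trans[OF _ g_le y gU] subsetD[OF A] by simp
      next
        assume lower: "\<forall>a\<in>A. y \<preceq> a"
        obtain K where K: "K \<in> T" "y \<in> carrier K" "convex_ext M K" using above[OF M(1) y] .
        interpret K: ortholattice K by (rule T_ortho[OF K(1)])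
        have y0K: "y0 \<in> carrier K" using carrier_mono[OF K(3) M(2)] .
        let ?j = "y \<squnion>\<^bsub>K\<^esub> y0"
        have jK: "?j \<in> carrier K" using K y0K by simp
        have jU: "?j \<in> carrier U" using carrier_sub[OF K(1) jK] .
        have "?j \<preceq> a" if "a \<in> A" for a
          using that lower y0 A join_le_U(1)[OF K(1,2) y0K, of a] unfolding Y0_def by blast
        moreover have yj: "y \<preceq> ?j" "y0 \<preceq> ?j"
          using join_le_U(1)[OF K(1,2) y0K jU] U.le_refl[OF jU] by auto
        ultimately have jY: "?j \<in> Y" using jU by (simp add: Y_def Y0_def)
        then have "?j \<sqsubseteq>\<^bsub>M\<^esub> ?g" using YM by (intro M.sup_upper) auto
        then have "?j \<preceq> ?g" using le_U[OF M(1) _ g] jY YM by blast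
        then show "y \<preceq> ?g" by (rule U.le_trans[OF yj(1) _ y jU gU])
      qed
      then show ?thesis using gU by blast
    qed
  qed
qed

lemma sublattice_U: "M \<in> T \<Longrightarrow> sublattice01 M U"
proof (rule sublattice01I)
  assume M: "M \<in> T"
  interpret M: ortholattice M by (rule T_ortho[OF M])
  interpret U: complete_lattice U by (rule complete_lattice_U)
  show "bounded_lattice M" "bounded_lattice U" by unfold_locales
qed (use carrier_sub bounds_U join_le_U le_U in auto)

lemma complete_ortholattice_U: "complete_ortholattice U"
proof -
  interpret U: complete_lattice U by (rule complete_lattice_U)
  interpret U: bounded_lattice U by unfold_locales
  have ops: "orth U x \<in> carrier U" "orth U (orth U x) = x" "x \<squnion>\<^bsub>U\<^esub> orth U x = \<top>\<^bsub>U\<^esub>" "x \<sqinter>\<^bsub>U\<^esub> orth U x = \<bottom>\<^bsub>U\<^esub>"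
    if x: "x \<in> carrier U" for x
  proof -
    obtain M where M: "M \<in> T" "x \<in> carrier M" using x by (auto simp: carrier_U)
    interpret M: ortholattice M by (rule T_ortho[OF M(1)])
    note o = M.orth_closed[OF M(2)]
    note s = sublattice_U[OF M(1), unfolded sublattice01_def]
    show "orth U x \<in> carrier U" using carrier_sub[OF M(1) o] by (simp add: orth_U[OF M])
    show "orth U (orth U x) = x" by (simp add: orth_U[OF M] orth_U[OF M(1) o] M.orth_orth M)
    show "x \<squnion>\<^bsub>U\<^esub> orth U x = \<top>\<^bsub>U\<^esub>" "x \<sqinter>\<^bsub>U\<^esub> orth U x = \<bottom>\<^bsub>U\<^esub>"
      using s M.join_orth[OF M(2)] M.meet_orth[OF M(2)] M(2) o by (simp_all add: orth_U[OF M])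
  qed
  have anti: "orth U y \<preceq> orth U x" if *: "x \<in> carrier U" "y \<in> carrier U" "x \<preceq> y" for x y
  proof -
    obtain M where M: "M \<in> T" "x \<in> carrier M" "y \<in> carrier M" using common[OF *(1,2)] .
    interpret M: ortholattice M by (rule T_ortho[OF M(1)])
    show ?thesis using * M M.orth_antitone by (simp add: orth_U[OF M(1)] le_U[OF M(1)] M.orth_closed)
  qed
  show ?thesis by unfold_locales (use ops anti in auto)
qed

lemma convex_ext_U: "M \<in> T \<Longrightarrow> convex_ext M U"
proof (rule convex_extI)
  assume M: "M \<in> T"
  then show "subortholattice M U"
    using sublattice_U[OF M] T_ortho[OF M] complete_ortholattice_U orth_U[OF M]
    by (simp add: subortholattice_def complete_ortholattice_def)
  have "\<bottom>\<^bsub>M\<^esub> = \<bottom>\<^bsub>U\<^esub>" "\<top>\<^bsub>M\<^esub> = \<top>\<^bsub>U\<^esub>" using sublattice_U[OF M] by (auto simp: sublattice01_def)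
  then show "x \<in> carrier M" if "a \<in> carrier M" "b \<in> carrier M" "x \<in> carrier U" "a \<noteq> \<bottom>\<^bsub>U\<^esub>" "b \<noteq> \<top>\<^bsub>U\<^esub>"
      "a \<preceq> x" "x \<preceq> b" for a b x
    using between_U[OF M that(1-3)] that by simp
qed

end

text \<open>
  The maximal chain replaces a transfinite iteration of \<open>extension_step\<close>, and maximality is used twice. If no member of
  the chain contains \<open>B\<close>, then for every member there is a larger one containing an element of \<open>B\<close> that the former
  lacks. So the union is covered by \<open>|B|\<close> many members, it fits, and it succeeds every member; by maximality it is a member
  itself, and it contains \<open>B\<close>. If no member interpolates the functions on the member \<open>M\<close>, then \<open>M\<close> is the last member and the chain
  could be prolonged by \<open>extension_step\<close>.
\<close>

theorem self_interpolating_extension: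
  fixes L :: "'u set set ortholat"
  assumes L: "complete_ortholattice L" and inf: "infinite (UNIV :: 'u set)"
    and fL: "fits TYPE('u) (carrier L)"
  shows "\<exists>H :: 'u set set ortholat. complete_ortholattice H \<and> subortholattice L H \<and> interpolates TYPE('u) H H"
proof -
  define R where "R M K \<longleftrightarrow> convex_ext M K \<and> interpolates TYPE('u) M K" for M K :: "'u set set ortholat"
  define S where "S = {M. complete_ortholattice M \<and> fits TYPE('u) (carrier M) \<and> (M = L \<or> R L M)}"
  have R_trans: "R M K'" if "R M K" "R K K'" for M K K'
    using that convex_ext_trans interpolates_mono unfolding R_def by (meson convex_ext_def)
  obtain T where T: "pred_on.maxchain S R T" using pred_on.Hausdorff by blast
  then have chain: "T \<subseteq> S" "\<And>M K. \<lbrakk>M \<in> T; K \<in> T\<rbrakk> \<Longrightarrow> M = K \<or> R M K \<or> R K M"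
    unfolding pred_on.maxchain_def pred_on.chain_def by auto
  have maximal: "X \<in> T" if "X \<in> S" "\<And>M. M \<in> T \<Longrightarrow> M = X \<or> R M X \<or> R X M" for X
  proof (rule ccontr)
    assume "X \<notin> T"
    moreover have "pred_on.chain S R (insert X T)"
      unfolding pred_on.chain_def using that chain by auto
    ultimately show False using T unfolding pred_on.maxchain_def by blast
  qed
  have LT: "L \<in> T"
    by (rule maximal) (use chain(1) L fL in \<open>auto simp: S_def\<close>)
  have T_complete': "complete_ortholattice M" if "M \<in> T" for M
    using that chain(1) by (auto simp: S_def)
  have T_chain': "convex_ext M K \<or> convex_ext K M" if "M \<in> T" "K \<in> T" for M K
    using chain(2)[OF that] convex_ext_refl[of M] T_complete'[OF that(1)]
    by (auto simp: R_def complete_ortholattice_def)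
  interpret convex_chain T
    by (rule convex_chain.intro) (use LT T_complete' T_chain' in auto)
  have sub_U: "subortholattice M U" if "M \<in> T" for M
    using convex_ext_U[OF that] by (simp add: convex_ext_def)
  have absorb: "\<exists>M\<in>T. B \<subseteq> carrier M" if B: "B \<subseteq> carrier U" "|B| \<le>o |UNIV :: 'u set|" for B
  proof (rule ccontr)
    assume no: "\<not> ?thesis"
    have "\<forall>x\<in>B. \<exists>M\<in>T. x \<in> carrier M" using B(1) by (auto simp: carrier_U)
    then obtain m where m: "\<And>x. x \<in> B \<Longrightarrow> m x \<in> T" "\<And>x. x \<in> B \<Longrightarrow> x \<in> carrier (m x)" by metis
    have beyond: "\<exists>x\<in>B. R M (m x)" if "M \<in> T" for M
    proof -
      have "\<not> B \<subseteq> carrier M" using no bexI[OF _ that, of "\<lambda>M. B \<subseteq> carrier M"] by iprover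
      then obtain x where x: "x \<in> B" "x \<notin> carrier M" unfolding subset_iff not_all not_imp by iprover
      then have "\<not> convex_ext (m x) M" "m x \<noteq> M"
        using m(2)[OF x(1)] carrier_mono[of "m x" M x] by auto
      then show ?thesis using chain(2)[OF that m(1)[OF x(1)]] x(1) by (auto simp: R_def)
    qed
    have R_U: "R M U" if "M \<in> T" for M
    proof -
      obtain x where x: "x \<in> B" "R M (m x)" using beyond[OF \<open>M \<in> T\<close>] by blast
      then have "interpolates TYPE('u) M U"
        using interpolates_mono[OF _ _ sub_U[OF m(1)[OF x(1)]], of M] by (auto simp: R_def convex_ext_def)
      then show ?thesis using convex_ext_U[OF that] by (simp add: R_def)
    qed
    have "carrier U \<subseteq> (\<Union>x\<in>B. carrier (m x))"
      using beyond carrier_mono by (fastforce simp: carrier_U R_def)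
    moreover have "fits TYPE('u) (\<Union>x\<in>B. carrier (m x))"
    proof (rule fits_UN[OF inf])
      have "|UNIV :: 'u set| \<le>o |UNIV :: 'u set set|"
        using ordLess_imp_ordLeq[OF card_of_Pow[of "UNIV :: 'u set"]] by simp
      then show "fits TYPE('u) B" using B(2) ordLeq_transitive unfolding fits_def by blast
      show "fits TYPE('u) (carrier (m x))" if "x \<in> B" for x
        using m(1)[OF that] chain(1) by (auto simp: S_def)
    qed
    ultimately have "fits TYPE('u) (carrier U)" by (rule fits_mono[rotated])
    then have "U \<in> S" using complete_ortholattice_U R_U[OF LT] by (simp add: S_def)
    then have "U \<in> T" by (rule maximal) (use R_U in blast)
    then show False using no B(1) by blast
  qed
  have step: "\<exists>K\<in>T. R M K" if M: "M \<in> T" for M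
  proof (rule ccontr)
    assume top: "\<not> ?thesis"
    have MS: "M \<in> S" using M chain(1) by blast
    then obtain X where "complete_ortholattice X" "fits TYPE('u) (carrier X)" and X: "R M X"
      using extension_step[OF _ inf, of M] unfolding S_def R_def convex_ext_def by blast
    then have "X \<in> S" using MS R_trans by (auto simp: S_def)
    moreover have "K = X \<or> R K X \<or> R X K" if "K \<in> T" for K
      using chain(2)[OF that M] top that X R_trans by blast
    ultimately have "X \<in> T" by (rule maximal)
    then show False using top X by blast
  qed
  have "interpolates TYPE('u) U U"
    unfolding interpolates_def
  proof (intro allI ballI impI)
    fix n f A assume f: "f \<in> tuples U n \<rightarrow> carrier U" and A: "A \<subseteq> tuples U n \<and> |A| \<le>o |UNIV :: 'u set|"
    define B where "B = (\<Union>xs\<in>A. insert (f xs) (set xs))"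
    have "B \<subseteq> carrier U" using f A by (auto simp: B_def tuples_def)
    moreover have "|B| \<le>o |UNIV :: 'u set|"
      unfolding B_def
    proof (rule card_of_UNION_ordLeq_infinite[OF inf])
      show "\<forall>xs\<in>A. |insert (f xs) (set xs)| \<le>o |UNIV :: 'u set|"
      proof
        fix xs
        have "\<not> |UNIV :: 'u set| \<le>o |insert (f xs) (set xs)|"
          using card_of_ordLeq_infinite[OF _ inf, of "insert (f xs) (set xs)"] by auto
        then show "|insert (f xs) (set xs)| \<le>o |UNIV :: 'u set|"
          using ordLeq_total[OF card_of_Well_order card_of_Well_order] by blast
      qed
    qed (use A in blast)
    ultimately obtain M where M: "M \<in> T" "B \<subseteq> carrier M" using absorb by blast
    obtain K where K: "K \<in> T" "R M K" using step[OF M(1)] by blast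
    interpret M: ortholattice M by (rule T_ortho[OF M(1)])
    define f' where "f' xs = (if xs \<in> A then f xs else \<bottom>\<^bsub>M\<^esub>)" for xs
    have fM: "f xs \<in> carrier M" "set xs \<subseteq> carrier M" if "xs \<in> A" for xs
      using M(2) that by (auto simp: B_def)
    then have "f' \<in> tuples M n \<rightarrow> carrier M" by (auto simp: f'_def)
    moreover have "A \<subseteq> tuples M n" using A fM(2) by (auto simp: tuples_def)
    ultimately obtain p where p: "orthopolynomial K n p" "\<forall>xs\<in>A. eval_orthoterm K p xs = f' xs"
      using K(2) A unfolding R_def interpolates_def by blast
    have MK: "carrier M \<subseteq> carrier K" using K(2) carrier_mono by (auto simp: R_def)
    have "eval_orthoterm U p xs = f xs" if "xs \<in> A" for xs
      using eval_subortholattice[OF sub_U[OF K(1)] _ p(1), of xs] p(2) that MK \<open>A \<subseteq> tuples M n\<close>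
      by (auto simp: f'_def tuples_def)
    moreover have "orthopolynomial U n p"
      using orthopolynomial_mono[OF subortholatticeD(4)[OF sub_U[OF K(1)]] p(1)] .
    ultimately show "\<exists>p. orthopolynomial U n p \<and> (\<forall>xs\<in>A. eval_orthoterm U p xs = f xs)" by blast
  qed
  then show ?thesis using complete_ortholattice_U sub_U[OF LT] by blast
qed

section \<open>The two extensions\<close>

definition ortho_copy :: "('a \<Rightarrow> 'b) \<Rightarrow> 'a ortholat \<Rightarrow> 'b ortholat" where
  "ortho_copy h L = \<lparr>carrier = h ` carrier L, eq = (=),
     le = (\<lambda>x y. inv_into (carrier L) h x \<sqsubseteq>\<^bsub>L\<^esub> inv_into (carrier L) h y),
     orth = (\<lambda>x. h (orth L (inv_into (carrier L) h x)))\<rparr>"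

lemma ortho_copy:
  assumes L: "complete_ortholattice L" and h: "inj_on h (carrier L)"
  shows "complete_ortholattice (ortho_copy h L)" "ortholattice_iso L (ortho_copy h L) h"
proof -
  interpret L: complete_ortholattice L by fact
  let ?M = "ortho_copy h L"
  have car: "carrier ?M = h ` carrier L" and eqM: "eq ?M = (=)" by (simp_all add: ortho_copy_def)
  have le: "h x \<sqsubseteq>\<^bsub>?M\<^esub> h y \<longleftrightarrow> x \<sqsubseteq>\<^bsub>L\<^esub> y" and orth: "orth ?M (h x) = h (orth L x)"
    if "x \<in> carrier L" "y \<in> carrier L" for x y
    using that h by (simp_all add: ortho_copy_def)
  have po: "partial_order ?M"
    by (rule partial_orderI_eq[OF eqM]) (auto simp: car le intro: L.le_trans L.le_antisym[THEN arg_cong])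
  have "complete_lattice ?M"
  proof (rule complete_lattice_if_infs[OF po])
    fix A assume "A \<subseteq> carrier ?M"
    then obtain B where B: "B \<subseteq> carrier L" "A = h ` B" by (auto simp: car subset_image_iff)
    have "y \<sqsubseteq>\<^bsub>L\<^esub> \<Sqinter>\<^bsub>L\<^esub>B \<longleftrightarrow> (\<forall>b\<in>B. y \<sqsubseteq>\<^bsub>L\<^esub> b)" if "y \<in> carrier L" for y
      by (rule L.le_Inf_iff[OF B(1) that])
    then show "\<exists>g\<in>carrier ?M. \<forall>y\<in>carrier ?M. y \<sqsubseteq>\<^bsub>?M\<^esub> g \<longleftrightarrow> (\<forall>a\<in>A. y \<sqsubseteq>\<^bsub>?M\<^esub> a)"
      using B by (intro bexI[of _ "h (\<Sqinter>\<^bsub>L\<^esub>B)"]) (auto simp: car le subset_iff)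
  qed
  then interpret M: complete_lattice ?M .
  interpret M: bounded_lattice ?M by unfold_locales
  have bounds: "\<bottom>\<^bsub>?M\<^esub> = h \<bottom>\<^bsub>L\<^esub>" "\<top>\<^bsub>?M\<^esub> = h \<top>\<^bsub>L\<^esub>"
    by (rule M.bottom_eqI M.top_eqI; auto simp: car le)+
  have ops: "h x \<squnion>\<^bsub>?M\<^esub> h y = h (x \<squnion>\<^bsub>L\<^esub> y)" "h x \<sqinter>\<^bsub>?M\<^esub> h y = h (x \<sqinter>\<^bsub>L\<^esub> y)"
    if "x \<in> carrier L" "y \<in> carrier L" for x y
  proof -
    note o = L.join_closed[OF that] L.meet_closed[OF that]
    show "h x \<squnion>\<^bsub>?M\<^esub> h y = h (x \<squnion>\<^bsub>L\<^esub> y)"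
      by (rule M.join_eqI) (use that o L.join_left L.join_right L.join_le in \<open>auto simp: car le\<close>)
    show "h x \<sqinter>\<^bsub>?M\<^esub> h y = h (x \<sqinter>\<^bsub>L\<^esub> y)"
      by (rule M.meet_eqI) (use that o L.meet_left L.meet_right L.meet_le in \<open>auto simp: car le\<close>)
  qed
  show "complete_ortholattice ?M"
    by unfold_locales
      (auto simp: car le orth ops bounds L.orth_closed L.orth_orth L.join_orth L.meet_orth intro: L.orth_antitone)
  show "ortholattice_iso L ?M h"
    using h by (auto simp: ortholattice_iso_def lattice_iso_def bij_betw_def car ops orth bounds)
qed

theorem theorem4p5:
  fixes L :: "'a ortholat" and \<kappa> :: "'k rel"
  assumes "complete_ortholattice L" and "Card_order \<kappa>"
  shows
    "(\<exists>(L0 :: ('a, 'k) ext ortholat) (L1 :: ('a, 'k) ext gorder) (Lbar :: ('a, 'k) ext ortholat).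
        (\<exists>j. ortholattice_iso L L0 j) \<and>
        complete_ortholattice Lbar \<and> subortholattice L0 Lbar \<and>
        (\<forall>f \<in> carrier L0 \<rightarrow> carrier L0.
           \<exists>p. orthopolynomial Lbar 1 p \<and> (\<forall>a\<in>carrier L0. eval_orthoterm Lbar p [a] = f a)) \<and>
        L0 \<unlhd> L1 \<and> is_ortho Lbar L1 L0 \<and>
        convex_in (carrier L0) Lbar \<and>
        ((finite (Field \<kappa>) \<longrightarrow> card (Field \<kappa>) \<le> 1) \<longrightarrow> card_power_closed \<kappa> Lbar)) \<and>
     (\<exists>(L0 :: ('a, 'k) ext ortholat) (Lhat :: ('a, 'k) ext ortholat).
        (\<exists>j. ortholattice_iso L L0 j) \<and>
        complete_ortholattice Lhat \<and> subortholattice L0 Lhat \<and>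
        (\<forall>n. \<forall>f \<in> tuples Lhat n \<rightarrow> carrier Lhat. \<forall>A. A \<subseteq> tuples Lhat n \<and> |A| \<le>o \<kappa> \<longrightarrow>
           (\<exists>p. orthopolynomial Lhat n p \<and> (\<forall>as\<in>A. eval_orthoterm Lhat p as = f as))))"
proof -
  let ?u = "TYPE('a + 'k + nat)" and ?U = "UNIV :: ('a + 'k + nat) set"
  have inf: "infinite ?U" by simp
  have \<kappa>_le: "\<kappa> \<le>o |?U|"
  proof -
    have "|Field \<kappa>| \<le>o |?U|"
      using card_of_ordLeq[of "Field \<kappa>" ?U] by (metis UNIV_I comp_inj_on inj_Inl inj_Inr inj_on_subset subset_UNIV)
    then show ?thesis using card_of_Field_ordIso[OF assms(2)] ordIso_symmetric ordIso_ordLeq_trans by blast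
  qed
  define j :: "'a \<Rightarrow> ('a, 'k) ext" where "j x = {{Inl x}}" for x
  have inj: "inj_on j X" for X by (auto simp: inj_on_def j_def)
  define L0 where "L0 = ortho_copy j L"
  have L0: "complete_ortholattice L0" "ortholattice_iso L L0 j"
    unfolding L0_def using ortho_copy[OF assms(1) inj] by auto
  have car: "carrier L0 = j ` carrier L" by (simp add: L0_def ortho_copy_def)
  have "carrier L0 \<subseteq> (\<lambda>a. {a}) ` (UNIV :: ('a + 'k + nat) set set)" by (auto simp: car j_def)
  then have fits: "fits ?u (carrier L0)" using fits_mono[OF fits_image[OF fits_UNIV]] by blast
  obtain L1 :: "('a, 'k) ext gorder" and M where M: "complete_ortholattice M" "subortholattice L0 M"
    "convex_in (carrier L0) M" "L0 \<unlhd> L1" "is_ortho M L1 L0" "interpolates ?u L0 M" "squares_embed ?u M"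
    using extension_step[OF L0(1) inf fits] by blast
  have unary: "\<exists>p. orthopolynomial M 1 p \<and> (\<forall>a\<in>carrier L0. eval_orthoterm M p [a] = f a)"
    if f: "f \<in> carrier L0 \<rightarrow> carrier L0" for f
  proof -
    have t: "tuples L0 1 = (\<lambda>x. [j x]) ` carrier L"
      by (auto simp: tuples_def car length_Suc_conv)
    have "(f \<circ> hd) \<in> tuples L0 1 \<rightarrow> carrier L0"
    proof (rule funcsetI)
      fix xs assume "xs \<in> tuples L0 1"
      then have "hd xs \<in> carrier L0" unfolding t car by auto
      then show "(f \<circ> hd) xs \<in> carrier L0" using funcset_mem[OF f] by simp
    qed
    moreover have "|tuples L0 1| \<le>o |?U|"
    proof -
      have "|tuples L0 1| \<le>o |UNIV :: 'a set|"
        unfolding t using card_of_image card_of_mono1[of "carrier L" UNIV] ordLeq_transitive by blast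
      moreover have "|UNIV :: 'a set| \<le>o |?U|"
        using card_of_ordLeq[of "UNIV :: 'a set" ?U] inj_Inl by blast
      ultimately show ?thesis by (rule ordLeq_transitive)
    qed
    ultimately obtain p where "orthopolynomial M 1 p" "\<forall>xs\<in>tuples L0 1. eval_orthoterm M p xs = (f \<circ> hd) xs"
      using M(6) unfolding interpolates_def by blast
    then show ?thesis unfolding t car by auto
  qed
  have power: "card_power_closed \<kappa> M" if \<kappa>: "finite (Field \<kappa>) \<longrightarrow> card (Field \<kappa>) \<le> 1"
  proof (rule card_power_closedI[OF _ assms(2) \<kappa>])
    interpret M: complete_ortholattice M by (rule M)
    show "lattice M" by unfold_locales
    fix S assume S: "sublattice_set S M" "|S \<times> S| \<le>o \<kappa>"
    then have "|S \<times> S| \<le>o |?U|" using \<kappa>_le ordLeq_transitive by blast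
    then show "(\<exists>a. S = {a}) \<or> (\<exists>h. sublattice_set (h ` (S \<times> S)) M \<and>
        lattice_iso (prod_lattice (M\<lparr>carrier := S\<rparr>) (M\<lparr>carrier := S\<rparr>)) (M\<lparr>carrier := h ` (S \<times> S)\<rparr>) h)"
      using M(7) S(1) unfolding squares_embed_def by blast
  qed
  obtain H :: "('a, 'k) ext ortholat" where H: "complete_ortholattice H" "subortholattice L0 H" "interpolates ?u H H"
    using self_interpolating_extension[OF L0(1) inf fits] by blast
  have local: "\<exists>p. orthopolynomial H n p \<and> (\<forall>as\<in>A. eval_orthoterm H p as = f as)"
    if "f \<in> tuples H n \<rightarrow> carrier H" "A \<subseteq> tuples H n \<and> |A| \<le>o \<kappa>" for n f A
  proof -
    have "|A| \<le>o |?U|" using that(2) \<kappa>_le ordLeq_transitive by blast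
    then show ?thesis using H(3) that unfolding interpolates_def by blast
  qed
  show ?thesis
    by (rule conjI; rule exI[of _ L0])
      ((rule exI[of _ L1], rule exI[of _ M], use L0(2) M(1-5) unary power in blast),
       (rule exI[of _ H], use L0(2) H(1,2) local in blast))
qed

end
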